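(* Let $w$ be a standard Brownian motion on $[0,T]$, $T>0$, let $\beta,\gamma\in(0,1)$, $X_0\in\mathbb{R}$, and let $$\mathfrak{m}_1(t)=\frac{1}{\sqrt{T}},\qquad \mathfrak{m}_k(t)=\sqrt{\frac{2}{T}}\cos\Big(\frac{\pi t(k-1)}{T}\Big),\quad k\ge 2.$$ If $\gamma-\beta\ge\frac12$, then the equation $J^{1-\beta}X(t)=J^{1-\gamma}w(t)$, $X(0)=X_0$ (understood coefficient-by-coefficient in the chaos expansion), defines a $\mathfrak{q}$-generalized process $X$ for every sequence $\mathfrak{q}=\{q_k,\ k\ge1\}$ with $0<q_k<1$ satisfying $$\sum_{k\ge1}k^{2(\gamma-\beta-1)}q_k<\infty.$$
   Context: For $p>0$, $I^pf(t)=\frac1{\Gamma(p)}\int_0^t(t-s)^{p-1}f(s)\,ds$ and $J^pf(t)=\frac1{\Gamma(p)}\int_0^t(t-s)^{p-1}(f(s)-f(0))\,ds$. Chaos expansion: $\{\mathfrak{m}_k\}$ is an orthonormal basis of $L_2((0,T))$, $\xi_k=\int_0^T\mathfrak{m}_k(t)\,dw(t)$; $\mathcal{J}$ is the set of multi-indices $\boldsymbol{\alpha}=(\alpha_k,\,k\ge1)$ with $\alpha_k\in\{0,1,2,\dots\}$ and $|\boldsymbol{\alpha}|=\sum_k\alpha_k<\infty$; $\xi_{\boldsymbol{\alpha}}=\prod_k \mathrm{H}_{\alpha_k}(\xi_k)/\sqrt{\alpha_k!}$ with $\mathrm{H}_n(x)=(-1)^ne^{x^2/2}\frac{d^n}{dx^n}e^{-x^2/2}$.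 In particular $w(t)=\sum_{k\ge1}\xi_k\int_0^t\mathfrak{m}_k(s)\,ds$. A formal series $X(t)=\sum_{\boldsymbol{\alpha}\in\mathcal{J}}x_{\boldsymbol{\alpha}}(t)\xi_{\boldsymbol{\alpha}}$ satisfies $J^{1-\beta}X=J^{1-\gamma}w$, $X(0)=X_0$, coefficient-by-coefficient if, for each $\boldsymbol{\alpha}$, $J^{1-\beta}x_{\boldsymbol{\alpha}}$ is the coefficient of $\xi_{\boldsymbol{\alpha}}$ in the chaos expansion of $J^{1-\gamma}w$ and $x_{\boldsymbol{\alpha}}(0)$ is the coefficient of $\xi_{\boldsymbol\alpha}$ in the expansion of $X_0$; explicitly, this is the series $X(t)=X_0+\sum_{k\ge1}\xi_k\,I^{1-(\gamma-\beta)}\mathfrak{m}_k(t)$. For a sequence $\mathfrak{q}=\{q_k\}$ with $0<q_k<1$, put $\mathfrak{q}^{\boldsymbol{\alpha}}=\prod_kq_k^{\alpha_k}$. A $\mathfrak{q}$-generalized process on $(0,T)$ is a formal series $X(t)=\sum_{\boldsymbol{\alpha}\in\mathcal{J}}x_{\boldsymbol{\alpha}}(t)\xi_{\boldsymbol{\alpha}}$ with non-random $x_{\boldsymbol{\alpha}}\in L_2((0,T))$ and $\sum_{\boldsymbol{\alpha}\in\mathcal{J}}\mathfrak{q}^{\boldsymbol{\alpha}}\|x_{\boldsymbol{\alpha}}\|^2_{L_2((0,T))}<\infty$. *)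

theory Defs
  imports "HOL-Probability.Probability" "HOL-Library.Poly_Mapping"
begin

definition frac_I :: "real \<Rightarrow> (real \<Rightarrow> real) \<Rightarrow> real \<Rightarrow> real" where
  "frac_I p f t = (LBINT s:{0..t}. (t - s) powr (p - 1) * f s) / Gamma p"

definition frac_J :: "real \<Rightarrow> (real \<Rightarrow> real) \<Rightarrow> real \<Rightarrow> real" where
  "frac_J p f t = frac_I p (\<lambda>s. f s - f 0) t"

text \<open>The paths are required to be continuous surely and not only almost surely: on a
  probability space that need not be complete, this makes pathwise integrals such as
  \<open>\<lambda>\<omega>. frac_J p (\<lambda>s. w s \<omega>) t\<close> random variables.\<close>

locale brownian_motion = prob_space M for M :: "'a measure" +
  fixes T :: real and w :: "real \<Rightarrow> 'a \<Rightarrow> real"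
  assumes random_variable: "\<And>t. t \<in> {0..T} \<Longrightarrow> w t \<in> borel_measurable M"
    and start_at_0: "AE \<omega> in M. w 0 \<omega> = 0"
    and continuous_paths: "\<And>\<omega>. \<omega> \<in> space M \<Longrightarrow> continuous_on {0..T} (\<lambda>t. w t \<omega>)"
    and normal_increments: "\<And>s t. 0 \<le> s \<Longrightarrow> s < t \<Longrightarrow> t \<le> T \<Longrightarrow>
      distributed M lborel (\<lambda>\<omega>. w t \<omega> - w s \<omega>) (normal_density 0 (sqrt (t - s)))"
    and indep_increments: "\<And>n (t :: nat \<Rightarrow> real).
      (\<forall>i\<le>n. t i \<in> {0..T}) \<Longrightarrow> (\<forall>i<n. t i < t (Suc i)) \<Longrightarrow>
      indep_vars (\<lambda>_. borel) (\<lambda>i \<omega>. w (t (Suc i)) \<omega> - w (t i) \<omega>) {..<n}"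

definition L2_on :: "real set \<Rightarrow> (real \<Rightarrow> real) \<Rightarrow> bool" where
  "L2_on A f \<longleftrightarrow> set_borel_measurable lborel A f \<and> set_integrable lborel A (\<lambda>t. (f t)\<^sup>2)"

definition L2_norm_sq :: "real set \<Rightarrow> (real \<Rightarrow> real) \<Rightarrow> real" where
  "L2_norm_sq A f = (LBINT t:A. (f t)\<^sup>2)"

text \<open>A list of triples \<open>(c, a, b)\<close> represents the step function which is the sum of
  the \<open>c\<close> times the indicator function of \<open>{a<..b}\<close>.\<close>

definition step_fun :: "(real \<times> real \<times> real) list \<Rightarrow> real \<Rightarrow> real" where
  "step_fun S t = (\<Sum>(c, a, b)\<leftarrow>S. c * indicator {a<..b} t)"

definition step_integral ::
    "(real \<Rightarrow> 'a \<Rightarrow> real) \<Rightarrow> (real \<times> real \<times> real) list \<Rightarrow> 'a \<Rightarrow> real" where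
  "step_integral w S \<omega> = (\<Sum>(c, a, b)\<leftarrow>S. c * (w b \<omega> - w a \<omega>))"

text \<open>\<open>has_wiener_integral M T w f Z\<close> says that \<open>Z\<close> is a version of the stochastic
  integral of the deterministic function \<open>f\<close> over \<open>(0, T)\<close> with respect to \<open>w\<close>, i.e. the
  mean-square limit of the integrals of step functions converging to \<open>f\<close> in \<open>L\<^sub>2\<close>.\<close>

definition has_wiener_integral ::
    "'a measure \<Rightarrow> real \<Rightarrow> (real \<Rightarrow> 'a \<Rightarrow> real) \<Rightarrow> (real \<Rightarrow> real) \<Rightarrow> ('a \<Rightarrow> real) \<Rightarrow> bool" where
  "has_wiener_integral M T w f Z \<longleftrightarrow>
     L2_on {0<..<T} f \<and> Z \<in> borel_measurable M \<and> integrable M (\<lambda>\<omega>. (Z \<omega>)\<^sup>2) \<and>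
     (\<exists>S :: nat \<Rightarrow> (real \<times> real \<times> real) list.
        (\<forall>n. \<forall>(c, a, b)\<in>set (S n). 0 \<le> a \<and> a \<le> b \<and> b \<le> T) \<and>
        (\<lambda>n. L2_norm_sq {0<..<T} (\<lambda>t. step_fun (S n) t - f t)) \<longlonglongrightarrow> 0 \<and>
        (\<lambda>n. \<integral>\<omega>. (step_integral w (S n) \<omega> - Z \<omega>)\<^sup>2 \<partial>M) \<longlonglongrightarrow> 0)"

text \<open>The basis functions are indexed by \<open>k \<ge> 1\<close>; the value at \<open>k = 0\<close> is never used.\<close>

definition cos_basis :: "real \<Rightarrow> nat \<Rightarrow> real \<Rightarrow> real" where
  "cos_basis T k t =
     (if k = 1 then 1 / sqrt T else sqrt (2 / T) * cos (pi * t * (real k - 1) / T))"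

text \<open>Multi-indices, with entries indexed by \<open>k \<ge> 1\<close>.\<close>

definition multi_indices :: "(nat \<Rightarrow>\<^sub>0 nat) set" where
  "multi_indices = {\<alpha>. Poly_Mapping.keys \<alpha> \<subseteq> {1..}}"

definition hermite :: "nat \<Rightarrow> real \<Rightarrow> real" where
  "hermite n x = (-1) ^ n * exp (x\<^sup>2 / 2) * (deriv ^^ n) (\<lambda>y. exp (- (y\<^sup>2 / 2))) x"

definition chaos_basis :: "(nat \<Rightarrow> 'a \<Rightarrow> real) \<Rightarrow> (nat \<Rightarrow>\<^sub>0 nat) \<Rightarrow> 'a \<Rightarrow> real" where
  "chaos_basis \<xi> \<alpha> \<omega> =
     (\<Prod>k\<in>Poly_Mapping.keys \<alpha>. hermite (Poly_Mapping.lookup \<alpha> k) (\<xi> k \<omega>) / sqrt (fact (Poly_Mapping.lookup \<alpha> k)))"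

text \<open>By the Cameron-Martin theorem the variables \<open>chaos_basis \<xi> \<alpha>\<close> form an orthonormal
  basis of the square-integrable functionals of \<open>w\<close>; the coefficients of the chaos expansion
  of such a functional are therefore its inner products with the basis elements.\<close>

definition chaos_coeff ::
    "'a measure \<Rightarrow> (nat \<Rightarrow> 'a \<Rightarrow> real) \<Rightarrow> ('a \<Rightarrow> real) \<Rightarrow> (nat \<Rightarrow>\<^sub>0 nat) \<Rightarrow> real" where
  "chaos_coeff M \<xi> \<eta> \<alpha> = (\<integral>\<omega>. \<eta> \<omega> * chaos_basis \<xi> \<alpha> \<omega> \<partial>M)"

text \<open>A formal series is represented by the family \<open>X\<close> of its coefficients; only the values
  at indices in \<open>multi_indices\<close> matter. The predicate states that the series solves
  \<open>J\<^sup>1\<^sup>-\<^sup>\<beta> X = J\<^sup>1\<^sup>-\<^sup>\<gamma> w\<close>, \<open>X(0) = X\<^sub>0\<close> on \<open>[0, T]\<close> coefficient by coefficient.\<close>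

definition solves_coeffwise ::
    "'a measure \<Rightarrow> real \<Rightarrow> (real \<Rightarrow> 'a \<Rightarrow> real) \<Rightarrow> (nat \<Rightarrow> 'a \<Rightarrow> real) \<Rightarrow> real \<Rightarrow> real \<Rightarrow> real \<Rightarrow>
     ((nat \<Rightarrow>\<^sub>0 nat) \<Rightarrow> real \<Rightarrow> real) \<Rightarrow> bool" where
  "solves_coeffwise M T w \<xi> \<beta> \<gamma> X\<^sub>0 X \<longleftrightarrow>
     (\<forall>\<alpha>\<in>multi_indices.
        set_integrable lborel {0..T} (X \<alpha>) \<and>
        (\<forall>t\<in>{0..T}. frac_J (1 - \<beta>) (X \<alpha>) t =
           chaos_coeff M \<xi> (\<lambda>\<omega>. frac_J (1 - \<gamma>) (\<lambda>s. w s \<omega>) t) \<alpha>) \<and>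
        X \<alpha> 0 = chaos_coeff M \<xi> (\<lambda>_. X\<^sub>0) \<alpha>)"

definition weight_pow :: "(nat \<Rightarrow> real) \<Rightarrow> (nat \<Rightarrow>\<^sub>0 nat) \<Rightarrow> real" where
  "weight_pow q \<alpha> = (\<Prod>k\<in>Poly_Mapping.keys \<alpha>. q k ^ Poly_Mapping.lookup \<alpha> k)"

definition q_generalized_process ::
    "(nat \<Rightarrow> real) \<Rightarrow> real \<Rightarrow> ((nat \<Rightarrow>\<^sub>0 nat) \<Rightarrow> real \<Rightarrow> real) \<Rightarrow> bool" where
  "q_generalized_process q T X \<longleftrightarrow>
     (\<forall>\<alpha>\<in>multi_indices. L2_on {0<..<T} (X \<alpha>)) \<and>
     (\<lambda>\<alpha>. weight_pow q \<alpha> * L2_norm_sq {0<..<T} (X \<alpha>)) summable_on multi_indices"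

end

theory Submission
  imports Defs "HOL-Computational_Algebra.Polynomial"
begin

text \<open>
  Put \<open>p = 1 - (\<gamma> - \<beta>)\<close>, so that \<open>0 < p < 1\<close>, and let \<open>e k\<close> be the multi-index whose only nonzero
  entry is a one in position \<open>k\<close>. The solution has the coefficients \<open>X\<^sub>0\<close> at the multi-index \<open>0\<close>,
  the fractional integral of order \<open>p\<close> of the cosine \<open>m\<^sub>k\<close> at \<open>e k\<close>, and \<open>0\<close> at all others.

  \<^emph>\<open>The driving term.\<close> Since \<open>w s - w 0\<close> and the \<open>\<xi>\<^sub>k\<close> are Wiener integrals, they are jointly Gaussian.
  Subtracting from \<open>w s - w 0\<close> its projection onto finitely many \<open>\<xi>\<^sub>k\<close> leaves a centred variable that is
  independent of these \<open>\<xi>\<^sub>k\<close>, hence orthogonal to every polynomial in them, and the moments of Hermite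
  polynomials under the Gaussian measure annihilate all products \<open>\<xi>\<^sub>j \<xi>\<^sub>\<alpha>\<close> except those with \<open>\<alpha> = e j\<close>
  (\<open>wiener_integral_chaos_coeff\<close>). So only the coefficients at the \<open>e k\<close> survive, and there they are
  \<open>I\<^sup>1 m\<^sub>k\<close>. By Fubini's theorem, taking a coefficient commutes with fractional integration in time
  (\<open>frac_J_chaos_coeff\<close>). Independence comes from characteristic functions: the law of a Wiener integral
  is determined by the \<open>L\<^sub>2\<close> norm of the integrand (\<open>wiener_integral_iexp\<close>), so for orthogonal integrands
  the joint characteristic function factorises, and this implies independence
  (\<open>indep_vars_if_iexp_factor\<close>).

  \<^emph>\<open>Existence and uniqueness.\<close> The semigroup law \<open>I\<^sup>a I\<^sup>b = I\<^bsup>a+b\<^esup>\<close> (\<open>frac_I_frac_I\<close>) gives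
  \<open>I\<^bsup>1-\<beta>\<^esup> I\<^sup>p m\<^sub>k = I\<^bsup>2-\<gamma>\<^esup> m\<^sub>k = I\<^bsup>1-\<gamma>\<^esup> I\<^sup>1 m\<^sub>k\<close>, which is the equation at \<open>e k\<close>. The same law
  shows that \<open>I\<^bsup>1-\<beta>\<^esup>\<close> is injective up to null sets, as \<open>I\<^sup>\<beta> I\<^bsup>1-\<beta>\<^esup>\<close> is ordinary integration
  (\<open>frac_I_inject\<close>).

  \<^emph>\<open>Size.\<close> The kernel \<open>(t - s)\<^bsup>p-1\<^esup>\<close> is singular only at \<open>s = t\<close>. Splitting the integral at distance
  \<open>1 / c\<close> from this point and integrating the remaining part by parts shows that the fractional integral of
  \<open>cos (c s)\<close> is \<open>O(c\<^bsup>-p\<^esup>)\<close> uniformly in \<open>t\<close> (\<open>cos_kernel_bound\<close>). The squared norm of the \<open>k\<close>-th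
  coefficient is therefore \<open>O(k\<^bsup>-2p\<^esup>)\<close>, and \<open>-2p = 2(\<gamma> - \<beta> - 1)\<close> is the exponent in the condition on
  the weights.
\<close>

section \<open>Hermite polynomials under the Gaussian measure\<close>

text \<open>The recursion \<open>H\<^sub>n\<^sub>+\<^sub>1 = x H\<^sub>n - H\<^sub>n'\<close> is what differentiating
  \<open>H\<^sub>n(x) exp (- x\<^sup>2 / 2)\<close> once more produces.\<close>

fun hermite_poly :: "nat \<Rightarrow> real poly" where
  "hermite_poly 0 = 1"
| "hermite_poly (Suc n) = [:0, 1:] * hermite_poly n - pderiv (hermite_poly n)"

lemma higher_deriv_gaussian:
  "(deriv ^^ n) (\<lambda>y::real. exp (- (y\<^sup>2 / 2))) =
     (\<lambda>x. (-1) ^ n * poly (hermite_poly n) x * exp (- (x\<^sup>2 / 2)))"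
proof (induction n)
  case (Suc n)
  have "((\<lambda>x. (-1) ^ n * poly (hermite_poly n) x * exp (- (x\<^sup>2 / 2))) has_real_derivative
      (-1) ^ Suc n * poly (hermite_poly (Suc n)) x * exp (- (x\<^sup>2 / 2))) (at x)" for x
    by (auto intro!: derivative_eq_intros poly_DERIV simp: algebra_simps)
  then show ?case
    by (auto simp: Suc.IH intro!: DERIV_imp_deriv)
qed simp

lemma hermite_eq_poly: "hermite n x = poly (hermite_poly n) x"
proof -
  have "hermite n x = ((-1) ^ n * (-1) ^ n) * poly (hermite_poly n) x * (exp (x\<^sup>2 / 2) * exp (- (x\<^sup>2 / 2)))"
    unfolding hermite_def higher_deriv_gaussian by (simp only: mult_ac)
  then show ?thesis by (simp flip: power_mult_distrib exp_add)
qed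

lemma hermite_1 [simp]: "hermite (Suc 0) x = x"
  by (simp add: hermite_eq_poly)

lemma hermite_measurable [measurable]: "hermite n \<in> borel_measurable borel"
  unfolding hermite_eq_poly[abs_def] by (intro borel_measurable_continuous_onI continuous_intros)

lemma integrable_gaussian_poly: "integrable lborel (\<lambda>x. std_normal_density x * poly p x)"
proof -
  have "integrable lborel (\<lambda>x. \<Sum>i\<le>degree p. coeff p i * (std_normal_density x * x ^ i))"
    by (intro Bochner_Integration.integrable_sum integrable_mult_right integrable_std_normal_moment)
  then show ?thesis by (simp add: poly_altdef sum_distrib_left mult_ac)
qed

lemma gaussian_moment_recursion:
  "(\<integral>x. std_normal_density x * x ^ Suc k \<partial>lborel) = real k * (\<integral>x. std_normal_density x * x ^ (k - 1) \<partial>lborel)"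
proof (cases "even k")
  case True
  then obtain m where k: "k = 2 * m" by blast
  show ?thesis
  proof (cases m)
    case 0
    then show ?thesis using integral_std_normal_moment_odd[of 0] by (simp add: k)
  next
    case (Suc l)
    have e: "k - 1 = 2 * l + 1" "Suc k = 2 * (Suc l) + 1" using Suc by (auto simp: k)
    show ?thesis unfolding e integral_std_normal_moment_odd by simp
  qed
next
  case False
  then obtain m where k: "k = 2 * m + 1" by (elim oddE)
  have e: "Suc k = 2 * Suc m" "k - 1 = 2 * m" by (auto simp: k)
  show ?thesis
    unfolding e integral_std_normal_moment_even by (simp add: k divide_simps)
qed

text \<open>Linearity reduces this to monomials, where it is the recursion for the Gaussian moments; no
  boundary terms have to be controlled in this way.\<close>

lemma gaussian_integration_by_parts:
  "(\<integral>x. std_normal_density x * (x * poly p x) \<partial>lborel) =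
   (\<integral>x. std_normal_density x * poly (pderiv p) x \<partial>lborel)"
proof -
  have D: "poly (pderiv p) x = (\<Sum>i\<le>degree p. coeff p i * (real i * x ^ (i - 1)))" for x :: real
  proof -
    have "((\<lambda>x. \<Sum>i\<le>degree p. coeff p i * x ^ i) has_real_derivative (\<Sum>i\<le>degree p. coeff p i * (real i * x ^ (i - 1)))) (at x)"
      by (auto intro!: derivative_eq_intros sum.cong)
    moreover have "(poly p has_real_derivative poly (pderiv p) x) (at x)" by (rule poly_DERIV)
    ultimately show ?thesis
      using DERIV_unique unfolding poly_altdef[abs_def] by fast
  qed
  have "(\<integral>x. std_normal_density x * (x * poly p x) \<partial>lborel)
      = (\<integral>x. (\<Sum>i\<le>degree p. coeff p i * (std_normal_density x * x ^ Suc i)) \<partial>lborel)"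
    by (simp add: poly_altdef sum_distrib_left mult_ac)
  also have "\<dots> = (\<Sum>i\<le>degree p. coeff p i * (\<integral>x. std_normal_density x * x ^ Suc i \<partial>lborel))"
    using integrable_std_normal_moment
    by (subst Bochner_Integration.integral_sum) (auto simp del: power_Suc)
  also have "\<dots> = (\<Sum>i\<le>degree p. coeff p i * (real i * (\<integral>x. std_normal_density x * x ^ (i - 1) \<partial>lborel)))"
    by (simp only: gaussian_moment_recursion)
  also have "\<dots> = (\<integral>x. (\<Sum>i\<le>degree p. coeff p i * (real i * (std_normal_density x * x ^ (i - 1)))) \<partial>lborel)"
    using integrable_std_normal_moment
    by (subst Bochner_Integration.integral_sum) auto
  also have "\<dots> = (\<integral>x. std_normal_density x * poly (pderiv p) x \<partial>lborel)"
    unfolding D by (simp add: sum_distrib_left mult_ac)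
  finally show ?thesis .
qed

lemma gaussian_hermite_mean:
  assumes "n \<ge> 1"
  shows "(\<integral>x. std_normal_density x * hermite n x \<partial>lborel) = 0"
proof -
  from assms obtain m where n: "n = Suc m" by (cases n) auto
  have "(\<integral>x. std_normal_density x * hermite n x \<partial>lborel) =
     (\<integral>x. std_normal_density x * poly ([:0, 1:] * hermite_poly m) x
        - std_normal_density x * poly (pderiv (hermite_poly m)) x \<partial>lborel)"
    by (simp add: hermite_eq_poly n right_diff_distrib)
  also have "\<dots> = (\<integral>x. std_normal_density x * poly ([:0, 1:] * hermite_poly m) x \<partial>lborel)
     - (\<integral>x. std_normal_density x * poly (pderiv (hermite_poly m)) x \<partial>lborel)"
    by (intro Bochner_Integration.integral_diff integrable_gaussian_poly)
  finally show ?thesis by (simp add: gaussian_integration_by_parts)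
qed

text \<open>Two integrations by parts turn \<open>x H\<^sub>n\<close> into \<open>H\<^sub>n\<^sub>-\<^sub>1\<close>, whose mean vanishes unless \<open>n = 1\<close>.\<close>

lemma gaussian_hermite_first_moment:
  assumes "n \<noteq> 1"
  shows "(\<integral>x. std_normal_density x * (x * hermite n x) \<partial>lborel) = 0"
proof (cases n)
  case 0
  then show ?thesis
    using gaussian_integration_by_parts[of 1] by (simp add: hermite_eq_poly)
next
  case (Suc m)
  let ?h = "hermite_poly m"
  have "(\<integral>x. std_normal_density x * (x * hermite n x) \<partial>lborel)
      = (\<integral>x. std_normal_density x * poly (pderiv (hermite_poly n)) x \<partial>lborel)"
    by (simp add: hermite_eq_poly gaussian_integration_by_parts)
  also have "\<dots> = (\<integral>x. std_normal_density x * poly ?h x + std_normal_density x * poly ([:0, 1:] * pderiv ?h) x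
      - std_normal_density x * poly (pderiv (pderiv ?h)) x \<partial>lborel)"
    by (simp add: Suc pderiv_diff pderiv_mult pderiv_pCons algebra_simps)
  also have "\<dots> = (\<integral>x. std_normal_density x * poly ?h x \<partial>lborel)
      + (\<integral>x. std_normal_density x * poly ([:0, 1:] * pderiv ?h) x \<partial>lborel)
      - (\<integral>x. std_normal_density x * poly (pderiv (pderiv ?h)) x \<partial>lborel)"
    by (subst Bochner_Integration.integral_diff Bochner_Integration.integral_add;
        (intro Bochner_Integration.integrable_add integrable_gaussian_poly)?)+ simp
  also have "\<dots> = (\<integral>x. std_normal_density x * hermite m x \<partial>lborel)"
    by (simp add: gaussian_integration_by_parts hermite_eq_poly)
  also have "\<dots> = 0"
    using assms Suc by (intro gaussian_hermite_mean) auto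
  finally show ?thesis .
qed

definition hermite_normed :: "nat \<Rightarrow> real \<Rightarrow> real" where
  "hermite_normed n x = hermite n x / sqrt (fact n)"

lemma hermite_normed_measurable [measurable]: "hermite_normed n \<in> borel_measurable borel"
  unfolding hermite_normed_def[abs_def] by measurable

lemma hermite_normed_eq_poly: "hermite_normed n x = poly (smult (1 / sqrt (fact n)) (hermite_poly n)) x"
  by (simp add: hermite_normed_def hermite_eq_poly)

lemma integrable_gaussian_hermite:
  "integrable lborel (\<lambda>x. std_normal_density x * hermite_normed n x)"
  "integrable lborel (\<lambda>x. std_normal_density x * (x * hermite_normed n x))"
  "integrable lborel (\<lambda>x. std_normal_density x * (hermite_normed n x)\<^sup>2)"
  using integrable_gaussian_poly[of "smult (1 / sqrt (fact n)) (hermite_poly n)"]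
    integrable_gaussian_poly[of "[:0, 1:] * smult (1 / sqrt (fact n)) (hermite_poly n)"]
    integrable_gaussian_poly[of "(smult (1 / sqrt (fact n)) (hermite_poly n))\<^sup>2"]
  by (simp_all add: hermite_normed_eq_poly poly_power)

lemma gaussian_hermite_normed_mean:
  "n \<ge> 1 \<Longrightarrow> (\<integral>x. std_normal_density x * hermite_normed n x \<partial>lborel) = 0"
  using gaussian_hermite_mean[of n] by (simp add: hermite_normed_def)

lemma gaussian_hermite_normed_first_moment:
  "n \<noteq> 1 \<Longrightarrow> (\<integral>x. std_normal_density x * (x * hermite_normed n x) \<partial>lborel) = 0"
  using gaussian_hermite_first_moment[of n] by (simp add: hermite_normed_def)

lemma gaussian_second_moment: "(\<integral>x. std_normal_density x * (x * hermite_normed (Suc 0) x) \<partial>lborel) = 1"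
  using integral_std_normal_moment_even[of 1] by (simp add: hermite_normed_def power2_eq_square)

lemma chaos_basis_eq:
  "chaos_basis \<xi> \<alpha> \<omega> = (\<Prod>k\<in>Poly_Mapping.keys \<alpha>. hermite_normed (Poly_Mapping.lookup \<alpha> k) (\<xi> k \<omega>))"
  by (simp add: chaos_basis_def hermite_normed_def)

section \<open>Independence from factorising characteristic functions\<close>

text \<open>After normalisation, \<open>G\<close> is the density of a new probability measure. The hypothesis says that the law
  of \<open>Z\<close> has the same characteristic function under both measures, so the two laws agree by Levy's uniqueness
  theorem.\<close>

lemma (in prob_space) iexp_factor_imp_prob_factor_nonneg:
  fixes Z G :: "'a \<Rightarrow> real"
  assumes [measurable]: "Z \<in> borel_measurable M" "G \<in> borel_measurable M"
    and pos: "\<And>\<omega>. G \<omega> > 0" and bnd: "\<And>\<omega>. G \<omega> \<le> K"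
    and fac: "\<And>u. (\<integral>\<omega>. G \<omega> *\<^sub>R iexp (u * Z \<omega>) \<partial>M) = expectation G *\<^sub>R (\<integral>\<omega>. iexp (u * Z \<omega>) \<partial>M)"
    and [measurable]: "B \<in> sets borel"
  shows "(\<integral>\<omega>. G \<omega> * indicator B (Z \<omega>) \<partial>M) = expectation G * prob (Z -` B \<inter> space M)"
proof -
  have intG: "integrable M G"
    by (rule integrable_const_bound[of _ K]) (use pos bnd in \<open>auto simp: less_imp_le\<close>)
  define c where "c = expectation G"
  have cpos: "c > 0"
  proof -
    have "c \<ge> 0" unfolding c_def using pos by (intro integral_nonneg_AE) (auto simp: less_imp_le)
    moreover have "c \<noteq> 0"
    proof
      assume "c = 0"
      then have "AE \<omega> in M. G \<omega> = 0"
        using integral_nonneg_eq_0_iff_AE[OF intG] pos by (auto simp: c_def less_imp_le)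
      then have "AE \<omega> in M. False" using pos by (auto elim!: eventually_mono simp: less_le)
      then show False using AE_False by simp
    qed
    ultimately show ?thesis by simp
  qed
  define N where "N = density M (\<lambda>\<omega>. G \<omega> / c)"
  have [measurable]: "(\<lambda>\<omega>. G \<omega> / c) \<in> borel_measurable M" by measurable
  have [simp, measurable_cong]: "sets N = sets M" by (simp add: N_def)
  have spN [simp]: "space N = space M" by (simp add: N_def)
  have "prob_space N"
  proof
    have "emeasure N (space N) = (\<integral>\<^sup>+\<omega>. ennreal (G \<omega> / c) \<partial>M)"
      by (simp add: N_def emeasure_density cong: nn_integral_cong_simp)
    also have "\<dots> = ennreal (\<integral>\<omega>. G \<omega> / c \<partial>M)"
      using pos cpos intG by (intro nn_integral_eq_integral) (auto simp: less_imp_le)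
    also have "\<dots> = 1" using cpos by (simp add: c_def)
    finally show "emeasure N (space N) = 1" .
  qed
  then interpret N: prob_space N .
  have "distr N borel Z = distr M borel Z"
  proof (rule Levy_uniqueness)
    show "real_distribution (distr N borel Z)" by (rule N.real_distribution_distr) measurable
    show "real_distribution (distr M borel Z)" by (rule real_distribution_distr) measurable
    show "char (distr N borel Z) = char (distr M borel Z)"
    proof
      fix u
      have "char (distr N borel Z) u = (\<integral>\<omega>. iexp (u * Z \<omega>) \<partial>N)"
        unfolding char_def by (subst integral_distr) auto
      also have "\<dots> = (\<integral>\<omega>. (G \<omega> / c) *\<^sub>R iexp (u * Z \<omega>) \<partial>M)"
        unfolding N_def using pos cpos by (subst integral_density) (auto simp: less_imp_le)
      also have "\<dots> = (\<integral>\<omega>. (1 / c) *\<^sub>R (G \<omega> *\<^sub>R iexp (u * Z \<omega>)) \<partial>M)" by simp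
      also have "\<dots> = (1 / c) *\<^sub>R (\<integral>\<omega>. G \<omega> *\<^sub>R iexp (u * Z \<omega>) \<partial>M)"
        by (rule integral_scaleR_right)
      also have "\<dots> = (\<integral>\<omega>. iexp (u * Z \<omega>) \<partial>M)"
        unfolding fac using cpos by (simp add: c_def)
      also have "\<dots> = char (distr M borel Z) u"
        unfolding char_def by (subst integral_distr) auto
      finally show "char (distr N borel Z) u = char (distr M borel Z) u" .
    qed
  qed
  then have "measure (distr N borel Z) B = measure (distr M borel Z) B" by simp
  then have 1: "measure N (Z -` B \<inter> space M) = prob (Z -` B \<inter> space M)"
    by (simp add: measure_distr)
  have "measure N (Z -` B \<inter> space M) = (\<integral>\<omega>. indicator (Z -` B \<inter> space M) \<omega> \<partial>N)"
    by simp
  also have "\<dots> = (\<integral>\<omega>. (G \<omega> / c) *\<^sub>R indicator (Z -` B \<inter> space M) \<omega> \<partial>M)"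
    unfolding N_def using pos cpos by (subst integral_density) (auto simp: less_imp_le)
  also have "\<dots> = (\<integral>\<omega>. (G \<omega> * indicator B (Z \<omega>)) / c \<partial>M)"
    by (intro Bochner_Integration.integral_cong) (auto simp: indicator_def)
  also have "\<dots> = (\<integral>\<omega>. G \<omega> * indicator B (Z \<omega>) \<partial>M) / c" by simp
  finally show ?thesis using 1 cpos by (simp add: c_def field_simps)
qed

text \<open>Both sides are linear in \<open>G\<close> and agree for constants, so a constant can be added to make \<open>G\<close>
  positive.\<close>

lemma (in prob_space) iexp_factor_imp_prob_factor_real:
  fixes Z G :: "'a \<Rightarrow> real"
  assumes [measurable]: "Z \<in> borel_measurable M" "G \<in> borel_measurable M"
    and bnd: "\<And>\<omega>. \<bar>G \<omega>\<bar> \<le> K"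
    and fac: "\<And>u. (\<integral>\<omega>. G \<omega> *\<^sub>R iexp (u * Z \<omega>) \<partial>M) = expectation G *\<^sub>R (\<integral>\<omega>. iexp (u * Z \<omega>) \<partial>M)"
    and [measurable]: "B \<in> sets borel"
  shows "(\<integral>\<omega>. G \<omega> * indicator B (Z \<omega>) \<partial>M) = expectation G * prob (Z -` B \<inter> space M)"
proof -
  let ?H = "\<lambda>\<omega>. G \<omega> + (K + 1)"
  have intG: "integrable M G" using bnd by (intro integrable_const_bound[of _ K]) auto
  have intI: "integrable M (\<lambda>\<omega>. iexp (u * Z \<omega>))" for u
    by (intro integrable_const_bound[of _ 1]) auto
  have intGI: "integrable M (\<lambda>\<omega>. G \<omega> *\<^sub>R iexp (u * Z \<omega>))" for u
    by (intro integrable_const_bound[of _ K]) (use bnd in auto)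
  have intB: "integrable M (\<lambda>\<omega>. indicator B (Z \<omega>) :: real)"
    by (intro integrable_const_bound[of _ 1]) auto
  have intGB: "integrable M (\<lambda>\<omega>. G \<omega> * indicator B (Z \<omega>))"
    by (intro integrable_const_bound[of _ K]) (use bnd in \<open>auto simp: indicator_def intro: order_trans[OF abs_ge_zero]\<close>)
  have EH: "expectation ?H = expectation G + (K + 1)"
    using intG by (simp add: prob_space)
  have "(\<integral>\<omega>. ?H \<omega> * indicator B (Z \<omega>) \<partial>M) = expectation ?H * prob (Z -` B \<inter> space M)"
  proof (rule iexp_factor_imp_prob_factor_nonneg[where K = "2 * K + 1"])
    show "?H \<omega> > 0" "?H \<omega> \<le> 2 * K + 1" for \<omega>
      using bnd[of \<omega>] by linarith+
    show "(\<integral>\<omega>. ?H \<omega> *\<^sub>R iexp (u * Z \<omega>) \<partial>M) = expectation ?H *\<^sub>R (\<integral>\<omega>. iexp (u * Z \<omega>) \<partial>M)" for u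
    proof -
      have "(\<integral>\<omega>. ?H \<omega> *\<^sub>R iexp (u * Z \<omega>) \<partial>M)
         = (\<integral>\<omega>. G \<omega> *\<^sub>R iexp (u * Z \<omega>) + (K + 1) *\<^sub>R iexp (u * Z \<omega>) \<partial>M)"
        by (intro Bochner_Integration.integral_cong) (auto simp: scaleR_left.add)
      also have "\<dots> = expectation G *\<^sub>R (\<integral>\<omega>. iexp (u * Z \<omega>) \<partial>M) + (K + 1) *\<^sub>R (\<integral>\<omega>. iexp (u * Z \<omega>) \<partial>M)"
        using intI[of u] intGI[of u] fac[of u]
        by (subst Bochner_Integration.integral_add) (auto intro: integrable_scaleR_right simp del: scaleR_conv_of_real)
      finally show ?thesis unfolding EH by (simp add: scaleR_left.add)
    qed
  qed auto
  moreover have "(\<integral>\<omega>. ?H \<omega> * indicator B (Z \<omega>) \<partial>M)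
      = (\<integral>\<omega>. G \<omega> * indicator B (Z \<omega>) \<partial>M) + (K + 1) * prob (Z -` B \<inter> space M)"
  proof -
    have *: "(\<integral>\<omega>. indicator B (Z \<omega>) \<partial>M) = prob (Z -` B \<inter> space M)"
    proof -
      have "(\<integral>\<omega>. indicator B (Z \<omega>) \<partial>M) = (\<integral>\<omega>. (indicator (Z -` B \<inter> space M) \<omega> :: real) \<partial>M)"
        by (intro Bochner_Integration.integral_cong) (auto simp: indicator_def)
      then show ?thesis by simp
    qed
    have "(\<integral>\<omega>. ?H \<omega> * indicator B (Z \<omega>) \<partial>M)
       = (\<integral>\<omega>. G \<omega> * indicator B (Z \<omega>) + (K + 1) * indicator B (Z \<omega>) \<partial>M)"
      by (simp only: distrib_right)
    then show ?thesis using intB intGB * by simp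
  qed
  ultimately show ?thesis unfolding EH by (simp add: distrib_right)
qed

text \<open>The hypothesis passes to the complex conjugate of \<open>G\<close> (replace \<open>u\<close> by \<open>- u\<close> and conjugate), hence to
  the real and imaginary parts of \<open>G\<close>.\<close>

lemma (in prob_space) iexp_factor_imp_prob_factor:
  fixes Z :: "'a \<Rightarrow> real" and G :: "'a \<Rightarrow> complex"
  assumes [measurable]: "Z \<in> borel_measurable M" "G \<in> borel_measurable M"
    and bnd: "\<And>\<omega>. norm (G \<omega>) \<le> K"
    and fac: "\<And>u. (\<integral>\<omega>. G \<omega> * iexp (u * Z \<omega>) \<partial>M) = (\<integral>\<omega>. G \<omega> \<partial>M) * (\<integral>\<omega>. iexp (u * Z \<omega>) \<partial>M)"
    and [measurable]: "B \<in> sets borel"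
  shows "(\<integral>\<omega>. G \<omega> * indicator B (Z \<omega>) \<partial>M) = (\<integral>\<omega>. G \<omega> \<partial>M) * prob (Z -` B \<inter> space M)"
proof -
  have intG: "integrable M G" using bnd by (intro integrable_const_bound[of _ K]) auto
  have int: "integrable M (\<lambda>\<omega>. G \<omega> * H \<omega>)" if "H \<in> borel_measurable M" "\<And>\<omega>. norm (H \<omega>) \<le> 1" for H :: "'a \<Rightarrow> complex"
    using that(1) bnd that(2) norm_ge_zero[of "G undefined"]
    by (intro integrable_const_bound[of _ K] AE_I2)
       (auto simp: norm_mult intro: order_trans[OF mult_mono[OF bnd that(2)]] order_trans[OF norm_ge_zero bnd])
  have intGI: "integrable M (\<lambda>\<omega>. G \<omega> * iexp (u * Z \<omega>))" for u
    by (rule int) auto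
  have intGB: "integrable M (\<lambda>\<omega>. G \<omega> * indicator B (Z \<omega>))"
    by (rule int) (auto simp: indicator_def)
  have cnjfac: "(\<integral>\<omega>. cnj (G \<omega>) * iexp (u * Z \<omega>) \<partial>M) = cnj (\<integral>\<omega>. G \<omega> \<partial>M) * (\<integral>\<omega>. iexp (u * Z \<omega>) \<partial>M)" for u
  proof -
    have "(\<integral>\<omega>. cnj (G \<omega>) * iexp (u * Z \<omega>) \<partial>M) = (\<integral>\<omega>. cnj (G \<omega> * iexp ((-u) * Z \<omega>)) \<partial>M)"
      by (simp add: exp_cnj)
    also have "\<dots> = cnj (\<integral>\<omega>. G \<omega> * iexp ((-u) * Z \<omega>) \<partial>M)" by (rule Bochner_Integration.integral_cnj)
    also have "\<dots> = cnj (\<integral>\<omega>. G \<omega> \<partial>M) * cnj (\<integral>\<omega>. iexp ((-u) * Z \<omega>) \<partial>M)" unfolding fac by simp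
    also have "cnj (\<integral>\<omega>. iexp ((-u) * Z \<omega>) \<partial>M) = (\<integral>\<omega>. cnj (iexp ((-u) * Z \<omega>)) \<partial>M)"
      by (rule Bochner_Integration.integral_cnj[symmetric])
    also have "\<dots> = (\<integral>\<omega>. iexp (u * Z \<omega>) \<partial>M)" by (simp add: exp_cnj)
    finally show ?thesis .
  qed
  have intcGI: "integrable M (\<lambda>\<omega>. cnj (G \<omega>) * iexp (u * Z \<omega>))" for u
    using intGI[of "-u"] integrable_cnj[of M "\<lambda>\<omega>. G \<omega> * iexp (- u * Z \<omega>)"] by (simp add: exp_cnj)
  have ReE: "expectation (\<lambda>\<omega>. Re (G \<omega>)) = Re (\<integral>\<omega>. G \<omega> \<partial>M)"
    and ImE: "expectation (\<lambda>\<omega>. Im (G \<omega>)) = Im (\<integral>\<omega>. G \<omega> \<partial>M)"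
    using intG by (auto intro: integral_Re integral_Im)
  have re: "(\<integral>\<omega>. Re (G \<omega>) * indicator B (Z \<omega>) \<partial>M) = Re (\<integral>\<omega>. G \<omega> \<partial>M) * prob (Z -` B \<inter> space M)"
  proof (subst ReE[symmetric], rule iexp_factor_imp_prob_factor_real[where K = K])
    show "\<bar>Re (G \<omega>)\<bar> \<le> K" for \<omega> using abs_Re_le_cmod[of "G \<omega>"] bnd[of \<omega>] by linarith
    show "(\<integral>\<omega>. Re (G \<omega>) *\<^sub>R iexp (u * Z \<omega>) \<partial>M) = expectation (\<lambda>\<omega>. Re (G \<omega>)) *\<^sub>R (\<integral>\<omega>. iexp (u * Z \<omega>) \<partial>M)" for u
    proof -
      have "(\<integral>\<omega>. Re (G \<omega>) *\<^sub>R iexp (u * Z \<omega>) \<partial>M)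
        = (\<integral>\<omega>. (G \<omega> * iexp (u * Z \<omega>) + cnj (G \<omega>) * iexp (u * Z \<omega>)) / 2 \<partial>M)"
      proof (intro Bochner_Integration.integral_cong refl)
        fix \<omega> have "complex_of_real (Re (G \<omega>)) = (G \<omega> + cnj (G \<omega>)) / 2" by (simp add: complex_add_cnj)
        then show "Re (G \<omega>) *\<^sub>R iexp (u * Z \<omega>) = (G \<omega> * iexp (u * Z \<omega>) + cnj (G \<omega>) * iexp (u * Z \<omega>)) / 2"
          unfolding scaleR_conv_of_real by (simp only:) (simp add: distrib_right)
      qed
      also have "\<dots> = ((\<integral>\<omega>. G \<omega> * iexp (u * Z \<omega>) \<partial>M) + (\<integral>\<omega>. cnj (G \<omega>) * iexp (u * Z \<omega>) \<partial>M)) / 2"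
        using intGI[of u] intcGI[of u] by simp
      also have "\<dots> = ((\<integral>\<omega>. G \<omega> \<partial>M) + cnj (\<integral>\<omega>. G \<omega> \<partial>M)) / 2 * (\<integral>\<omega>. iexp (u * Z \<omega>) \<partial>M)"
        unfolding fac cnjfac by (simp only: distrib_right times_divide_eq_left)
      also have "((\<integral>\<omega>. G \<omega> \<partial>M) + cnj (\<integral>\<omega>. G \<omega> \<partial>M)) / 2 = of_real (Re (\<integral>\<omega>. G \<omega> \<partial>M))"
        by (simp add: complex_add_cnj)
      finally show ?thesis by (simp add: ReE scaleR_conv_of_real)
    qed
  qed auto
  have im: "(\<integral>\<omega>. Im (G \<omega>) * indicator B (Z \<omega>) \<partial>M) = Im (\<integral>\<omega>. G \<omega> \<partial>M) * prob (Z -` B \<inter> space M)"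
  proof (subst ImE[symmetric], rule iexp_factor_imp_prob_factor_real[where K = K])
    show "\<bar>Im (G \<omega>)\<bar> \<le> K" for \<omega> using abs_Im_le_cmod[of "G \<omega>"] bnd[of \<omega>] by linarith
    show "(\<integral>\<omega>. Im (G \<omega>) *\<^sub>R iexp (u * Z \<omega>) \<partial>M) = expectation (\<lambda>\<omega>. Im (G \<omega>)) *\<^sub>R (\<integral>\<omega>. iexp (u * Z \<omega>) \<partial>M)" for u
    proof -
      have "(\<integral>\<omega>. Im (G \<omega>) *\<^sub>R iexp (u * Z \<omega>) \<partial>M)
        = (\<integral>\<omega>. (G \<omega> * iexp (u * Z \<omega>) - cnj (G \<omega>) * iexp (u * Z \<omega>)) / (2 * \<i>) \<partial>M)"
      proof (intro Bochner_Integration.integral_cong refl)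
        fix \<omega> have "complex_of_real (Im (G \<omega>)) = (G \<omega> - cnj (G \<omega>)) / (2 * \<i>)"
          by (simp add: complex_diff_cnj complex_eq_iff)
        then show "Im (G \<omega>) *\<^sub>R iexp (u * Z \<omega>) = (G \<omega> * iexp (u * Z \<omega>) - cnj (G \<omega>) * iexp (u * Z \<omega>)) / (2 * \<i>)"
          unfolding scaleR_conv_of_real by (simp only:) (simp add: left_diff_distrib)
      qed
      also have "\<dots> = ((\<integral>\<omega>. G \<omega> * iexp (u * Z \<omega>) \<partial>M) - (\<integral>\<omega>. cnj (G \<omega>) * iexp (u * Z \<omega>) \<partial>M)) / (2 * \<i>)"
        using intGI[of u] intcGI[of u] by simp
      also have "\<dots> = ((\<integral>\<omega>. G \<omega> \<partial>M) - cnj (\<integral>\<omega>. G \<omega> \<partial>M)) / (2 * \<i>) * (\<integral>\<omega>. iexp (u * Z \<omega>) \<partial>M)"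
        unfolding fac cnjfac by (simp only: left_diff_distrib times_divide_eq_left)
      also have "((\<integral>\<omega>. G \<omega> \<partial>M) - cnj (\<integral>\<omega>. G \<omega> \<partial>M)) / (2 * \<i>) = of_real (Im (\<integral>\<omega>. G \<omega> \<partial>M))"
        by (simp add: complex_diff_cnj complex_eq_iff)
      finally show ?thesis by (simp add: ImE scaleR_conv_of_real)
    qed
  qed auto
  have "Re (\<integral>\<omega>. G \<omega> * indicator B (Z \<omega>) \<partial>M) = (\<integral>\<omega>. Re (G \<omega>) * indicator B (Z \<omega>) \<partial>M)"
    unfolding integral_Re[OF intGB, symmetric]
    by (intro Bochner_Integration.integral_cong) (auto simp: indicator_def)
  moreover have "Im (\<integral>\<omega>. G \<omega> * indicator B (Z \<omega>) \<partial>M) = (\<integral>\<omega>. Im (G \<omega>) * indicator B (Z \<omega>) \<partial>M)"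
    unfolding integral_Im[OF intGB, symmetric]
    by (intro Bochner_Integration.integral_cong) (auto simp: indicator_def)
  ultimately show ?thesis using re im by (simp add: complex_eq_iff)
qed

text \<open>This is the uniqueness of multivariate characteristic functions, in the form that independence needs,
  obtained from the univariate case alone: the exponentials \<open>iexp (\<theta>\<^sub>j Z\<^sub>j)\<close> are replaced by indicators of
  \<open>Z\<^sub>j \<in> B\<^sub>j\<close> one index at a time, all the other factors playing the role of the random weight \<open>G\<close>.\<close>

lemma (in prob_space) indep_vars_if_iexp_factor:
  fixes Z :: "'i \<Rightarrow> 'a \<Rightarrow> real"
  assumes fin: "finite I" and Z [measurable]: "\<And>j. j \<in> I \<Longrightarrow> Z j \<in> borel_measurable M"
    and fac: "\<And>\<theta>. (\<integral>\<omega>. (\<Prod>j\<in>I. iexp (\<theta> j * Z j \<omega>)) \<partial>M) = (\<Prod>j\<in>I. \<integral>\<omega>. iexp (\<theta> j * Z j \<omega>) \<partial>M)"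
  shows "indep_vars (\<lambda>_. borel) Z I"
proof (cases "I = {}")
  case False
  have key: "(\<integral>\<omega>. (\<Prod>j\<in>A. indicator (B j) (Z j \<omega>)) * (\<Prod>j\<in>I - A. iexp (\<theta> j * Z j \<omega>)) \<partial>M)
      = (\<Prod>j\<in>A. complex_of_real (prob (Z j -` B j \<inter> space M))) * (\<Prod>j\<in>I - A. \<integral>\<omega>. iexp (\<theta> j * Z j \<omega>) \<partial>M)"
    if "A \<subseteq> I" and B: "\<And>j. B j \<in> sets borel" for A B \<theta>
    using finite_subset[OF \<open>A \<subseteq> I\<close> fin] \<open>A \<subseteq> I\<close>
  proof (induction A arbitrary: \<theta> rule: finite_induct)
    case empty
    then show ?case using fac by simp
  next
    case (insert k A)
    note B [measurable]
    have kI: "k \<in> I" "A \<subseteq> I" using insert by auto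
    note [measurable] = Z[OF kI(1)]
    have fI: "finite (I - A)" "finite (I - insert k A)" using fin by auto
    have split: "I - A = insert k (I - insert k A)" using kI insert.hyps by auto
    define G where "G \<omega> = (\<Prod>j\<in>A. indicator (B j) (Z j \<omega>)) * (\<Prod>j\<in>I - insert k A. iexp (\<theta> j * Z j \<omega>))" for \<omega>
    define C where "C = (\<Prod>j\<in>A. complex_of_real (prob (Z j -` B j \<inter> space M))) * (\<Prod>j\<in>I - insert k A. \<integral>\<omega>. iexp (\<theta> j * Z j \<omega>) \<partial>M)"
    have [measurable]: "G \<in> borel_measurable M"
      unfolding G_def
      by (intro borel_measurable_times borel_measurable_prod borel_measurable_indicator)
         (use kI Z in auto)
    have "norm (G \<omega>) \<le> 1" for \<omega>
    proof -
      have "norm (\<Prod>j\<in>A. indicator (B j) (Z j \<omega>) :: complex) \<le> 1"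
        unfolding prod_norm[symmetric] by (intro prod_le_1) (auto simp: indicator_def)
      moreover have "norm (\<Prod>j\<in>I - insert k A. iexp (\<theta> j * Z j \<omega>)) = 1"
        unfolding prod_norm[symmetric] by simp
      ultimately show ?thesis unfolding G_def norm_mult by simp
    qed
    have Gu: "(\<integral>\<omega>. G \<omega> * iexp (u * Z k \<omega>) \<partial>M) = C * (\<integral>\<omega>. iexp (u * Z k \<omega>) \<partial>M)" for u
    proof -
      have e: "(\<Prod>j\<in>I - insert k A. iexp ((\<theta>(k := u)) j * Z j \<omega>)) = (\<Prod>j\<in>I - insert k A. iexp (\<theta> j * Z j \<omega>))" for \<omega>
        by (intro prod.cong) auto
      have e2: "(\<Prod>j\<in>I - insert k A. \<integral>\<omega>. iexp ((\<theta>(k := u)) j * Z j \<omega>) \<partial>M) = (\<Prod>j\<in>I - insert k A. \<integral>\<omega>. iexp (\<theta> j * Z j \<omega>) \<partial>M)"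
        by (intro prod.cong) auto
      show ?thesis
        using insert.IH[OF kI(2), of "\<theta>(k := u)"] fI
        unfolding split prod.insert[OF fI(2), of k] C_def
        by (simp add: e e2 G_def mult_ac del: fun_upd_apply) (simp add: mult_ac)
    qed
    have EG: "(\<integral>\<omega>. G \<omega> \<partial>M) = C" using Gu[of 0] by (simp add: prob_space)
    have "(\<integral>\<omega>. G \<omega> * indicator (B k) (Z k \<omega>) \<partial>M) = (\<integral>\<omega>. G \<omega> \<partial>M) * prob (Z k -` B k \<inter> space M)"
      by (rule iexp_factor_imp_prob_factor[where K = 1]) (use \<open>\<And>\<omega>. norm (G \<omega>) \<le> 1\<close> Gu EG in auto)
    then show ?case
      using insert.hyps by (simp add: EG) (simp add: G_def C_def mult_ac)
  qed
  show ?thesis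
  proof (subst indep_vars_finite[where E = "\<lambda>_. sets borel", OF False fin])
    show "\<forall>B\<in>\<Pi> i\<in>I. sets borel. prob (\<Inter>j\<in>I. Z j -` B j \<inter> space M) = (\<Prod>j\<in>I. prob (Z j -` B j \<inter> space M))"
    proof
      fix B assume B: "B \<in> (\<Pi> i\<in>I. sets (borel :: real measure))"
      \<comment> \<open>Outside \<open>I\<close> the sets are arbitrary; \<open>key\<close> asks for Borel sets at all indices.\<close>
      define B' where "B' j = (if j \<in> I then B j else {})" for j
      have "B' j \<in> sets borel" for j using B by (auto simp: B'_def)
      have "complex_of_real (prob (\<Inter>j\<in>I. Z j -` B j \<inter> space M)) = (\<integral>\<omega>. indicator (\<Inter>j\<in>I. Z j -` B j \<inter> space M) \<omega> \<partial>M)"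
      proof -
        define E where "E = (\<Inter>j\<in>I. Z j -` B j \<inter> space M)"
        have "E \<in> sets M"
          using B Z False fin unfolding E_def by (intro sets.finite_INT measurable_sets[OF Z]) auto
        then have "complex_of_real (prob E) = complex_of_real (\<integral>\<omega>. indicator E \<omega> \<partial>M)" by simp
        also have "\<dots> = (\<integral>\<omega>. complex_of_real (indicator E \<omega>) \<partial>M)" by (rule integral_complex_of_real[symmetric])
        also have "\<dots> = (\<integral>\<omega>. indicator E \<omega> \<partial>M)"
          by (intro Bochner_Integration.integral_cong) (auto simp: indicator_def)
        finally show ?thesis unfolding E_def[symmetric] .
      qed
      also have "\<dots> = (\<integral>\<omega>. (\<Prod>j\<in>I. indicator (B' j) (Z j \<omega>)) \<partial>M)"
      proof (intro Bochner_Integration.integral_cong refl)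
        fix \<omega> assume "\<omega> \<in> space M"
        then have "(indicator (\<Inter>j\<in>I. Z j -` B j \<inter> space M) \<omega> :: complex) = (if \<forall>j\<in>I. Z j \<omega> \<in> B j then 1 else 0)"
          using False by (auto simp: indicator_def)
        also have "\<dots> = (\<Prod>j\<in>I. indicator (B' j) (Z j \<omega>))"
          using fin by (auto simp: B'_def indicator_def prod_zero_iff intro!: prod.neutral[symmetric])
        finally show "(indicator (\<Inter>j\<in>I. Z j -` B j \<inter> space M) \<omega> :: complex) = (\<Prod>j\<in>I. indicator (B' j) (Z j \<omega>))" .
      qed
      also have "\<dots> = of_real (\<Prod>j\<in>I. prob (Z j -` B' j \<inter> space M))"
        using key[of I B'] \<open>\<And>j. B' j \<in> sets borel\<close> by simp
      also have "(\<Prod>j\<in>I. prob (Z j -` B' j \<inter> space M)) = (\<Prod>j\<in>I. prob (Z j -` B j \<inter> space M))"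
        by (intro prod.cong) (auto simp: B'_def)
      finally show "prob (\<Inter>j\<in>I. Z j -` B j \<inter> space M) = (\<Prod>j\<in>I. prob (Z j -` B j \<inter> space M))"
        by (simp only: of_real_eq_iff)
    qed
    show "Int_stable (sets (borel :: real measure))" by (auto simp: Int_stable_def)
  qed (use Z in \<open>auto simp: sets.sigma_sets_eq[of "borel :: real measure", simplified]\<close>)
qed (simp add: indep_vars_def2 indep_sets_def)

section \<open>Square-integrable functions\<close>

lemma integrable_mult_if_square_integrable:
  fixes f g :: "'b \<Rightarrow> real"
  assumes [measurable]: "f \<in> borel_measurable N" "g \<in> borel_measurable N"
    and "integrable N (\<lambda>x. (f x)\<^sup>2)" "integrable N (\<lambda>x. (g x)\<^sup>2)"
  shows "integrable N (\<lambda>x. f x * g x)"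
proof (rule Bochner_Integration.integrable_bound)
  show "integrable N (\<lambda>x. (f x)\<^sup>2 + (g x)\<^sup>2)" using assms by simp
  have "\<bar>a * b\<bar> \<le> a\<^sup>2 + b\<^sup>2" for a b :: real
    using sum_squares_bound[of "\<bar>a\<bar>" "\<bar>b\<bar>"] mult_nonneg_nonneg[of "\<bar>a\<bar>" "\<bar>b\<bar>"]
    unfolding abs_mult power2_abs by linarith
  then show "AE x in N. norm (f x * g x) \<le> norm ((f x)\<^sup>2 + (g x)\<^sup>2)" by simp
qed simp

lemma integrable_square_add:
  fixes f g :: "'b \<Rightarrow> real"
  assumes "f \<in> borel_measurable N" "g \<in> borel_measurable N"
    and "integrable N (\<lambda>x. (f x)\<^sup>2)" "integrable N (\<lambda>x. (g x)\<^sup>2)"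
  shows "integrable N (\<lambda>x. (f x + g x)\<^sup>2)"
  using assms integrable_mult_if_square_integrable[OF assms]
  by (simp add: power2_sum mult.assoc)

lemma Cauchy_Schwarz_integral:
  fixes f g :: "'b \<Rightarrow> real"
  assumes "f \<in> borel_measurable N" "g \<in> borel_measurable N"
    and "integrable N (\<lambda>x. (f x)\<^sup>2)" "integrable N (\<lambda>x. (g x)\<^sup>2)"
  shows "(\<integral>x. f x * g x \<partial>N)\<^sup>2 \<le> (\<integral>x. (f x)\<^sup>2 \<partial>N) * (\<integral>x. (g x)\<^sup>2 \<partial>N)"
proof -
  define A B C where "A = (\<integral>x. (f x)\<^sup>2 \<partial>N)" and "B = (\<integral>x. f x * g x \<partial>N)" and "C = (\<integral>x. (g x)\<^sup>2 \<partial>N)"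
  have fg: "integrable N (\<lambda>x. f x * g x)" by (rule integrable_mult_if_square_integrable) fact+
  have quadratic: "0 \<le> A + 2 * t * B + t\<^sup>2 * C" for t
  proof -
    have "0 \<le> (\<integral>x. (f x + t * g x)\<^sup>2 \<partial>N)" by simp
    also have "\<dots> = (\<integral>x. (f x)\<^sup>2 + 2 * t * (f x * g x) + t\<^sup>2 * (g x)\<^sup>2 \<partial>N)"
      by (simp add: power2_sum power_mult_distrib mult_ac add_ac)
    also have "\<dots> = A + 2 * t * B + t\<^sup>2 * C"
      unfolding A_def B_def C_def using assms fg by simp
    finally show ?thesis .
  qed
  have "C \<ge> 0" by (simp add: C_def)
  show ?thesis
  proof (cases "C = 0")
    case True
    have "B = 0"
    proof (rule ccontr)
      assume "B \<noteq> 0"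
      then show False using quadratic[of "- (A + 1) / (2 * B)"] True by (simp add: field_simps)
    qed
    then show ?thesis using True by (simp add: A_def B_def C_def)
  next
    case False
    then have "C > 0" using \<open>C \<ge> 0\<close> by simp
    \<comment> \<open>The quadratic polynomial is evaluated at its minimum.\<close>
    have "0 \<le> A + 2 * (- B / C) * B + (- B / C)\<^sup>2 * C" by (rule quadratic)
    also have "\<dots> = A - B\<^sup>2 / C" using \<open>C > 0\<close> by (simp add: power2_eq_square field_simps)
    finally show ?thesis using \<open>C > 0\<close> unfolding A_def B_def C_def by (simp add: field_simps)
  qed
qed

lemma tendsto_integral_square:
  fixes f :: "nat \<Rightarrow> 'b \<Rightarrow> real" and g :: "'b \<Rightarrow> real"
  assumes meas: "\<And>n. f n \<in> borel_measurable N" "g \<in> borel_measurable N"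
    and int: "\<And>n. integrable N (\<lambda>x. (f n x)\<^sup>2)" "integrable N (\<lambda>x. (g x)\<^sup>2)"
    and lim: "(\<lambda>n. \<integral>x. (f n x - g x)\<^sup>2 \<partial>N) \<longlonglongrightarrow> 0"
  shows "(\<lambda>n. \<integral>x. (f n x)\<^sup>2 \<partial>N) \<longlonglongrightarrow> (\<integral>x. (g x)\<^sup>2 \<partial>N)"
proof -
  define D where "D n = (\<integral>x. (f n x - g x)\<^sup>2 \<partial>N)" for n
  define P where "P n = (\<integral>x. g x * (f n x - g x) \<partial>N)" for n
  have dm: "(\<lambda>x. f n x - g x) \<in> borel_measurable N" for n using meas by simp
  have di: "integrable N (\<lambda>x. (f n x - g x)\<^sup>2)" for n
    using integrable_square_add[of "f n" N "\<lambda>x. - g x"] meas int by simp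
  have pi: "integrable N (\<lambda>x. g x * (f n x - g x))" for n
    by (rule integrable_mult_if_square_integrable) (use meas int di dm in auto)
  have bound: "\<bar>P n\<bar> \<le> sqrt ((\<integral>x. (g x)\<^sup>2 \<partial>N) * D n)" for n
    using Cauchy_Schwarz_integral[OF meas(2) dm int(2) di, of n]
    unfolding P_def D_def by (intro real_le_rsqrt) simp
  have "(\<lambda>n. sqrt ((\<integral>x. (g x)\<^sup>2 \<partial>N) * D n)) \<longlonglongrightarrow> sqrt ((\<integral>x. (g x)\<^sup>2 \<partial>N) * 0)"
    using lim unfolding D_def by (intro tendsto_intros)
  then have "P \<longlonglongrightarrow> 0"
    using bound by (intro Lim_null_comparison[of P "\<lambda>n. sqrt ((\<integral>x. (g x)\<^sup>2 \<partial>N) * D n)"]) (auto simp: P_def)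
  then have "(\<lambda>n. (\<integral>x. (g x)\<^sup>2 \<partial>N) + 2 * P n + D n) \<longlonglongrightarrow> (\<integral>x. (g x)\<^sup>2 \<partial>N) + 2 * 0 + 0"
    using lim unfolding D_def by (intro tendsto_intros)
  moreover have "(\<integral>x. (f n x)\<^sup>2 \<partial>N) = (\<integral>x. (g x)\<^sup>2 \<partial>N) + 2 * P n + D n" for n
  proof -
    have "(\<integral>x. (f n x)\<^sup>2 \<partial>N) = (\<integral>x. (g x)\<^sup>2 + 2 * (g x * (f n x - g x)) + (f n x - g x)\<^sup>2 \<partial>N)"
      by (intro Bochner_Integration.integral_cong) (auto simp: power2_eq_square algebra_simps)
    then show ?thesis unfolding P_def D_def using int di pi by simp
  qed
  ultimately show ?thesis by simp
qed

lemma tendsto_integral_square_add: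
  fixes f g :: "nat \<Rightarrow> 'b \<Rightarrow> real"
  assumes meas: "\<And>n. f n \<in> borel_measurable N" "\<And>n. g n \<in> borel_measurable N"
    and int: "\<And>n. integrable N (\<lambda>x. (f n x)\<^sup>2)" "\<And>n. integrable N (\<lambda>x. (g n x)\<^sup>2)"
    and lim: "(\<lambda>n. \<integral>x. (f n x)\<^sup>2 \<partial>N) \<longlonglongrightarrow> 0" "(\<lambda>n. \<integral>x. (g n x)\<^sup>2 \<partial>N) \<longlonglongrightarrow> 0"
  shows "(\<lambda>n. \<integral>x. (f n x + g n x)\<^sup>2 \<partial>N) \<longlonglongrightarrow> 0"
proof (rule Lim_null_comparison)
  show "\<forall>\<^sub>F n in sequentially. norm (\<integral>x. (f n x + g n x)\<^sup>2 \<partial>N)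
      \<le> 2 * (\<integral>x. (f n x)\<^sup>2 \<partial>N) + 2 * (\<integral>x. (g n x)\<^sup>2 \<partial>N)"
  proof (intro always_eventually allI)
    fix n
    have "(\<integral>x. (f n x + g n x)\<^sup>2 \<partial>N) \<le> (\<integral>x. 2 * (f n x)\<^sup>2 + 2 * (g n x)\<^sup>2 \<partial>N)"
    proof (rule integral_mono)
      show "(f n x + g n x)\<^sup>2 \<le> 2 * (f n x)\<^sup>2 + 2 * (g n x)\<^sup>2" for x
        using sum_squares_bound[of "f n x" "g n x"] by (simp add: power2_sum)
    qed (use integrable_square_add[OF meas int] int in auto)
    then show "norm (\<integral>x. (f n x + g n x)\<^sup>2 \<partial>N) \<le> 2 * (\<integral>x. (f n x)\<^sup>2 \<partial>N) + 2 * (\<integral>x. (g n x)\<^sup>2 \<partial>N)"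
      using int by simp
  qed
  have "(\<lambda>n. 2 * (\<integral>x. (f n x)\<^sup>2 \<partial>N) + 2 * (\<integral>x. (g n x)\<^sup>2 \<partial>N)) \<longlonglongrightarrow> 2 * 0 + 2 * 0"
    by (intro tendsto_intros lim)
  then show "(\<lambda>n. 2 * (\<integral>x. (f n x)\<^sup>2 \<partial>N) + 2 * (\<integral>x. (g n x)\<^sup>2 \<partial>N)) \<longlonglongrightarrow> 0" by simp
qed

text \<open>The set-restricted notions are notions on the whole line for the function cut off outside \<open>A\<close>. The
  lemmas about \<open>L2_on\<close>, \<open>L2_norm_sq\<close> and \<open>L2_inner\<close> are reduced in this way to those about general measure
  spaces.\<close>

lemma L2_on_iff:
  "L2_on A f \<longleftrightarrow> (\<lambda>x. indicator A x * f x) \<in> borel_measurable lborel \<and>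
     integrable lborel (\<lambda>x. (indicator A x * f x)\<^sup>2)"
proof -
  have "indicator A x *\<^sub>R (f x)\<^sup>2 = (indicator A x * f x)\<^sup>2" for x by (simp add: indicator_def)
  then show ?thesis unfolding L2_on_def set_borel_measurable_def set_integrable_def by simp
qed

lemma L2_norm_sq_eq: "L2_norm_sq A f = (\<integral>x. (indicator A x * f x)\<^sup>2 \<partial>lborel)"
  unfolding L2_norm_sq_def set_lebesgue_integral_def
  by (intro Bochner_Integration.integral_cong) (auto simp: indicator_def)

lemma L2_on_add: "L2_on A f \<Longrightarrow> L2_on A g \<Longrightarrow> L2_on A (\<lambda>x. f x + g x)"
  unfolding L2_on_iff distrib_left by (auto intro: integrable_square_add)

lemma L2_on_scale: "L2_on A f \<Longrightarrow> L2_on A (\<lambda>x. c * f x)"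
proof -
  assume "L2_on A f"
  then have m: "(\<lambda>x. indicator A x * f x) \<in> borel_measurable lborel"
    and i: "integrable lborel (\<lambda>x. (indicator A x * f x)\<^sup>2)" unfolding L2_on_iff by auto
  have "indicator A x * (c * f x) = c * (indicator A x * f x)" for x by simp
  then show ?thesis unfolding L2_on_iff power_mult_distrib
    using borel_measurable_times[OF borel_measurable_const m, of c] integrable_mult_right[OF i, of "c\<^sup>2"]
    by (simp add: power_mult_distrib mult_ac)
qed

lemma L2_norm_sq_scale: "L2_norm_sq A (\<lambda>x. c * f x) = c\<^sup>2 * L2_norm_sq A f"
  unfolding L2_norm_sq_eq by (simp add: power_mult_distrib mult_ac)

lemma L2_norm_sq_nonneg: "L2_norm_sq A f \<ge> 0"
  unfolding L2_norm_sq_eq by simp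

definition L2_inner :: "real set \<Rightarrow> (real \<Rightarrow> real) \<Rightarrow> (real \<Rightarrow> real) \<Rightarrow> real" where
  "L2_inner A f g = (LBINT t:A. f t * g t)"

lemma L2_inner_eq: "L2_inner A f g = (\<integral>x. (indicator A x * f x) * (indicator A x * g x) \<partial>lborel)"
  unfolding L2_inner_def set_lebesgue_integral_def
  by (intro Bochner_Integration.integral_cong) (auto simp: indicator_def)

lemma L2_inner_commute: "L2_inner A f g = L2_inner A g f"
  by (simp add: L2_inner_def mult.commute)

lemma L2_inner_same: "L2_inner A f f = L2_norm_sq A f"
  by (simp add: L2_inner_def L2_norm_sq_def power2_eq_square)

lemma L2_integrable_mult:
  assumes "L2_on A f" "L2_on A g"
  shows "integrable lborel (\<lambda>x. (indicator A x * f x) * (indicator A x * g x))"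
  using assms unfolding L2_on_iff by (auto intro: integrable_mult_if_square_integrable)

lemma L2_on_sum: "finite I \<Longrightarrow> (\<And>j. j \<in> I \<Longrightarrow> L2_on A (f j)) \<Longrightarrow> L2_on A (\<lambda>x. \<Sum>j\<in>I. f j x)"
proof (induction I rule: finite_induct)
  case empty
  then show ?case by (simp add: L2_on_iff)
qed (auto intro: L2_on_add)

lemma L2_inner_sum_left:
  assumes "finite I" "\<And>j. j \<in> I \<Longrightarrow> L2_on A (f j)" "L2_on A g"
  shows "L2_inner A (\<lambda>x. \<Sum>j\<in>I. c j * f j x) g = (\<Sum>j\<in>I. c j * L2_inner A (f j) g)"
proof -
  have "L2_inner A (\<lambda>x. \<Sum>j\<in>I. c j * f j x) g
      = (\<integral>x. (\<Sum>j\<in>I. c j * ((indicator A x * f j x) * (indicator A x * g x))) \<partial>lborel)"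
    unfolding L2_inner_eq by (intro Bochner_Integration.integral_cong) (auto simp: sum_distrib_left sum_distrib_right mult_ac)
  also have "\<dots> = (\<Sum>j\<in>I. c j * L2_inner A (f j) g)"
    unfolding L2_inner_eq using assms
    by (subst Bochner_Integration.integral_sum) (auto intro!: integrable_mult_right L2_integrable_mult)
  finally show ?thesis .
qed

lemma L2_norm_sq_orthogonal_sum:
  assumes fin: "finite I" and L2: "\<And>j. j \<in> I \<Longrightarrow> L2_on A (f j)"
    and orth: "\<And>i j. i \<in> I \<Longrightarrow> j \<in> I \<Longrightarrow> i \<noteq> j \<Longrightarrow> L2_inner A (f i) (f j) = 0"
  shows "L2_norm_sq A (\<lambda>x. \<Sum>j\<in>I. c j * f j x) = (\<Sum>j\<in>I. (c j)\<^sup>2 * L2_norm_sq A (f j))"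
proof -
  have S: "L2_on A (\<lambda>x. \<Sum>j\<in>I. c j * f j x)" using fin L2 by (intro L2_on_sum L2_on_scale)
  have "L2_norm_sq A (\<lambda>x. \<Sum>j\<in>I. c j * f j x) = (\<Sum>i\<in>I. c i * L2_inner A (f i) (\<lambda>x. \<Sum>j\<in>I. c j * f j x))"
    unfolding L2_inner_same[symmetric] by (rule L2_inner_sum_left[OF fin L2 S])
  also have "\<dots> = (\<Sum>i\<in>I. c i * (\<Sum>j\<in>I. c j * L2_inner A (f j) (f i)))"
    using L2_inner_sum_left[OF fin L2 L2] by (simp add: L2_inner_commute[of A "f _" "\<lambda>x. \<Sum>j\<in>I. c j * f j x"])
  also have "\<dots> = (\<Sum>i\<in>I. (c i)\<^sup>2 * L2_norm_sq A (f i))"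
  proof (intro sum.cong refl)
    fix i assume i: "i \<in> I"
    have "(\<Sum>j\<in>I. c j * L2_inner A (f j) (f i)) = (\<Sum>j\<in>I. if j = i then c i * L2_norm_sq A (f i) else 0)"
      using orth i by (intro sum.cong) (auto simp: L2_inner_same)
    then show "c i * (\<Sum>j\<in>I. c j * L2_inner A (f j) (f i)) = (c i)\<^sup>2 * L2_norm_sq A (f i)"
      using i fin by (simp add: power2_eq_square)
  qed
  finally show ?thesis .
qed

section \<open>Step functions and their common partitions\<close>

lemma step_fun_Nil [simp]: "step_fun [] t = 0"
  and step_fun_Cons [simp]: "step_fun ((c, a, b) # S) t = c * indicator {a<..b} t + step_fun S t"
  and step_fun_append [simp]: "step_fun (S @ R) t = step_fun S t + step_fun R t"
  by (simp_all add: step_fun_def)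

lemma step_integral_Nil [simp]: "step_integral w [] \<omega> = 0"
  and step_integral_Cons [simp]:
    "step_integral w ((c, a, b) # S) \<omega> = c * (w b \<omega> - w a \<omega>) + step_integral w S \<omega>"
  and step_integral_append [simp]:
    "step_integral w (S @ R) \<omega> = step_integral w S \<omega> + step_integral w R \<omega>"
  by (simp_all add: step_integral_def)

definition scale_steps :: "real \<Rightarrow> (real \<times> real \<times> real) list \<Rightarrow> (real \<times> real \<times> real) list" where
  "scale_steps r S = map (\<lambda>(c, a, b). (r * c, a, b)) S"

lemma step_fun_scale: "step_fun (scale_steps r S) t = r * step_fun S t"
  unfolding scale_steps_def by (induction S) (auto simp: algebra_simps)

lemma step_integral_scale: "step_integral w (scale_steps r S) \<omega> = r * step_integral w S \<omega>"
  unfolding scale_steps_def by (induction S) (auto simp: algebra_simps)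

definition steps_in :: "real \<Rightarrow> (real \<times> real \<times> real) list \<Rightarrow> bool" where
  "steps_in T S \<longleftrightarrow> (\<forall>(c, a, b)\<in>set S. 0 \<le> a \<and> a \<le> b \<and> b \<le> T)"

lemma steps_in_Nil [simp]: "steps_in T []"
  and steps_in_Cons: "steps_in T ((c, a, b) # S) \<longleftrightarrow> 0 \<le> a \<and> a \<le> b \<and> b \<le> T \<and> steps_in T S"
  by (simp_all add: steps_in_def)

lemma steps_in_append [simp]: "steps_in T (S @ R) \<longleftrightarrow> steps_in T S \<and> steps_in T R"
  by (simp add: steps_in_def ball_Un)

lemma steps_in_scale [simp]: "steps_in T (scale_steps r S) \<longleftrightarrow> steps_in T S"
  by (simp add: steps_in_def scale_steps_def case_prod_unfold)

lemma step_fun_measurable [measurable]: "step_fun S \<in> borel_measurable borel"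
proof (induction S)
  case (Cons p S)
  obtain c a b where "p = (c, a, b)" by (cases p)
  with Cons show ?case by simp
qed simp

lemma L2_on_step_fun: "L2_on {0<..<T} (step_fun S)"
proof (induction S)
  case Nil
  show ?case by (simp add: L2_on_iff)
next
  case (Cons p S)
  obtain c a b where p: "p = (c, a, b)" by (cases p)
  have "L2_on {0<..<T} (indicator {a<..b})"
    unfolding L2_on_iff
  proof
    show "integrable lborel (\<lambda>x. (indicator {0<..<T} x * indicat_real {a<..b} x)\<^sup>2)"
      by (rule Bochner_Integration.integrable_bound[of _ "\<lambda>x. indicator {0..T} x :: real"])
         (auto simp: emeasure_lborel_Icc_eq split: split_indicator)
  qed simp
  with Cons show ?case unfolding p step_fun_Cons by (intro L2_on_add L2_on_scale)
qed

text \<open>All jumps of \<open>step_fun S\<close> lie on the grid \<open>t 0 < \<dots> < t n\<close>. Strict monotonicity is what the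
  independence of increments is stated for.\<close>

definition adapted_partition :: "real \<Rightarrow> (real \<times> real \<times> real) list \<Rightarrow> nat \<Rightarrow> (nat \<Rightarrow> real) \<Rightarrow> bool" where
  "adapted_partition T S n t \<longleftrightarrow> (\<forall>i\<le>n. t i \<in> {0..T}) \<and> strict_mono_on {..n} t \<and>
     (\<forall>(c, a, b)\<in>set S. \<exists>p q. p \<le> q \<and> q \<le> n \<and> a = t p \<and> b = t q)"

lemma ex_adapted_partition:
  assumes "T \<ge> 0" "steps_in T S"
  shows "\<exists>n t. adapted_partition T S n t"
proof -
  define E where "E = insert 0 ((\<lambda>(c, a, b). a) ` set S \<union> (\<lambda>(c, a, b). b) ` set S)"
  define l where "l = sorted_list_of_set E"
  have fE: "finite E" by (simp add: E_def)
  have l: "set l = E" "sorted_wrt (<) l" using fE by (auto simp: l_def)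
  have "0 \<le> a \<and> a \<le> b \<and> b \<le> T" if "(c, a, b) \<in> set S" for a b c
    using bspec[OF assms(2)[unfolded steps_in_def] that] by auto
  then have ET: "E \<subseteq> {0..T}" using assms(1) unfolding E_def by fastforce
  have ne: "l \<noteq> []" using l by (auto simp: E_def)
  have "adapted_partition T S (length l - 1) (\<lambda>i. l ! i)"
    unfolding adapted_partition_def
  proof (intro conjI allI impI)
    show "l ! i \<in> {0..T}" if "i \<le> length l - 1" for i
    proof -
      have "i < length l" using that ne by (cases l) auto
      then show ?thesis using nth_mem[of i l] l ET by auto
    qed
    have mono: "l ! i < l ! j" if "i < j" "j \<le> length l - 1" for i j
      using l(2) that ne by (cases l) (auto simp: sorted_wrt_iff_nth_less)
    then show "strict_mono_on {..length l - 1} (\<lambda>i. l ! i)"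
      by (auto intro!: strict_mono_onI)
    show "\<forall>(c, a, b)\<in>set S. \<exists>p q. p \<le> q \<and> q \<le> length l - 1 \<and> a = l ! p \<and> b = l ! q"
    proof (safe)
      fix c a b assume S: "(c, a, b) \<in> set S"
      then have "a \<in> set l" "b \<in> set l" unfolding l E_def by force+
      then obtain p q where pq: "p < length l" "q < length l" "a = l ! p" "b = l ! q"
        by (metis in_set_conv_nth)
      have "a \<le> b" using S assms by (auto simp: steps_in_def)
      have "p \<le> q"
      proof (rule ccontr)
        assume "\<not> p \<le> q"
        then have "l ! q < l ! p" using mono[of q p] pq by simp
        then show False using \<open>a \<le> b\<close> pq by simp
      qed
      then show "\<exists>p q. p \<le> q \<and> q \<le> length l - 1 \<and> a = l ! p \<and> b = l ! q"
        using pq by (intro exI[of _ p] exI[of _ q]) auto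
    qed
  qed
  then show ?thesis by blast
qed

text \<open>A telescoping sum, in which the indicator picks out the cells between \<open>t p\<close> and \<open>t q\<close>. Leaving \<open>F\<close>
  arbitrary serves two purposes: a Brownian path yields the stochastic integral, and the indicator of
  \<open>{x..}\<close> yields the step function itself.\<close>

lemma increment_over_partition:
  fixes F :: "real \<Rightarrow> real"
  assumes smono: "strict_mono_on {..n} t" and pq: "p \<le> q" "q \<le> (n::nat)"
  shows "F (t q) - F (t p) = (\<Sum>i<n. indicator {t p<..t q} (t (Suc i)) * (F (t (Suc i)) - F (t i)))"
proof -
  have mono: "t i < t j" if "i < j" "j \<le> n" for i j
    using that by (intro strict_mono_onD[OF smono]) auto
  have le: "t i \<le> t j" if "i \<le> j" "j \<le> n" for i j using mono[of i j] that by (cases "i = j") auto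
  have ind: "t (Suc i) \<in> {t p<..t q} \<longleftrightarrow> i \<in> {p..<q}" if "i < n" for i
  proof
    assume a: "t (Suc i) \<in> {t p<..t q}"
    have "\<not> Suc i \<le> p" using le[of "Suc i" p] a pq by auto
    moreover have "\<not> q < Suc i" using mono[of q "Suc i"] a that by auto
    ultimately show "i \<in> {p..<q}" by auto
  next
    assume "i \<in> {p..<q}"
    then show "t (Suc i) \<in> {t p<..t q}" using mono[of p "Suc i"] le[of "Suc i" q] that pq by auto
  qed
  have "(\<Sum>i<n. indicator {t p<..t q} (t (Suc i)) * (F (t (Suc i)) - F (t i)))
      = (\<Sum>i<n. if i \<in> {p..<q} then F (t (Suc i)) - F (t i) else 0)"
    using ind by (intro sum.cong) (auto simp: indicator_def)
  also have "\<dots> = (\<Sum>i\<in>{..<n} \<inter> {p..<q}. F (t (Suc i)) - F (t i))"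
    by (rule sum.inter_restrict[symmetric]) simp
  also have "{..<n} \<inter> {p..<q} = {p..<q}" using pq by auto
  also have "(\<Sum>i\<in>{p..<q}. F (t (Suc i)) - F (t i)) = F (t q) - F (t p)"
    using pq by (intro sum_Suc_diff') auto
  finally show ?thesis by simp
qed

lemma step_sum_over_partition:
  fixes F :: "real \<Rightarrow> real"
  assumes smono: "strict_mono_on {..n} t"
    and S: "\<forall>(c, a, b)\<in>set S. \<exists>p q. p \<le> q \<and> q \<le> (n::nat) \<and> a = t p \<and> b = t q"
  shows "(\<Sum>(c, a, b)\<leftarrow>S. c * (F b - F a)) = (\<Sum>i<n. step_fun S (t (Suc i)) * (F (t (Suc i)) - F (t i)))"
  using S
proof (induction S)
  case (Cons x S)
  obtain c a b where x: "x = (c, a, b)" by (cases x)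
  obtain p q where pq: "p \<le> q" "q \<le> n" "a = t p" "b = t q" using Cons.prems x by auto
  have "c * (F b - F a) = (\<Sum>i<n. c * indicator {a<..b} (t (Suc i)) * (F (t (Suc i)) - F (t i)))"
    by (simp only: pq(3,4) increment_over_partition[OF smono pq(1,2), where F = F] sum_distrib_left mult.assoc)
  then show ?case using Cons by (simp add: x sum.distrib distrib_right)
qed simp

lemma step_integral_over_partition:
  assumes "strict_mono_on {..n} t"
    and "\<forall>(c, a, b)\<in>set S. \<exists>p q. p \<le> q \<and> q \<le> (n::nat) \<and> a = t p \<and> b = t q"
  shows "step_integral w S \<omega> = (\<Sum>i<n. step_fun S (t (Suc i)) * (w (t (Suc i)) \<omega> - w (t i) \<omega>))"
  unfolding step_integral_def using step_sum_over_partition[OF assms, where F = "\<lambda>t. w t \<omega>"] .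

lemma step_fun_over_partition:
  assumes smono: "strict_mono_on {..n} t"
    and S: "\<forall>(c, a, b)\<in>set S. \<exists>p q. p \<le> q \<and> q \<le> (n::nat) \<and> a = t p \<and> b = t q"
  shows "step_fun S x = (\<Sum>i<n. step_fun S (t (Suc i)) * indicator {t i<..t (Suc i)} x)"
proof -
  have mono: "t i < t j" if "i < j" "j \<le> n" for i j
    using that by (intro strict_mono_onD[OF smono]) auto
  let ?F = "\<lambda>s. indicator {x..} s :: real"
  have diff: "indicator {a<..b} x = ?F b - ?F a" if "a \<le> b" for a b
    using that by (auto simp: indicator_def)
  have le: "a \<le> b" if in_S: "(c, a, b) \<in> set S" for c a b
  proof -
    obtain p q where "p \<le> q" "q \<le> n" "a = t p" "b = t q" using bspec[OF S in_S] by auto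
    then show ?thesis using mono[of p q] by (cases "p = q") auto
  qed
  have "step_fun S x = (\<Sum>(c, a, b)\<leftarrow>S. c * (?F b - ?F a))"
    unfolding step_fun_def
  proof (intro arg_cong[where f = sum_list] map_cong refl)
    fix p assume "p \<in> set S"
    moreover obtain c a b where "p = (c, a, b)" by (cases p)
    ultimately show "(case p of (c, a, b) \<Rightarrow> c * indicator {a<..b} x) = (case p of (c, a, b) \<Rightarrow> c * (?F b - ?F a))"
      using diff[OF le[of c a b]] by (simp only: prod.case)
  qed
  also have "\<dots> = (\<Sum>i<n. step_fun S (t (Suc i)) * (?F (t (Suc i)) - ?F (t i)))"
    by (rule step_sum_over_partition[OF smono S])
  also have "\<dots> = (\<Sum>i<n. step_fun S (t (Suc i)) * indicator {t i<..t (Suc i)} x)"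
  proof (intro sum.cong refl)
    fix i assume "i \<in> {..<n}"
    then have "t i \<le> t (Suc i)" using mono[of i "Suc i"] by auto
    then show "step_fun S (t (Suc i)) * (?F (t (Suc i)) - ?F (t i)) = step_fun S (t (Suc i)) * indicator {t i<..t (Suc i)} x"
      by (simp only: diff)
  qed
  finally show ?thesis .
qed

text \<open>The cells are disjoint, so the square of the step function has no mixed terms.\<close>

lemma step_fun_norm_over_partition:
  assumes rng: "\<And>i. i \<le> n \<Longrightarrow> t i \<in> {0..T}"
    and smono: "strict_mono_on {..n} t"
    and S: "\<forall>(c, a, b)\<in>set S. \<exists>p q. p \<le> q \<and> q \<le> (n::nat) \<and> a = t p \<and> b = t q"
  shows "L2_norm_sq {0<..<T} (step_fun S) = (\<Sum>i<n. (step_fun S (t (Suc i)))\<^sup>2 * (t (Suc i) - t i))"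
proof -
  have mono: "t i < t j" if "i < j" "j \<le> n" for i j
    using that by (intro strict_mono_onD[OF smono]) auto
  let ?d = "\<lambda>i. step_fun S (t (Suc i))" and ?J = "\<lambda>i. {t i<..t (Suc i)}"
  have lt: "t i < t (Suc i)" if "i < n" for i using mono[of i "Suc i"] that by simp
  have disj: "j = i" if "x \<in> ?J i" "x \<in> ?J j" "i < n" "j < n" for i j x
  proof (rule ccontr)
    have le: "t i \<le> t j" if "i \<le> j" "j \<le> n" for i j using mono[of i j] that by (cases "i = j") auto
    assume "j \<noteq> i"
    then consider "Suc i \<le> j" | "Suc j \<le> i" by linarith
    then show False using that le[of "Suc i" j] le[of "Suc j" i] by cases auto
  qed
  have sq: "(step_fun S x)\<^sup>2 = (\<Sum>i<n. (?d i)\<^sup>2 * indicator (?J i) x)" for x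
  proof (cases "\<exists>i<n. x \<in> ?J i")
    case True
    then obtain k where k: "k < n" "x \<in> ?J k" by auto
    have 1: "(\<Sum>i<n. f i * indicator (?J i) x) = f k" for f :: "nat \<Rightarrow> real"
    proof -
      have "(\<Sum>i<n. f i * indicator (?J i) x) = (\<Sum>i<n. if i = k then f k else 0)"
      proof (intro sum.cong refl)
        fix i assume "i \<in> {..<n}"
        then have "x \<notin> ?J i" if "i \<noteq> k"
          using disj[OF k(2) _ k(1), of i] that by (simp only: lessThan_iff) blast
        moreover have "indicator (?J k) x = (1 :: real)" by (rule indicator_simps(1)[OF k(2)])
        ultimately show "f i * indicator (?J i) x = (if i = k then f k else 0)"
          by (metis indicator_simps(2) mult.right_neutral mult_zero_right)
      qed
      then show ?thesis using k by simp
    qed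
    show ?thesis unfolding 1 by (subst step_fun_over_partition[OF smono S]) (simp add: 1)
  next
    case False
    then have "indicator (?J i) x = (0 :: real)" if "i < n" for i using that by (auto simp: indicator_def)
    then show ?thesis by (subst step_fun_over_partition[OF smono S]) simp
  qed
  have "L2_norm_sq {0<..<T} (step_fun S) = (\<integral>x. (\<Sum>i<n. (?d i)\<^sup>2 * indicator (?J i) x) \<partial>lborel)"
    unfolding L2_norm_sq_eq
  proof (intro integral_cong_AE)
    have "AE x in lborel. x \<noteq> T" by (rule AE_lborel_singleton)
    then show "AE x in lborel. (indicator {0<..<T} x * step_fun S x)\<^sup>2 = (\<Sum>i<n. (?d i)\<^sup>2 * indicator (?J i) x)"
    proof eventually_elim
      case (elim x)
      show ?case
      proof (cases "x \<in> {0<..<T}")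
        case True
        then show ?thesis by (simp only: indicator_simps mult_1_left) (rule sq)
      next
        case False
        have "x \<notin> ?J i" if "i < n" for i
        proof
          assume "x \<in> ?J i"
          then have "0 < x" "x \<le> T" using rng[of i] rng[of "Suc i"] that by auto
          then show False using elim False by simp
        qed
        then show ?thesis using False by simp
      qed
    qed
  qed measurable
  also have "\<dots> = (\<Sum>i<n. (?d i)\<^sup>2 * (\<integral>x. indicator (?J i) x \<partial>lborel))"
    using lt by (subst Bochner_Integration.integral_sum) (auto simp: less_imp_le)
  also have "\<dots> = (\<Sum>i<n. (?d i)\<^sup>2 * (t (Suc i) - t i))"
  proof (intro sum.cong refl arg_cong2[where f = "(*)"])
    fix i assume "i \<in> {..<n}"
    then show "(\<integral>x. indicator (?J i) x \<partial>lborel) = t (Suc i) - t i"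
      using lt[of i] by (simp add: less_imp_le)
  qed
  finally show ?thesis .
qed

section \<open>The Wiener integral\<close>

lemma (in prob_space) iexp_expectation_normal:
  assumes X: "distributed M lborel X (normal_density 0 \<sigma>)" and "\<sigma> > 0"
  shows "(\<integral>\<omega>. iexp (u * X \<omega>) \<partial>M) = of_real (exp (- (u * \<sigma>)\<^sup>2 / 2))"
proof -
  have std: "distributed M lborel (\<lambda>\<omega>. X \<omega> / \<sigma>) std_normal_density"
    using normal_standard_normal_convert[OF \<open>\<sigma> > 0\<close>, of X 0] X by simp
  then have [measurable]: "(\<lambda>\<omega>. X \<omega> / \<sigma>) \<in> borel_measurable M"
    by (auto simp: distributed_def)
  have "(\<integral>\<omega>. iexp (u * X \<omega>) \<partial>M) = (\<integral>\<omega>. iexp ((u * \<sigma>) * (X \<omega> / \<sigma>)) \<partial>M)"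
    using \<open>\<sigma> > 0\<close> by (intro Bochner_Integration.integral_cong) auto
  also have "\<dots> = (\<integral>x. iexp ((u * \<sigma>) * x) \<partial>distr M lborel (\<lambda>\<omega>. X \<omega> / \<sigma>))"
    by (subst integral_distr) auto
  also have "\<dots> = char std_normal_distribution (u * \<sigma>)"
    using std by (simp add: char_def distributed_def)
  finally show ?thesis by (simp add: char_std_normal_distribution)
qed

lemma square_integrable_normal:
  assumes X: "distributed M lborel X (normal_density 0 \<sigma>)" and "\<sigma> > 0"
  shows "integrable M (\<lambda>\<omega>. (X \<omega>)\<^sup>2)"
proof -
  have "integrable lborel (\<lambda>x. normal_density 0 \<sigma> x * x\<^sup>2)"
    using integrable.intros[OF normal_moment_even[OF \<open>\<sigma> > 0\<close>, of 0 1]] by simp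
  then show ?thesis
    using distributed_integrable[OF X, of "\<lambda>x. x\<^sup>2"] by simp
qed

lemma (in prob_space) indep_iexp_sum:
  assumes "indep_vars (\<lambda>_. borel) X I" "finite I"
  shows "(\<integral>\<omega>. iexp (u * (\<Sum>i\<in>I. X i \<omega>)) \<partial>M) = (\<Prod>i\<in>I. \<integral>\<omega>. iexp (u * X i \<omega>) \<partial>M)"
proof -
  have m: "X i \<in> borel_measurable M" if "i \<in> I" for i
    using assms that by (auto simp: indep_vars_def2)
  have "char (distr M borel (\<lambda>\<omega>. \<Sum>i\<in>I. X i \<omega>)) u = (\<Prod>i\<in>I. char (distr M borel (X i)) u)"
    using assms by (intro char_distr_sum)
  moreover have "char (distr M borel Y) u = (\<integral>\<omega>. iexp (u * Y \<omega>) \<partial>M)" if "Y \<in> borel_measurable M" for Y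
    unfolding char_def using that by (subst integral_distr) auto
  ultimately show ?thesis using m by simp
qed

text \<open>This Lipschitz bound is why \<open>L\<^sub>2\<close> convergence of random variables entails convergence of their
  characteristic functions.\<close>

lemma iexp_diff_le: "cmod (iexp a - iexp b) \<le> \<bar>a - b\<bar>"
proof -
  have "iexp a - iexp b = iexp b * (iexp (a - b) - 1)"
    by (simp add: exp_diff right_diff_distrib)
  then have "cmod (iexp a - iexp b) = cmod (iexp (a - b) - 1)"
    by (simp add: norm_mult)
  also have "\<dots> \<le> \<bar>a - b\<bar>" using iexp_approx1[of "a - b" 0] by simp
  finally show ?thesis .
qed

lemma (in prob_space) iexp_expectation_tendsto:
  fixes X :: "nat \<Rightarrow> 'a \<Rightarrow> real" and Z :: "'a \<Rightarrow> real"
  assumes [measurable]: "\<And>n. X n \<in> borel_measurable M" "Z \<in> borel_measurable M"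
    and int: "\<And>n. integrable M (\<lambda>\<omega>. (X n \<omega> - Z \<omega>)\<^sup>2)"
    and lim: "(\<lambda>n. \<integral>\<omega>. (X n \<omega> - Z \<omega>)\<^sup>2 \<partial>M) \<longlonglongrightarrow> 0"
  shows "(\<lambda>n. \<integral>\<omega>. iexp (u * X n \<omega>) \<partial>M) \<longlonglongrightarrow> (\<integral>\<omega>. iexp (u * Z \<omega>) \<partial>M)"
proof (subst LIM_zero_iff[symmetric], rule Lim_null_comparison)
  have intI: "integrable M (\<lambda>\<omega>. iexp (u * Y \<omega>))" if "Y \<in> borel_measurable M" for Y
    using that by (intro integrable_const_bound[of _ 1]) auto
  show "\<forall>\<^sub>F n in sequentially. norm ((\<integral>\<omega>. iexp (u * X n \<omega>) \<partial>M) - (\<integral>\<omega>. iexp (u * Z \<omega>) \<partial>M))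
      \<le> \<bar>u\<bar> * sqrt (\<integral>\<omega>. (X n \<omega> - Z \<omega>)\<^sup>2 \<partial>M)"
  proof (intro always_eventually allI)
    fix n
    let ?D = "\<lambda>\<omega>. \<bar>X n \<omega> - Z \<omega>\<bar>"
    have D: "integrable M ?D"
      by (rule square_integrable_imp_integrable) (use int in auto)
    have "(\<integral>\<omega>. iexp (u * X n \<omega>) \<partial>M) - (\<integral>\<omega>. iexp (u * Z \<omega>) \<partial>M)
        = (\<integral>\<omega>. iexp (u * X n \<omega>) - iexp (u * Z \<omega>) \<partial>M)"
      by (intro Bochner_Integration.integral_diff[symmetric] intI) auto
    also have "norm \<dots> \<le> (\<integral>\<omega>. norm (iexp (u * X n \<omega>) - iexp (u * Z \<omega>)) \<partial>M)"
      by (rule integral_norm_bound)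
    also have "\<dots> \<le> (\<integral>\<omega>. \<bar>u\<bar> * ?D \<omega> \<partial>M)"
    proof (rule integral_mono)
      show "norm (iexp (u * X n \<omega>) - iexp (u * Z \<omega>)) \<le> \<bar>u\<bar> * ?D \<omega>" for \<omega>
        using iexp_diff_le[of "u * X n \<omega>" "u * Z \<omega>"] by (simp add: abs_mult[symmetric] right_diff_distrib)
      show "integrable M (\<lambda>\<omega>. norm (iexp (u * X n \<omega>) - iexp (u * Z \<omega>)))"
        by (intro integrable_norm Bochner_Integration.integrable_diff intI) auto
    qed (use D in auto)
    also have "\<dots> = \<bar>u\<bar> * expectation ?D" by simp
    also have "expectation ?D \<le> sqrt (\<integral>\<omega>. (X n \<omega> - Z \<omega>)\<^sup>2 \<partial>M)"
    proof (rule real_le_rsqrt)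
      show "(expectation ?D)\<^sup>2 \<le> (\<integral>\<omega>. (X n \<omega> - Z \<omega>)\<^sup>2 \<partial>M)"
        using variance_positive[of ?D] variance_eq[OF D] int[of n] by simp
    qed
    finally show "norm ((\<integral>\<omega>. iexp (u * X n \<omega>) \<partial>M) - (\<integral>\<omega>. iexp (u * Z \<omega>) \<partial>M))
      \<le> \<bar>u\<bar> * sqrt (\<integral>\<omega>. (X n \<omega> - Z \<omega>)\<^sup>2 \<partial>M)" by (simp add: mult_left_mono)
  qed
  have "(\<lambda>n. \<bar>u\<bar> * sqrt (\<integral>\<omega>. (X n \<omega> - Z \<omega>)\<^sup>2 \<partial>M)) \<longlonglongrightarrow> \<bar>u\<bar> * sqrt 0"
    by (intro tendsto_intros lim)
  then show "(\<lambda>n. \<bar>u\<bar> * sqrt (\<integral>\<omega>. (X n \<omega> - Z \<omega>)\<^sup>2 \<partial>M)) \<longlonglongrightarrow> 0" by simp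
qed

context brownian_motion
begin

lemma increment_square_integrable:
  assumes "0 \<le> a" "a \<le> b" "b \<le> T"
  shows "integrable M (\<lambda>\<omega>. (w b \<omega> - w a \<omega>)\<^sup>2)"
proof (cases "a = b")
  case False
  then show ?thesis
    using square_integrable_normal[OF normal_increments[of a b]] assms by simp
qed simp

lemma increment_iexp:
  assumes "0 \<le> a" "a < b" "b \<le> T"
  shows "(\<integral>\<omega>. iexp (u * (w b \<omega> - w a \<omega>)) \<partial>M) = of_real (exp (- (u\<^sup>2 * (b - a)) / 2))"
  using iexp_expectation_normal[OF normal_increments[OF assms], of u] assms
  by (simp add: power_mult_distrib)

lemma step_integral_measurable [measurable]:
  "steps_in T S \<Longrightarrow> step_integral w S \<in> borel_measurable M"
proof (induction S)
  case (Cons p S)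
  obtain c a b where p: "p = (c, a, b)" by (cases p)
  have "w a \<in> borel_measurable M" "w b \<in> borel_measurable M"
    using Cons.prems by (auto simp: p steps_in_Cons intro!: random_variable)
  moreover have "step_integral w (p # S) = (\<lambda>\<omega>. c * (w b \<omega> - w a \<omega>) + step_integral w S \<omega>)"
    unfolding p by (rule ext) simp
  ultimately show ?case using Cons by (simp add: p steps_in_Cons)
next
  case Nil
  have "step_integral w [] = (\<lambda>\<omega>. 0)" by (rule ext) simp
  then show ?case by simp
qed

lemma step_integral_square_integrable:
  "steps_in T S \<Longrightarrow> integrable M (\<lambda>\<omega>. (step_integral w S \<omega>)\<^sup>2)"
proof (induction S)
  case (Cons p S)
  obtain c a b where p: "p = (c, a, b)" by (cases p)
  have ab: "0 \<le> a" "a \<le> b" "b \<le> T" "steps_in T S" using Cons.prems by (auto simp: p steps_in_Cons)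
  have m: "w a \<in> borel_measurable M" "w b \<in> borel_measurable M"
    using ab by (auto intro!: random_variable)
  show ?case unfolding p step_integral_Cons
    using Cons.IH ab m increment_square_integrable[OF ab(1-3)] step_integral_measurable[OF ab(4)]
    by (intro integrable_square_add) (auto simp: power_mult_distrib)
qed simp

text \<open>On a common partition the step integral is a sum of independent centred Gaussian increments; their
  variances add up to the squared norm of the step function.\<close>

lemma step_integral_iexp:
  assumes T: "T \<ge> 0" and S: "steps_in T S"
  shows "(\<integral>\<omega>. iexp (u * step_integral w S \<omega>) \<partial>M)
    = of_real (exp (- (u\<^sup>2 * L2_norm_sq {0<..<T} (step_fun S)) / 2))"
proof -
  obtain n t where "adapted_partition T S n t"
    using ex_adapted_partition[OF T S] by blast
  then have P: "(\<forall>i\<le>n. t i \<in> {0..T}) \<and> strict_mono_on {..n} t \<and>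
     (\<forall>(c, a, b)\<in>set S. \<exists>p q. p \<le> q \<and> q \<le> n \<and> a = t p \<and> b = t q)"
    unfolding adapted_partition_def .
  have rng: "t i \<in> {0..T}" if "i \<le> n" for i using conjunct1[OF P] that by blast
  note smono = conjunct1[OF conjunct2[OF P]] and part = conjunct2[OF conjunct2[OF P]]
  have mono: "t i < t j" if "i < j" "j \<le> n" for i j
    using that by (intro strict_mono_onD[OF smono]) auto
  let ?d = "\<lambda>i. step_fun S (t (Suc i))" and ?\<Delta> = "\<lambda>i \<omega>. w (t (Suc i)) \<omega> - w (t i) \<omega>"
  have "indep_vars (\<lambda>_. borel) ?\<Delta> {..<n}"
    using rng mono by (intro indep_increments) auto
  then have ind: "indep_vars (\<lambda>_. borel) (\<lambda>i \<omega>. ?d i * ?\<Delta> i \<omega>) {..<n}"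
    by (rule indep_vars_compose2) simp
  have "(\<integral>\<omega>. iexp (u * step_integral w S \<omega>) \<partial>M) = (\<integral>\<omega>. iexp (u * (\<Sum>i<n. ?d i * ?\<Delta> i \<omega>)) \<partial>M)"
    unfolding step_integral_over_partition[OF smono part, of w] ..
  also have "\<dots> = (\<Prod>i<n. \<integral>\<omega>. iexp (u * (?d i * ?\<Delta> i \<omega>)) \<partial>M)"
    by (rule indep_iexp_sum[OF ind]) simp
  also have "\<dots> = (\<Prod>i<n. of_real (exp (- (u\<^sup>2 * ((?d i)\<^sup>2 * (t (Suc i) - t i))) / 2)))"
  proof (intro prod.cong refl)
    fix i assume "i \<in> {..<n}"
    then have "0 \<le> t i" "t i < t (Suc i)" "t (Suc i) \<le> T"
      using rng[of i] rng[of "Suc i"] mono[of i "Suc i"] by auto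
    from increment_iexp[OF this, of "u * ?d i"]
    show "(\<integral>\<omega>. iexp (u * (?d i * ?\<Delta> i \<omega>)) \<partial>M) = of_real (exp (- (u\<^sup>2 * ((?d i)\<^sup>2 * (t (Suc i) - t i))) / 2))"
      by (simp only: mult.assoc[symmetric] power_mult_distrib)
  qed
  also have "\<dots> = of_real (exp (\<Sum>i<n. - (u\<^sup>2 * ((?d i)\<^sup>2 * (t (Suc i) - t i))) / 2))"
    by (simp only: of_real_prod[symmetric] exp_sum[OF finite_lessThan])
  also have "(\<Sum>i<n. - (u\<^sup>2 * ((?d i)\<^sup>2 * (t (Suc i) - t i))) / 2)
      = - (u\<^sup>2 * (\<Sum>i<n. (?d i)\<^sup>2 * (t (Suc i) - t i))) / 2"
    by (simp add: sum_distrib_left sum_divide_distrib sum_negf)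
  also have "(\<Sum>i<n. (?d i)\<^sup>2 * (t (Suc i) - t i)) = L2_norm_sq {0<..<T} (step_fun S)"
    by (rule step_fun_norm_over_partition[OF _ smono part, symmetric]) (rule rng)
  finally show ?thesis .
qed


lemma has_wiener_integral_iff:
  "has_wiener_integral M T w f Z \<longleftrightarrow>
     L2_on {0<..<T} f \<and> Z \<in> borel_measurable M \<and> integrable M (\<lambda>\<omega>. (Z \<omega>)\<^sup>2) \<and>
     (\<exists>S. (\<forall>n. steps_in T (S n)) \<and>
        (\<lambda>n. L2_norm_sq {0<..<T} (\<lambda>t. step_fun (S n) t - f t)) \<longlonglongrightarrow> 0 \<and>
        (\<lambda>n. \<integral>\<omega>. (step_integral w (S n) \<omega> - Z \<omega>)\<^sup>2 \<partial>M) \<longlonglongrightarrow> 0)"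
  unfolding has_wiener_integral_def steps_in_def ..

lemma has_wiener_integralE:
  assumes "has_wiener_integral M T w f Z"
  obtains S where "\<And>n. steps_in T (S n)"
    "(\<lambda>n. L2_norm_sq {0<..<T} (\<lambda>t. step_fun (S n) t - f t)) \<longlonglongrightarrow> 0"
    "(\<lambda>n. \<integral>\<omega>. (step_integral w (S n) \<omega> - Z \<omega>)\<^sup>2 \<partial>M) \<longlonglongrightarrow> 0"
  using assms unfolding has_wiener_integral_iff by (elim conjE exE) (rule that, erule spec, assumption+)

lemma has_wiener_integralI:
  assumes "L2_on {0<..<T} f" "Z \<in> borel_measurable M" "integrable M (\<lambda>\<omega>. (Z \<omega>)\<^sup>2)"
    and "\<And>n. steps_in T (S n)"
    and "(\<lambda>n. L2_norm_sq {0<..<T} (\<lambda>t. step_fun (S n) t - f t)) \<longlonglongrightarrow> 0"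
    and "(\<lambda>n. \<integral>\<omega>. (step_integral w (S n) \<omega> - Z \<omega>)\<^sup>2 \<partial>M) \<longlonglongrightarrow> 0"
  shows "has_wiener_integral M T w f Z"
  unfolding has_wiener_integral_iff by (intro conjI exI[of _ S] allI assms)

lemma has_wiener_integralD:
  assumes "has_wiener_integral M T w f Z"
  shows "L2_on {0<..<T} f" "Z \<in> borel_measurable M" "integrable M (\<lambda>\<omega>. (Z \<omega>)\<^sup>2)"
proof -
  note * = assms[unfolded has_wiener_integral_iff]
  show "L2_on {0<..<T} f" "Z \<in> borel_measurable M" "integrable M (\<lambda>\<omega>. (Z \<omega>)\<^sup>2)"
    using conjunct1[OF *] conjunct1[OF conjunct2[OF *]] conjunct1[OF conjunct2[OF conjunct2[OF *]]]
    by (simp_all only:)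
qed

lemma step_error_measurable:
  assumes "steps_in T S" "Z \<in> borel_measurable M"
  shows "(\<lambda>\<omega>. step_integral w S \<omega> - Z \<omega>) \<in> borel_measurable M"
  using step_integral_measurable[OF assms(1)] assms(2) by simp

lemma step_error_square_integrable:
  assumes "steps_in T S" "Z \<in> borel_measurable M" "integrable M (\<lambda>\<omega>. (Z \<omega>)\<^sup>2)"
  shows "integrable M (\<lambda>\<omega>. (step_integral w S \<omega> - Z \<omega>)\<^sup>2)"
  using integrable_square_add[OF step_integral_measurable[OF assms(1)], of "\<lambda>\<omega>. - Z \<omega>"]
    step_integral_square_integrable[OF assms(1)] assms by simp

lemma L2_on_step_error:
  assumes "L2_on {0<..<T} f"
  shows "L2_on {0<..<T} (\<lambda>t. step_fun S t - f t)"
  using L2_on_add[OF L2_on_step_fun[of T S] L2_on_scale[OF assms, of "-1"]] by simp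

lemma has_wiener_integral_add:
  assumes f: "has_wiener_integral M T w f Z" and g: "has_wiener_integral M T w g Y"
  shows "has_wiener_integral M T w (\<lambda>t. f t + g t) (\<lambda>\<omega>. Z \<omega> + Y \<omega>)"
proof -
  note F = has_wiener_integralD[OF f] and G = has_wiener_integralD[OF g]
  obtain S where S: "\<And>n. steps_in T (S n)"
    "(\<lambda>n. L2_norm_sq {0<..<T} (\<lambda>t. step_fun (S n) t - f t)) \<longlonglongrightarrow> 0"
    "(\<lambda>n. \<integral>\<omega>. (step_integral w (S n) \<omega> - Z \<omega>)\<^sup>2 \<partial>M) \<longlonglongrightarrow> 0"
    using has_wiener_integralE[OF f] by blast
  obtain R where R: "\<And>n. steps_in T (R n)"
    "(\<lambda>n. L2_norm_sq {0<..<T} (\<lambda>t. step_fun (R n) t - g t)) \<longlonglongrightarrow> 0"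
    "(\<lambda>n. \<integral>\<omega>. (step_integral w (R n) \<omega> - Y \<omega>)\<^sup>2 \<partial>M) \<longlonglongrightarrow> 0"
    using has_wiener_integralE[OF g] by blast
  show ?thesis
  proof (rule has_wiener_integralI[where S = "\<lambda>n. S n @ R n"])
    show "L2_on {0<..<T} (\<lambda>t. f t + g t)" using F G by (intro L2_on_add)
    show "(\<lambda>\<omega>. Z \<omega> + Y \<omega>) \<in> borel_measurable M" using F G by simp
    show "integrable M (\<lambda>\<omega>. (Z \<omega> + Y \<omega>)\<^sup>2)" using F G by (intro integrable_square_add)
    show "steps_in T (S n @ R n)" for n using S R by simp
    have "(\<lambda>n. \<integral>x. (indicator {0<..<T} x * (step_fun (S n) x - f x) + indicator {0<..<T} x * (step_fun (R n) x - g x))\<^sup>2 \<partial>lborel) \<longlonglongrightarrow> 0"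
      using S(2) R(2) L2_on_step_error[OF F(1)] L2_on_step_error[OF G(1)]
      unfolding L2_norm_sq_eq L2_on_iff by (intro tendsto_integral_square_add) (simp_all only:)
    then show "(\<lambda>n. L2_norm_sq {0<..<T} (\<lambda>t. step_fun (S n @ R n) t - (f t + g t))) \<longlonglongrightarrow> 0"
      unfolding L2_norm_sq_eq by (simp add: distrib_left[symmetric] add_diff_add)
    have "(\<lambda>n. \<integral>\<omega>. ((step_integral w (S n) \<omega> - Z \<omega>) + (step_integral w (R n) \<omega> - Y \<omega>))\<^sup>2 \<partial>M) \<longlonglongrightarrow> 0"
      using S(3) R(3) step_error_measurable[OF S(1) F(2)] step_error_measurable[OF R(1) G(2)]
        step_error_square_integrable[OF S(1) F(2,3)] step_error_square_integrable[OF R(1) G(2,3)]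
      by (intro tendsto_integral_square_add)
    then show "(\<lambda>n. \<integral>\<omega>. (step_integral w (S n @ R n) \<omega> - (Z \<omega> + Y \<omega>))\<^sup>2 \<partial>M) \<longlonglongrightarrow> 0"
      by (simp add: add_diff_add)
  qed
qed

lemma has_wiener_integral_scale:
  assumes f: "has_wiener_integral M T w f Z"
  shows "has_wiener_integral M T w (\<lambda>t. c * f t) (\<lambda>\<omega>. c * Z \<omega>)"
proof -
  note F = has_wiener_integralD[OF f]
  obtain S where S: "\<And>n. steps_in T (S n)"
    "(\<lambda>n. L2_norm_sq {0<..<T} (\<lambda>t. step_fun (S n) t - f t)) \<longlonglongrightarrow> 0"
    "(\<lambda>n. \<integral>\<omega>. (step_integral w (S n) \<omega> - Z \<omega>)\<^sup>2 \<partial>M) \<longlonglongrightarrow> 0"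
    using has_wiener_integralE[OF f] by blast
  show ?thesis
  proof (rule has_wiener_integralI[where S = "\<lambda>n. scale_steps c (S n)"])
    show "L2_on {0<..<T} (\<lambda>t. c * f t)" using F by (intro L2_on_scale)
    show "(\<lambda>\<omega>. c * Z \<omega>) \<in> borel_measurable M" using F by simp
    show "integrable M (\<lambda>\<omega>. (c * Z \<omega>)\<^sup>2)" using F by (simp add: power_mult_distrib)
    show "steps_in T (scale_steps c (S n))" for n using S by simp
    show "(\<lambda>n. L2_norm_sq {0<..<T} (\<lambda>t. step_fun (scale_steps c (S n)) t - c * f t)) \<longlonglongrightarrow> 0"
      using tendsto_mult_right_zero[OF S(2), of "c\<^sup>2"]
      by (simp add: step_fun_scale right_diff_distrib[symmetric] L2_norm_sq_scale)
    show "(\<lambda>n. \<integral>\<omega>. (step_integral w (scale_steps c (S n)) \<omega> - c * Z \<omega>)\<^sup>2 \<partial>M) \<longlonglongrightarrow> 0"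
      using tendsto_mult_right_zero[OF S(3), of "c\<^sup>2"]
      by (simp add: step_integral_scale right_diff_distrib[symmetric] power_mult_distrib)
  qed
qed

lemma has_wiener_integral_step:
  assumes "steps_in T S"
  shows "has_wiener_integral M T w (step_fun S) (step_integral w S)"
  by (rule has_wiener_integralI[where S = "\<lambda>_. S"])
     (use assms in \<open>simp_all add: L2_on_step_fun step_integral_measurable step_integral_square_integrable L2_norm_sq_eq\<close>)

lemma has_wiener_integral_sum:
  assumes "finite I" "\<And>j. j \<in> I \<Longrightarrow> has_wiener_integral M T w (f j) (Z j)"
  shows "has_wiener_integral M T w (\<lambda>t. \<Sum>j\<in>I. c j * f j t) (\<lambda>\<omega>. \<Sum>j\<in>I. c j * Z j \<omega>)"
  using assms
proof (induction I rule: finite_induct)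
  case empty
  have "step_fun [] = (\<lambda>t. 0)" "step_integral w [] = (\<lambda>\<omega>. 0)" by (simp_all add: fun_eq_iff)
  then show ?case using has_wiener_integral_step[of "[]"] by simp
next
  case (insert i I)
  then have "has_wiener_integral M T w (\<lambda>t. c i * f i t + (\<Sum>j\<in>I. c j * f j t)) (\<lambda>\<omega>. c i * Z i \<omega> + (\<Sum>j\<in>I. c j * Z j \<omega>))"
    by (intro has_wiener_integral_add has_wiener_integral_scale) auto
  with insert.hyps show ?case by simp
qed

text \<open>Both sides are continuous under the limits that define the Wiener integral, and they agree for step
  functions. The mean, the normal law and the independence of Wiener integrals are all read off from this formula.\<close>

lemma wiener_integral_iexp:
  assumes T: "T \<ge> 0" and f: "has_wiener_integral M T w f Z"
  shows "(\<integral>\<omega>. iexp (u * Z \<omega>) \<partial>M) = of_real (exp (- (u\<^sup>2 * L2_norm_sq {0<..<T} f) / 2))"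
proof -
  note F = has_wiener_integralD[OF f]
  obtain S where S: "\<And>n. steps_in T (S n)"
    "(\<lambda>n. L2_norm_sq {0<..<T} (\<lambda>t. step_fun (S n) t - f t)) \<longlonglongrightarrow> 0"
    "(\<lambda>n. \<integral>\<omega>. (step_integral w (S n) \<omega> - Z \<omega>)\<^sup>2 \<partial>M) \<longlonglongrightarrow> 0"
    using has_wiener_integralE[OF f] by blast
  have "(\<lambda>n. \<integral>\<omega>. iexp (u * step_integral w (S n) \<omega>) \<partial>M) \<longlonglongrightarrow> (\<integral>\<omega>. iexp (u * Z \<omega>) \<partial>M)"
    by (intro iexp_expectation_tendsto step_integral_measurable[OF S(1)] F(2) S(3) step_error_square_integrable[OF S(1) F(2,3)])
  moreover have "(\<lambda>n. \<integral>\<omega>. iexp (u * step_integral w (S n) \<omega>) \<partial>M)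
      \<longlonglongrightarrow> of_real (exp (- (u\<^sup>2 * L2_norm_sq {0<..<T} f) / 2))"
  proof -
    have "(\<lambda>n. L2_norm_sq {0<..<T} (step_fun (S n))) \<longlonglongrightarrow> L2_norm_sq {0<..<T} f"
      unfolding L2_norm_sq_eq
    proof (rule tendsto_integral_square)
      show "(\<lambda>n. \<integral>x. (indicator {0<..<T} x * step_fun (S n) x - indicator {0<..<T} x * f x)\<^sup>2 \<partial>lborel) \<longlonglongrightarrow> 0"
        using S(2) unfolding L2_norm_sq_eq by (simp add: right_diff_distrib)
    qed (use F(1) L2_on_step_fun[of T] in \<open>simp_all add: L2_on_iff\<close>)
    then show ?thesis
      unfolding step_integral_iexp[OF T S(1)]
      by (intro tendsto_of_real tendsto_exp tendsto_divide tendsto_minus tendsto_mult tendsto_const) simp_all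
  qed
  ultimately show ?thesis by (rule LIMSEQ_unique)
qed

text \<open>By linearity and Pythagoras, the characteristic function of \<open>\<Sum> \<theta>\<^sub>j Z\<^sub>j\<close> is a product of functions of the
  single \<open>\<theta>\<^sub>j\<close>. The integrands are orthogonal but not normalised, because one of them will be a projection
  residual of unknown and possibly vanishing norm.\<close>

lemma wiener_integral_indep:
  assumes T: "T \<ge> 0" and fin: "finite I" and f: "\<And>j. j \<in> I \<Longrightarrow> has_wiener_integral M T w (f j) (Z j)"
    and orth: "\<And>i j. i \<in> I \<Longrightarrow> j \<in> I \<Longrightarrow> i \<noteq> j \<Longrightarrow> L2_inner {0<..<T} (f i) (f j) = 0"
  shows "indep_vars (\<lambda>_. borel) Z I"
proof (rule indep_vars_if_iexp_factor[OF fin])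
  fix j assume "j \<in> I"
  then show "Z j \<in> borel_measurable M" using has_wiener_integralD(2)[OF f] by simp
next
  fix \<theta> :: "_ \<Rightarrow> real"
  have L2: "L2_on {0<..<T} (f j)" if "j \<in> I" for j using has_wiener_integralD(1)[OF f] that by simp
  have "(\<integral>\<omega>. (\<Prod>j\<in>I. iexp (\<theta> j * Z j \<omega>)) \<partial>M) = (\<integral>\<omega>. iexp (1 * (\<Sum>j\<in>I. \<theta> j * Z j \<omega>)) \<partial>M)"
    by (simp only: exp_sum[OF fin, symmetric] sum_distrib_left[symmetric] of_real_sum[symmetric] mult_1_left)
  also have "\<dots> = of_real (exp (- (1\<^sup>2 * L2_norm_sq {0<..<T} (\<lambda>t. \<Sum>j\<in>I. \<theta> j * f j t)) / 2))"
    by (rule wiener_integral_iexp[OF T has_wiener_integral_sum[OF fin f]])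
  also have "L2_norm_sq {0<..<T} (\<lambda>t. \<Sum>j\<in>I. \<theta> j * f j t) = (\<Sum>j\<in>I. (\<theta> j)\<^sup>2 * L2_norm_sq {0<..<T} (f j))"
    by (rule L2_norm_sq_orthogonal_sum[OF fin L2 orth])
  also have "- (1\<^sup>2 * (\<Sum>j\<in>I. (\<theta> j)\<^sup>2 * L2_norm_sq {0<..<T} (f j))) / 2
      = (\<Sum>j\<in>I. - ((\<theta> j)\<^sup>2 * L2_norm_sq {0<..<T} (f j)) / 2)"
    by (simp add: sum_divide_distrib sum_negf)
  also have "of_real (exp \<dots>) = (\<Prod>j\<in>I. complex_of_real (exp (- ((\<theta> j)\<^sup>2 * L2_norm_sq {0<..<T} (f j)) / 2)))"
    by (simp only: of_real_prod[symmetric] exp_sum[OF fin])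
  also have "\<dots> = (\<Prod>j\<in>I. \<integral>\<omega>. iexp (\<theta> j * Z j \<omega>) \<partial>M)"
    by (intro prod.cong refl wiener_integral_iexp[OF T f, symmetric])
  finally show "(\<integral>\<omega>. (\<Prod>j\<in>I. iexp (\<theta> j * Z j \<omega>)) \<partial>M) = (\<Prod>j\<in>I. \<integral>\<omega>. iexp (\<theta> j * Z j \<omega>) \<partial>M)" .
qed

lemma wiener_integral_integrable:
  assumes "has_wiener_integral M T w f Z"
  shows "integrable M Z"
  by (rule square_integrable_imp_integrable[OF has_wiener_integralD(2,3)[OF assms]])

text \<open>The characteristic function is even in \<open>u\<close>, so \<open>Z\<close> and \<open>- Z\<close> have the same law.\<close>

lemma wiener_integral_mean:
  assumes T: "T \<ge> 0" and f: "has_wiener_integral M T w f Z"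
  shows "expectation Z = 0"
proof -
  have [measurable]: "Z \<in> borel_measurable M" using has_wiener_integralD[OF f] by simp
  have neg: "has_wiener_integral M T w (\<lambda>t. (-1) * f t) (\<lambda>\<omega>. (-1) * Z \<omega>)"
    by (rule has_wiener_integral_scale[OF f])
  have "distr M borel (\<lambda>\<omega>. (-1) * Z \<omega>) = distr M borel Z"
  proof (rule Levy_uniqueness)
    show "char (distr M borel (\<lambda>\<omega>. (-1) * Z \<omega>)) = char (distr M borel Z)"
    proof
      fix u
      have "char (distr M borel (\<lambda>\<omega>. (-1) * Z \<omega>)) u = (\<integral>\<omega>. iexp (u * ((-1) * Z \<omega>)) \<partial>M)"
        unfolding char_def by (subst integral_distr) auto
      also have "\<dots> = (\<integral>\<omega>. iexp (u * Z \<omega>) \<partial>M)"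
        unfolding wiener_integral_iexp[OF T neg] wiener_integral_iexp[OF T f] L2_norm_sq_scale by simp
      also have "\<dots> = char (distr M borel Z) u"
        unfolding char_def by (subst integral_distr) auto
      finally show "char (distr M borel (\<lambda>\<omega>. (-1) * Z \<omega>)) u = char (distr M borel Z) u" .
    qed
  qed (simp_all add: real_distribution_distr)
  then have "(\<integral>x. x \<partial>distr M borel (\<lambda>\<omega>. (-1) * Z \<omega>)) = (\<integral>x. x \<partial>distr M borel Z)" by simp
  then have "(\<integral>\<omega>. (-1) * Z \<omega> \<partial>M) = expectation Z"
    by (simp add: integral_distr)
  then show ?thesis by simp
qed

lemma wiener_integral_std_normal:
  assumes T: "T \<ge> 0" and f: "has_wiener_integral M T w f Z" and norm: "L2_norm_sq {0<..<T} f = 1"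
  shows "distributed M lborel Z std_normal_density"
proof -
  have [measurable]: "Z \<in> borel_measurable M" using has_wiener_integralD[OF f] by simp
  have "distr M borel Z = std_normal_distribution"
  proof (rule Levy_uniqueness)
    show "char (distr M borel Z) = char std_normal_distribution"
    proof
      fix u
      have "char (distr M borel Z) u = (\<integral>\<omega>. iexp (u * Z \<omega>) \<partial>M)"
        unfolding char_def by (subst integral_distr) auto
      also have "\<dots> = char std_normal_distribution u"
        unfolding wiener_integral_iexp[OF T f] norm char_std_normal_distribution by simp
      finally show "char (distr M borel Z) u = char std_normal_distribution u" .
    qed
  qed (simp_all add: real_distribution_distr real_dist_normal_dist)
  moreover have "distr M lborel Z = distr M borel Z" by (rule distr_cong) simp_all
  ultimately show ?thesis by (simp add: distributed_def)
qed

lemma increment_wiener_integral: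
  assumes "0 \<le> s" "s \<le> T"
  shows "has_wiener_integral M T w (indicator {0<..s}) (\<lambda>\<omega>. w s \<omega> - w 0 \<omega>)"
proof -
  have "step_fun [(1, 0, s)] = indicator {0<..s}" "step_integral w [(1, 0, s)] = (\<lambda>\<omega>. w s \<omega> - w 0 \<omega>)"
    by (auto simp: fun_eq_iff)
  then show ?thesis using has_wiener_integral_step[of "[(1, 0, s)]"] assms by (simp add: steps_in_Cons)
qed

end

section \<open>Chaos coefficients of Wiener integrals\<close>

text \<open>The cosines enter the chaos coefficients only through their orthonormality, so the family \<open>f\<close> is kept
  abstract.\<close>

locale wiener_chaos = brownian_motion M T w
  for M :: "'a measure" and T w +
  fixes f :: "nat \<Rightarrow> real \<Rightarrow> real" and \<xi> :: "nat \<Rightarrow> 'a \<Rightarrow> real"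
  assumes T_nonneg: "T \<ge> 0"
    and wiener: "\<And>k. k \<ge> 1 \<Longrightarrow> has_wiener_integral M T w (f k) (\<xi> k)"
    and orthonormal: "\<And>j k. j \<ge> 1 \<Longrightarrow> k \<ge> 1 \<Longrightarrow> L2_inner {0<..<T} (f j) (f k) = (if j = k then 1 else 0)"
begin

lemma L2_basis: "k \<ge> 1 \<Longrightarrow> L2_on {0<..<T} (f k)"
  using has_wiener_integralD(1)[OF wiener] .

lemma xi_measurable: "k \<ge> 1 \<Longrightarrow> \<xi> k \<in> borel_measurable M"
  using has_wiener_integralD(2)[OF wiener] .

lemma xi_std_normal: "k \<ge> 1 \<Longrightarrow> distributed M lborel (\<xi> k) std_normal_density"
  using wiener_integral_std_normal[OF T_nonneg wiener] orthonormal[of k k] by (simp add: L2_inner_same)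

lemma xi_function_integrable:
  assumes "k \<ge> 1" "g \<in> borel_measurable borel" "integrable lborel (\<lambda>x. std_normal_density x * g x)"
  shows "integrable M (\<lambda>\<omega>. g (\<xi> k \<omega>))"
  using distributed_integrable[OF xi_std_normal[OF assms(1)], of g] assms by simp

lemma xi_function_expectation:
  assumes "k \<ge> 1" "g \<in> borel_measurable borel"
  shows "(\<integral>\<omega>. g (\<xi> k \<omega>) \<partial>M) = (\<integral>x. std_normal_density x * g x \<partial>lborel)"
  using distributed_integral[OF xi_std_normal[OF assms(1)], of g] assms by simp

lemma xi_indep:
  assumes "finite K" "K \<subseteq> {1..}"
  shows "indep_vars (\<lambda>_. borel) \<xi> K"
proof (rule wiener_integral_indep[OF T_nonneg assms(1), where f = f])
  show "has_wiener_integral M T w (f j) (\<xi> j)" if "j \<in> K" for j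
    using assms that by (intro wiener) auto
  show "L2_inner {0<..<T} (f i) (f j) = 0" if "i \<in> K" "j \<in> K" "i \<noteq> j" for i j
    using orthonormal[of i j] assms that by auto
qed

lemma
  assumes K: "finite K" "K \<subseteq> {1..}"
    and g: "\<And>k. k \<in> K \<Longrightarrow> g k \<in> borel_measurable borel"
    and int: "\<And>k. k \<in> K \<Longrightarrow> integrable lborel (\<lambda>x. std_normal_density x * g k x)"
  shows xi_prod_integrable: "integrable M (\<lambda>\<omega>. \<Prod>k\<in>K. g k (\<xi> k \<omega>))"
    and xi_prod_expectation: "(\<integral>\<omega>. (\<Prod>k\<in>K. g k (\<xi> k \<omega>)) \<partial>M) = (\<Prod>k\<in>K. \<integral>x. std_normal_density x * g k x \<partial>lborel)"
proof -
  have ind: "indep_vars (\<lambda>_. borel) (\<lambda>k \<omega>. g k (\<xi> k \<omega>)) K"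
    by (rule indep_vars_compose2[OF xi_indep[OF K]]) (rule g)
  have ge: "k \<ge> 1" if "k \<in> K" for k using K that by auto
  have i: "integrable M (\<lambda>\<omega>. g k (\<xi> k \<omega>))" if "k \<in> K" for k
    using xi_function_integrable[OF ge g int] that by blast
  show "integrable M (\<lambda>\<omega>. \<Prod>k\<in>K. g k (\<xi> k \<omega>))"
    by (rule indep_vars_integrable[OF K(1) ind i])
  have "(\<integral>\<omega>. (\<Prod>k\<in>K. g k (\<xi> k \<omega>)) \<partial>M) = (\<Prod>k\<in>K. \<integral>\<omega>. g k (\<xi> k \<omega>) \<partial>M)"
    by (rule indep_vars_lebesgue_integral[OF K(1) ind i])
  also have "\<dots> = (\<Prod>k\<in>K. \<integral>x. std_normal_density x * g k x \<partial>lborel)"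
    using ge g by (intro prod.cong refl xi_function_expectation)
  finally show "(\<integral>\<omega>. (\<Prod>k\<in>K. g k (\<xi> k \<omega>)) \<partial>M) = (\<Prod>k\<in>K. \<integral>x. std_normal_density x * g k x \<partial>lborel)" .
qed

lemma keys_multi_index: "\<alpha> \<in> multi_indices \<Longrightarrow> Poly_Mapping.keys \<alpha> \<subseteq> {1..}"
  by (simp add: multi_indices_def)

lemma chaos_basis_measurable: "\<alpha> \<in> multi_indices \<Longrightarrow> chaos_basis \<xi> \<alpha> \<in> borel_measurable M"
proof -
  assume \<alpha>: "\<alpha> \<in> multi_indices"
  have "(\<lambda>\<omega>. hermite_normed (Poly_Mapping.lookup \<alpha> k) (\<xi> k \<omega>)) \<in> borel_measurable M"
    if "k \<in> Poly_Mapping.keys \<alpha>" for k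
  proof -
    have "\<xi> k \<in> borel_measurable M" using keys_multi_index[OF \<alpha>] that by (intro xi_measurable) auto
    then show ?thesis by (rule measurable_compose) measurable
  qed
  then show ?thesis unfolding chaos_basis_eq[abs_def] by (intro borel_measurable_prod)
qed

lemma chaos_basis_square_integrable:
  assumes "\<alpha> \<in> multi_indices"
  shows "integrable M (\<lambda>\<omega>. (chaos_basis \<xi> \<alpha> \<omega>)\<^sup>2)"
  unfolding chaos_basis_eq prod_power_distrib
  by (rule xi_prod_integrable[where g = "\<lambda>k x. (hermite_normed (Poly_Mapping.lookup \<alpha> k) x)\<^sup>2",
        OF finite_keys keys_multi_index[OF assms]])
     (simp_all add: integrable_gaussian_hermite)

lemma chaos_basis_expectation:
  assumes "\<alpha> \<in> multi_indices"
  shows "(\<integral>\<omega>. chaos_basis \<xi> \<alpha> \<omega> \<partial>M) = (if \<alpha> = 0 then 1 else 0)"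
proof -
  let ?n = "Poly_Mapping.lookup \<alpha>"
  have "(\<integral>\<omega>. chaos_basis \<xi> \<alpha> \<omega> \<partial>M)
      = (\<Prod>k\<in>Poly_Mapping.keys \<alpha>. \<integral>x. std_normal_density x * hermite_normed (?n k) x \<partial>lborel)"
    unfolding chaos_basis_eq
    by (rule xi_prod_expectation[OF finite_keys keys_multi_index[OF assms]])
       (simp_all add: integrable_gaussian_hermite)
  also have "\<dots> = (\<Prod>k\<in>Poly_Mapping.keys \<alpha>. 0)"
    by (intro prod.cong refl gaussian_hermite_normed_mean) (simp add: in_keys_iff)
  also have "\<dots> = (if \<alpha> = 0 then 1 else 0)" by (simp add: card_gt_0_iff)
  finally show ?thesis .
qed

text \<open>By independence the expectation is a product over the support of \<open>\<alpha>\<close>. A factor with index other than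
  \<open>j\<close> is the mean of a Hermite polynomial of positive degree and vanishes; if \<open>j\<close> is the only index, the
  factor is \<open>E [x H\<^sub>n] / \<surd>n!\<close>, which vanishes for \<open>n \<noteq> 1\<close>.\<close>

lemma xi_times_chaos_basis:
  assumes \<alpha>: "\<alpha> \<in> multi_indices" and j: "j \<in> Poly_Mapping.keys \<alpha>"
  shows "integrable M (\<lambda>\<omega>. \<xi> j \<omega> * chaos_basis \<xi> \<alpha> \<omega>)"
    and "(\<integral>\<omega>. \<xi> j \<omega> * chaos_basis \<xi> \<alpha> \<omega> \<partial>M) = (if \<alpha> = Poly_Mapping.single j 1 then 1 else 0)"
proof -
  let ?K = "Poly_Mapping.keys \<alpha>" and ?n = "Poly_Mapping.lookup \<alpha>"
  define g where "g k x = (if k = j then x else 1) * hermite_normed (?n k) x" for k and x :: real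
  have eq: "\<xi> j \<omega> * chaos_basis \<xi> \<alpha> \<omega> = (\<Prod>k\<in>?K. g k (\<xi> k \<omega>))" for \<omega>
  proof -
    have "(\<Prod>k\<in>?K. if k = j then \<xi> k \<omega> else 1) = \<xi> j \<omega>"
      using j by (simp add: prod.delta)
    then show ?thesis unfolding g_def chaos_basis_eq prod.distrib by simp
  qed
  have m: "g k \<in> borel_measurable borel" for k unfolding g_def[abs_def] by measurable
  have i: "integrable lborel (\<lambda>x. std_normal_density x * g k x)" for k
    using integrable_gaussian_hermite[of "?n k"] by (cases "k = j") (simp_all add: g_def)
  show "integrable M (\<lambda>\<omega>. \<xi> j \<omega> * chaos_basis \<xi> \<alpha> \<omega>)"
    unfolding eq by (rule xi_prod_integrable[OF finite_keys keys_multi_index[OF \<alpha>] m i])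
  have E: "(\<integral>\<omega>. \<xi> j \<omega> * chaos_basis \<xi> \<alpha> \<omega> \<partial>M) = (\<Prod>k\<in>?K. \<integral>x. std_normal_density x * g k x \<partial>lborel)"
    unfolding eq by (rule xi_prod_expectation[OF finite_keys keys_multi_index[OF \<alpha>] m i])
  show "(\<integral>\<omega>. \<xi> j \<omega> * chaos_basis \<xi> \<alpha> \<omega> \<partial>M) = (if \<alpha> = Poly_Mapping.single j 1 then 1 else 0)"
  proof (cases "\<alpha> = Poly_Mapping.single j 1")
    case True
    then have "?K = {j}" and "?n j = Suc 0" by simp_all
    then have "(\<Prod>k\<in>?K. \<integral>x. std_normal_density x * g k x \<partial>lborel) = 1"
      using gaussian_second_moment by (simp add: g_def)
    then show ?thesis unfolding E if_P[OF True] .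
  next
    case False
    have "\<exists>k\<in>?K. (\<integral>x. std_normal_density x * g k x \<partial>lborel) = 0"
    proof (cases "?K = {j}")
      case True
      have "?n j \<noteq> 1"
      proof
        assume "?n j = 1"
        have "\<alpha> = Poly_Mapping.single j 1"
        proof (rule poly_mapping_eqI)
          fix k
          show "?n k = Poly_Mapping.lookup (Poly_Mapping.single j 1) k"
          proof (cases "k = j")
            case False
            then have "k \<notin> ?K" using True by simp
            then show ?thesis using False by (simp add: in_keys_iff lookup_single)
          qed (simp add: \<open>?n j = 1\<close>)
        qed
        then show False using False by simp
      qed
      then show ?thesis using gaussian_hermite_normed_first_moment[of "?n j"]
        by (intro bexI[of _ j] j) (simp add: g_def)
    next
      case False
      then obtain k where "k \<in> ?K" "k \<noteq> j" using j by auto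
      then show ?thesis using gaussian_hermite_normed_mean[of "?n k"]
        by (intro bexI[of _ k]) (simp_all add: g_def in_keys_iff)
    qed
    then show ?thesis unfolding E using False by (simp add: prod_zero_iff)
  qed
qed

text \<open>The residual \<open>Y\<close> is the Wiener integral of the component of \<open>\<phi>\<close> orthogonal to the \<open>f j\<close> in question,
  hence a centred variable independent of the corresponding \<open>\<xi> j\<close>.\<close>

lemma chaos_basis_orthogonal_residual:
  assumes \<alpha>: "\<alpha> \<in> multi_indices" and W: "has_wiener_integral M T w \<phi> W"
    and Y: "\<And>\<omega>. Y \<omega> = W \<omega> - (\<Sum>j\<in>Poly_Mapping.keys \<alpha>. L2_inner {0<..<T} \<phi> (f j) * \<xi> j \<omega>)"
  shows "integrable M (\<lambda>\<omega>. Y \<omega> * chaos_basis \<xi> \<alpha> \<omega>)" "(\<integral>\<omega>. Y \<omega> * chaos_basis \<xi> \<alpha> \<omega> \<partial>M) = 0"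
proof -
  let ?K = "Poly_Mapping.keys \<alpha>"
  have K: "finite ?K" "?K \<subseteq> {1..}" using keys_multi_index[OF \<alpha>] by auto
  then have 0: "0 \<notin> ?K" by auto
  have fK: "finite (insert 0 ?K)" using K by simp
  \<comment> \<open>Position \<open>0\<close> is never in the support of a multi-index, so it is free for the integrand of \<open>W\<close>.\<close>
  define f' where "f' j = (if j = 0 then \<phi> else f j)" for j
  define \<xi>' where "\<xi>' j = (if j = 0 then W else \<xi> j)" for j
  define c' where "c' j = (if j = 0 then 1 else - L2_inner {0<..<T} \<phi> (f j))" for j
  define F where "F = (\<lambda>t. \<Sum>j\<in>insert 0 ?K. c' j * f' j t)"
  have w': "has_wiener_integral M T w (f' j) (\<xi>' j)" if "j \<in> insert 0 ?K" for j
    using that K W wiener[of j] by (cases "j = 0") (auto simp: f'_def \<xi>'_def)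
  have s: "(\<Sum>j\<in>?K. c' j * \<xi>' j \<omega>) = - (\<Sum>j\<in>?K. L2_inner {0<..<T} \<phi> (f j) * \<xi> j \<omega>)" for \<omega>
    unfolding sum_negf[symmetric] using 0 by (intro sum.cong) (auto simp: c'_def \<xi>'_def)
  have "Y \<omega> = (\<Sum>j\<in>insert 0 ?K. c' j * \<xi>' j \<omega>)" for \<omega>
    unfolding Y sum.insert[OF K(1) 0] s by (simp add: c'_def \<xi>'_def)
  then have Yeq: "Y = (\<lambda>\<omega>. \<Sum>j\<in>insert 0 ?K. c' j * \<xi>' j \<omega>)" by (rule ext)
  have YW: "has_wiener_integral M T w F Y"
    unfolding F_def Yeq by (rule has_wiener_integral_sum[OF fK w'])
  have orth: "L2_inner {0<..<T} F (f k) = 0" if k: "k \<in> ?K" for k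
  proof -
    have k1: "k \<ge> 1" using K k by auto
    have L2: "L2_on {0<..<T} (f' j)" if "j \<in> insert 0 ?K" for j
      using has_wiener_integralD(1)[OF w'[OF that]] .
    have "L2_inner {0<..<T} F (f k) = (\<Sum>j\<in>insert 0 ?K. c' j * L2_inner {0<..<T} (f' j) (f k))"
      unfolding F_def by (rule L2_inner_sum_left[OF fK L2 L2_basis[OF k1]])
    also have "\<dots> = L2_inner {0<..<T} \<phi> (f k) + (\<Sum>j\<in>?K. c' j * L2_inner {0<..<T} (f' j) (f k))"
      using 0 K by (simp add: c'_def f'_def)
    also have "(\<Sum>j\<in>?K. c' j * L2_inner {0<..<T} (f' j) (f k)) = (\<Sum>j\<in>?K. if j = k then c' k else 0)"
    proof (intro sum.cong refl)
      fix j assume "j \<in> ?K"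
      then have "j \<ge> 1" using K by auto
      then show "c' j * L2_inner {0<..<T} (f' j) (f k) = (if j = k then c' k else 0)"
        using orthonormal[of j k] k1 by (simp add: f'_def)
    qed
    also have "\<dots> = c' k" using K k by simp
    finally show ?thesis using k1 by (simp add: c'_def)
  qed
  define Z where "Z j = (if j = 0 then Y else \<xi> j)" for j
  define G where "G j = (if j = 0 then (\<lambda>x. x) else hermite_normed (Poly_Mapping.lookup \<alpha> j))" for j
  have indZ: "indep_vars (\<lambda>_. borel) Z (insert 0 ?K)"
  proof (rule wiener_integral_indep[OF T_nonneg fK, where f = "\<lambda>j. if j = 0 then F else f j"])
    show "has_wiener_integral M T w (if j = 0 then F else f j) (Z j)" if "j \<in> insert 0 ?K" for j
      using that K YW wiener[of j] by (cases "j = 0") (auto simp: Z_def)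
    show "L2_inner {0<..<T} (if i = 0 then F else f i) (if j = 0 then F else f j) = 0"
      if ij: "i \<in> insert 0 ?K" "j \<in> insert 0 ?K" "i \<noteq> j" for i j
    proof -
      consider "i = 0" "j \<in> ?K" "j \<noteq> 0" | "j = 0" "i \<in> ?K" "i \<noteq> 0" | "i \<in> ?K" "j \<in> ?K" "i \<noteq> 0" "j \<noteq> 0"
        using ij 0 by (cases "i = 0"; cases "j = 0") auto
      then show ?thesis
      proof cases
        case 1
        then show ?thesis using orth[of j] by simp
      next
        case 2
        then show ?thesis using orth[of i] by (simp add: L2_inner_commute[of _ "f i" F])
      next
        case 3
        then show ?thesis using orthonormal[of i j] ij(3) by simp
      qed
    qed
  qed
  then have ind: "indep_vars (\<lambda>_. borel) (\<lambda>j \<omega>. G j (Z j \<omega>)) (insert 0 ?K)"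
    by (rule indep_vars_compose2) (simp add: G_def)
  have int: "integrable M (\<lambda>\<omega>. G j (Z j \<omega>))" if "j \<in> insert 0 ?K" for j
  proof (cases "j = 0")
    case True
    then show ?thesis using wiener_integral_integrable[OF YW] by (simp add: G_def Z_def)
  next
    case False
    then show ?thesis using xi_function_integrable[of j "hermite_normed (Poly_Mapping.lookup \<alpha> j)"]
      by (simp add: G_def Z_def integrable_gaussian_hermite)
  qed
  have eq: "Y \<omega> * chaos_basis \<xi> \<alpha> \<omega> = (\<Prod>j\<in>insert 0 ?K. G j (Z j \<omega>))" for \<omega>
  proof -
    have "chaos_basis \<xi> \<alpha> \<omega> = (\<Prod>j\<in>?K. G j (Z j \<omega>))"
      unfolding chaos_basis_eq using 0 by (intro prod.cong) (auto simp: G_def Z_def)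
    then show ?thesis using 0 K by (simp add: G_def Z_def)
  qed
  show "integrable M (\<lambda>\<omega>. Y \<omega> * chaos_basis \<xi> \<alpha> \<omega>)"
    unfolding eq by (rule indep_vars_integrable[OF fK ind int])
  have "(\<integral>\<omega>. Y \<omega> * chaos_basis \<xi> \<alpha> \<omega> \<partial>M) = (\<Prod>j\<in>insert 0 ?K. \<integral>\<omega>. G j (Z j \<omega>) \<partial>M)"
    unfolding eq by (rule indep_vars_lebesgue_integral[OF fK ind int])
  also have "(\<integral>\<omega>. G 0 (Z 0 \<omega>) \<partial>M) = 0"
    using wiener_integral_mean[OF T_nonneg YW] by (simp add: G_def Z_def)
  then have "(\<Prod>j\<in>insert 0 ?K. \<integral>\<omega>. G j (Z j \<omega>) \<partial>M) = 0" using 0 K by simp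
  finally show "(\<integral>\<omega>. Y \<omega> * chaos_basis \<xi> \<alpha> \<omega> \<partial>M) = 0" .
qed

text \<open>A Wiener integral lives in the first chaos. At most one summand is nonzero; the sum over the support
  avoids a choice of the index \<open>j\<close> and covers multi-indices \<open>\<alpha>\<close> of any order.\<close>

lemma wiener_integral_chaos_coeff:
  assumes \<alpha>: "\<alpha> \<in> multi_indices" and W: "has_wiener_integral M T w \<phi> W"
  shows "chaos_coeff M \<xi> W \<alpha> =
    (\<Sum>j\<in>Poly_Mapping.keys \<alpha>. if \<alpha> = Poly_Mapping.single j 1 then L2_inner {0<..<T} \<phi> (f j) else 0)"
proof -
  let ?K = "Poly_Mapping.keys \<alpha>" and ?c = "\<lambda>j. L2_inner {0<..<T} \<phi> (f j)"
  define Y where "Y \<omega> = W \<omega> - (\<Sum>j\<in>?K. ?c j * \<xi> j \<omega>)" for \<omega>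
  note Y = chaos_basis_orthogonal_residual[OF \<alpha> W Y_def]
  have x: "integrable M (\<lambda>\<omega>. ?c j * (\<xi> j \<omega> * chaos_basis \<xi> \<alpha> \<omega>))" if "j \<in> ?K" for j
    using xi_times_chaos_basis(1)[OF \<alpha> that] by simp
  have "chaos_coeff M \<xi> W \<alpha>
      = (\<integral>\<omega>. Y \<omega> * chaos_basis \<xi> \<alpha> \<omega> + (\<Sum>j\<in>?K. ?c j * (\<xi> j \<omega> * chaos_basis \<xi> \<alpha> \<omega>)) \<partial>M)"
    unfolding chaos_coeff_def Y_def
    by (intro Bochner_Integration.integral_cong) (simp_all add: left_diff_distrib sum_distrib_right mult.assoc)
  also have "\<dots> = (\<Sum>j\<in>?K. ?c j * (\<integral>\<omega>. \<xi> j \<omega> * chaos_basis \<xi> \<alpha> \<omega> \<partial>M))"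
    using Y x by simp
  also have "\<dots> = (\<Sum>j\<in>?K. if \<alpha> = Poly_Mapping.single j 1 then ?c j else 0)"
    by (intro sum.cong refl) (simp add: xi_times_chaos_basis(2)[OF \<alpha>])
  finally show ?thesis .
qed

end

section \<open>Fractional integrals\<close>

lemma power_kernel_has_integral:
  fixes a t p :: real
  assumes "a \<le> t" "p > 0"
  shows "((\<lambda>s. (t - s) powr (p - 1)) has_integral ((t - a) powr p / p)) {a..t}"
proof -
  have "((\<lambda>s. (t - s) powr (p - 1)) has_integral (- ((t - t) powr p / p) - (- ((t - a) powr p / p)))) {a..t}"
  proof (rule fundamental_theorem_of_calculus_interior[OF assms(1)])
    show "continuous_on {a..t} (\<lambda>s. - ((t - s) powr p / p))"
      using assms by (intro continuous_intros continuous_on_powr') auto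
    fix s assume "s \<in> {a<..<t}"
    then show "((\<lambda>s. - ((t - s) powr p / p)) has_vector_derivative (t - s) powr (p - 1)) (at s)"
      unfolding has_real_derivative_iff_has_vector_derivative[symmetric]
      using assms by (auto intro!: derivative_eq_intros)
  qed
  then show ?thesis by simp
qed

lemma power_kernel_has_bochner_integral:
  fixes t p :: real
  assumes "0 \<le> t" "p > 0"
  shows "has_bochner_integral lborel (\<lambda>s. indicator {0..t} s * (t - s) powr (p - 1)) (t powr p / p)"
proof (rule has_bochner_integral_nn_integral)
  show "(\<integral>\<^sup>+ s. ennreal (indicator {0..t} s * (t - s) powr (p - 1)) \<partial>lborel) = ennreal (t powr p / p)"
    using nn_integral_has_integral_lebesgue[OF _ power_kernel_has_integral[OF assms]] by simp
qed (use assms in auto)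

lemma power_kernel_integrable:
  fixes t p :: real
  assumes "0 \<le> t" "p > 0"
  shows "integrable lborel (\<lambda>s. indicator {0..t} s * (t - s) powr (p - 1))"
  using power_kernel_has_bochner_integral[OF assms] by (rule integrable.intros)

text \<open>The substitution \<open>u = s + (t - s) x\<close> turns this into Euler's Beta integral.\<close>

lemma beta_kernel_has_bochner_integral:
  fixes a b s t :: real
  assumes "a > 0" "b > 0" "s \<le> t"
  shows "has_bochner_integral lborel
    (\<lambda>u. indicator {s..t} u * ((t - u) powr (a - 1) * (u - s) powr (b - 1)))
    ((t - s) powr (a + b - 1) * Beta a b)"
proof (cases "s = t")
  case True
  have "indicator {s..t} u * ((t - u) powr (a - 1) * (u - s) powr (b - 1)) = 0" for u :: real
    using True by (simp add: indicator_def)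
  then show ?thesis using True by (simp only:) (simp add: has_bochner_integral_zero)
next
  case False
  define d where "d = t - s"
  have d: "d > 0" using False assms by (simp add: d_def)
  let ?g = "\<lambda>x::real. indicator {0..1} x * (x powr (b - 1) * (1 - x) powr (a - 1))"
  have "(\<integral>\<^sup>+ x. ennreal (?g x) \<partial>lborel) = ennreal (Beta b a)"
    using nn_integral_has_integral_lebesgue[OF _ has_integral_Beta_real[OF \<open>b > 0\<close> \<open>a > 0\<close>]] by simp
  moreover have "0 \<le> Beta b a" using assms by (simp add: Beta_def Gamma_real_nonneg)
  ultimately have "has_bochner_integral lborel ?g (Beta b a)"
    by (intro has_bochner_integral_nn_integral) auto
  then have "has_bochner_integral lborel (\<lambda>x. d powr (a + b - 2) * ?g x) (d powr (a + b - 2) * Beta b a)"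
    by (rule has_bochner_integral_mult_right)
  moreover have "d powr (a + b - 2) * ?g x
      = indicator {s..t} (s + d * x) * ((t - (s + d * x)) powr (a - 1) * ((s + d * x) - s) powr (b - 1))" for x
  proof (cases "x \<in> {0..1}")
    case True
    have "t - (s + d * x) = d * (1 - x)" by (simp add: d_def algebra_simps)
    moreover have "d * x \<le> d * 1" using True d by (intro mult_left_mono) auto
    moreover have "0 \<le> d * x" using True d by simp
    moreover have "t = s + d" by (simp add: d_def)
    ultimately have "t - (s + d * x) = d * (1 - x)" "s + d * x \<in> {s..t}" by auto
    moreover have "d powr (a + b - 2) = d powr (a - 1) * d powr (b - 1)"
      using d by (simp add: powr_add[symmetric])
    ultimately show ?thesis using True d by (simp add: powr_mult)
  next
    case False
    have "s + d * x \<notin> {s..t}"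
    proof
      assume *: "s + d * x \<in> {s..t}"
      then have "0 \<le> d * x" "d * x \<le> d * 1" by (auto simp: d_def)
      then have "0 \<le> x" "x \<le> 1" using d by (simp_all add: zero_le_mult_iff)
      then show False using False by simp
    qed
    then show ?thesis using False by simp
  qed
  ultimately have "has_bochner_integral lborel (\<lambda>x. indicator {s..t} (s + d * x) * ((t - (s + d * x)) powr (a - 1) * ((s + d * x) - s) powr (b - 1)))
      (d powr (a + b - 2) * Beta b a)"
    by (simp only:)
  moreover have "(d powr (a + b - 1) * Beta a b) /\<^sub>R \<bar>d\<bar> = d powr (a + b - 2) * Beta b a"
  proof -
    have "d powr (a + b - 1) = d powr (a + b - 2) * d"
      using d powr_add[of d "a + b - 2" 1] by simp
    then show ?thesis using d by (simp add: Beta_commute[of a b])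
  qed
  ultimately show ?thesis
    using lborel_has_bochner_integral_real_affine_iff[of d
        "\<lambda>u. indicator {s..t} u * ((t - u) powr (a - 1) * (u - s) powr (b - 1))" "d powr (a + b - 1) * Beta a b" s] d
    unfolding d_def[symmetric] by simp
qed

lemma frac_I_eq:
  "frac_I p f t = (\<integral>s. indicator {0..t} s * ((t - s) powr (p - 1) * f s) \<partial>lborel) / Gamma p"
  by (simp add: frac_I_def set_lebesgue_integral_def)

lemma frac_I_cong:
  assumes "\<And>s. s \<in> {0..t} \<Longrightarrow> f s = g s"
  shows "frac_I p f t = frac_I p g t"
  unfolding frac_I_eq
  by (intro arg_cong2[where f = "(/)"] Bochner_Integration.integral_cong refl) (use assms in \<open>auto simp: indicator_def\<close>)

text \<open>The region of integration depends on \<open>t\<close>; writing it as a condition on the pair \<open>(t, s)\<close> makes the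
  integrand jointly measurable.\<close>

lemma frac_I_measurable [measurable]:
  assumes [measurable]: "f \<in> borel_measurable borel"
  shows "frac_I p f \<in> borel_measurable borel"
proof -
  have "(\<lambda>(t, s). (if 0 \<le> s \<and> s \<le> t then 1 else 0) * ((t - s) powr (p - 1) * f s)) \<in> borel_measurable (borel \<Otimes>\<^sub>M lborel)"
    by measurable
  then have "(\<lambda>t. \<integral>s. (if 0 \<le> s \<and> s \<le> t then 1 else 0) * ((t - s) powr (p - 1) * f s) \<partial>lborel) \<in> borel_measurable borel"
    by (rule lborel.borel_measurable_lebesgue_integral)
  moreover have "frac_I p f = (\<lambda>t. (\<integral>s. (if 0 \<le> s \<and> s \<le> t then 1 else 0) * ((t - s) powr (p - 1) * f s) \<partial>lborel) / Gamma p)"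
    unfolding frac_I_eq[abs_def]
    by (intro ext arg_cong2[where f = "(/)"] Bochner_Integration.integral_cong refl) (auto simp: indicator_def)
  ultimately show ?thesis by simp
qed

lemma frac_I_zero [simp]: "frac_I p (\<lambda>s. 0) t = 0"
  by (simp add: frac_I_eq)

lemma frac_I_at_0 [simp]: "frac_I p f 0 = 0"
proof -
  have "indicator {0..0} s * ((0 - s) powr (p - 1) * f s) = 0" for s :: real
    by (simp add: indicator_def)
  then show ?thesis unfolding frac_I_eq by (simp only:) simp
qed

lemma power_kernel_mult_integrable:
  fixes f :: "real \<Rightarrow> real" and t p :: real
  assumes "0 \<le> t" "p > 0" and [measurable]: "f \<in> borel_measurable borel" and bnd: "\<And>s. s \<in> {0..t} \<Longrightarrow> \<bar>f s\<bar> \<le> B"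
  shows "integrable lborel (\<lambda>s. indicator {0..t} s * ((t - s) powr (p - 1) * f s))"
proof (rule Bochner_Integration.integrable_bound)
  show "integrable lborel (\<lambda>s. B * (indicator {0..t} s * (t - s) powr (p - 1)))"
    using power_kernel_integrable[OF assms(1,2)] by simp
  have "\<bar>(t - s) powr (p - 1) * f s\<bar> \<le> \<bar>B * (t - s) powr (p - 1)\<bar>" if "s \<in> {0..t}" for s
  proof -
    have "B \<ge> 0" using bnd[OF that] by linarith
    then show ?thesis
      using mult_right_mono[OF bnd[OF that], of "(t - s) powr (p - 1)"] by (simp add: abs_mult mult.commute)
  qed
  then show "AE s in lborel. norm (indicator {0..t} s * ((t - s) powr (p - 1) * f s))
      \<le> norm (B * (indicator {0..t} s * (t - s) powr (p - 1)))"
    by (auto simp: indicator_def)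
qed measurable

text \<open>Exchange the order of integration; the inner integral of the two kernels is a Beta integral. The
  integrability assumption concerns the composite kernel only. The inner fractional integral
  need not converge at every point: the points of divergence form a null set, which the outer
  integral ignores.\<close>

lemma frac_I_frac_I:
  assumes ab: "a > 0" "b > 0" and t: "0 \<le> t"
    and f: "set_borel_measurable lborel {0..t} f"
    and int: "integrable lborel (\<lambda>s. indicator {0..t} s * ((t - s) powr (a + b - 1) * f s))"
  shows "frac_I a (frac_I b f) t = frac_I (a + b) f t"
proof -
  define F where "F s = indicator {0..t} s * f s" for s
  have [measurable]: "F \<in> borel_measurable borel"
    using f by (simp add: F_def[abs_def] set_borel_measurable_def)
  define H where "H s u = (if 0 \<le> s \<and> s \<le> u \<and> u \<le> t then (t - u) powr (a - 1) * (u - s) powr (b - 1) * F s else 0)" for s u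
  have [measurable]: "(\<lambda>(s, u). H s u) \<in> borel_measurable (lborel \<Otimes>\<^sub>M lborel)"
    unfolding H_def by measurable
  have Hs: "H s u = F s * (indicator {s..t} u * ((t - u) powr (a - 1) * (u - s) powr (b - 1)))" for s u
    by (auto simp: H_def F_def indicator_def)
  have Gamma_pos: "Gamma (a + b) > 0" using ab by (intro Gamma_real_pos) simp
  have bochner: "has_bochner_integral lborel (H s) (F s * ((t - s) powr (a + b - 1) * Beta a b))" for s
  proof (cases "s \<in> {0..t}")
    case True
    then show ?thesis unfolding Hs[abs_def]
      by (intro has_bochner_integral_mult_right beta_kernel_has_bochner_integral ab) auto
  next
    case False
    then have "H s = (\<lambda>u. 0)" "F s = 0" by (auto simp: H_def F_def)
    then show ?thesis by (simp add: has_bochner_integral_zero)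
  qed
  have bochner_norm: "has_bochner_integral lborel (\<lambda>u. norm (H s u)) (\<bar>F s\<bar> * ((t - s) powr (a + b - 1) * Beta a b))" for s
  proof (cases "s \<in> {0..t}")
    case True
    have "norm (H s u) = \<bar>F s\<bar> * (indicator {s..t} u * ((t - u) powr (a - 1) * (u - s) powr (b - 1)))" for u
      unfolding Hs by (simp add: abs_mult)
    then show ?thesis using True
      by (simp only:) (intro has_bochner_integral_mult_right beta_kernel_has_bochner_integral ab, simp)
  next
    case False
    then have "norm (H s u) = 0" "F s = 0" for u by (auto simp: H_def F_def)
    then show ?thesis by (simp add: has_bochner_integral_zero)
  qed
  have int': "integrable lborel (\<lambda>s. F s * ((t - s) powr (a + b - 1) * Beta a b))"
    using integrable_mult_right[OF int, of "Beta a b"] by (simp add: F_def mult_ac)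
  have pair: "integrable (lborel \<Otimes>\<^sub>M lborel) (\<lambda>(s, u). H s u)"
  proof (rule lborel_pair.Fubini_integrable)
    have "0 \<le> Beta a b" using ab by (simp add: Beta_def Gamma_real_nonneg)
    then have "norm (F s * ((t - s) powr (a + b - 1) * Beta a b)) = \<bar>F s\<bar> * ((t - s) powr (a + b - 1) * Beta a b)" for s
      by (simp add: abs_mult)
    then have "integrable lborel (\<lambda>s. \<bar>F s\<bar> * ((t - s) powr (a + b - 1) * Beta a b))"
      using integrable_norm[OF int'] by (simp only:)
    then show "integrable lborel (\<lambda>s. \<integral>u. norm (case (s, u) of (s, u) \<Rightarrow> H s u) \<partial>lborel)"
      by (simp add: has_bochner_integral_integral_eq[OF bochner_norm[unfolded real_norm_def]])
    show "AE s in lborel. integrable lborel (\<lambda>u. case (s, u) of (s, u) \<Rightarrow> H s u)"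
      using integrable.intros[OF bochner] by simp
  qed measurable
  have "(\<integral>u. (\<integral>s. H s u \<partial>lborel) \<partial>lborel) = (\<integral>s. (\<integral>u. H s u \<partial>lborel) \<partial>lborel)"
    by (rule lborel_pair.Fubini_integral) (use pair in simp)
  also have "\<dots> = (\<integral>s. F s * ((t - s) powr (a + b - 1) * Beta a b) \<partial>lborel)"
    by (simp add: has_bochner_integral_integral_eq[OF bochner])
  also have "\<dots> = (\<integral>s. Beta a b * (indicator {0..t} s * ((t - s) powr (a + b - 1) * f s)) \<partial>lborel)"
    by (simp add: F_def mult_ac)
  also have "\<dots> = Beta a b * (Gamma (a + b) * frac_I (a + b) f t)"
    using Gamma_pos by (simp add: frac_I_eq)
  finally have 1: "(\<integral>u. (\<integral>s. H s u \<partial>lborel) \<partial>lborel) = Gamma a * Gamma b * frac_I (a + b) f t"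
    using ab Gamma_pos by (simp add: Beta_def)
  have inner: "(\<integral>s. H s u \<partial>lborel) = Gamma b * (indicator {0..t} u * ((t - u) powr (a - 1) * frac_I b f u))" for u
  proof (cases "u \<in> {0..t}")
    case True
    have "(\<integral>s. H s u \<partial>lborel) = (\<integral>s. (t - u) powr (a - 1) * (indicator {0..u} s * ((u - s) powr (b - 1) * f s)) \<partial>lborel)"
      using True by (intro Bochner_Integration.integral_cong refl) (auto simp: H_def F_def indicator_def)
    then show ?thesis using True Gamma_real_pos[OF ab(2)] by (simp add: frac_I_eq)
  next
    case False
    then have "H s u = 0" for s by (auto simp: H_def)
    then show ?thesis using False by simp
  qed
  have "(\<integral>u. (\<integral>s. H s u \<partial>lborel) \<partial>lborel) = Gamma a * Gamma b * frac_I a (frac_I b f) t"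
    unfolding inner using Gamma_real_pos[OF ab(1)] by (simp add: frac_I_eq[of a])
  with 1 show ?thesis using Gamma_real_pos[OF ab(1)] Gamma_real_pos[OF ab(2)] by simp
qed


lemma frac_I_1: "frac_I 1 f t = (\<integral>s. indicator {0..t} s * f s \<partial>lborel)"
proof -
  have "(\<integral>s. indicator {0..t} s * ((t - s) powr (1 - 1) * f s) \<partial>lborel) = (\<integral>s. indicator {0..t} s * f s \<partial>lborel)"
    by (rule integral_discrete_difference[of "{t}"]) (auto simp: indicator_def)
  then show ?thesis by (simp add: frac_I_eq)
qed

text \<open>The positive and the negative part of \<open>h\<close> are densities of two finite measures that agree on all
  half-lines, hence everywhere; densities are unique up to null sets.\<close>

lemma AE_zero_if_tail_integrals_zero:
  fixes h :: "real \<Rightarrow> real"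
  assumes h: "integrable lborel h" and tail: "\<And>x. (\<integral>s. indicator {x<..} s * h s \<partial>lborel) = 0"
  shows "AE s in lborel. h s = 0"
proof -
  define P where "P s = max 0 (h s)" for s
  define N where "N s = max 0 (- h s)" for s
  have PN: "h s = P s - N s" "0 \<le> P s" "0 \<le> N s" for s by (auto simp: P_def N_def)
  have P: "integrable lborel P" and N: "integrable lborel N"
    unfolding P_def[abs_def] N_def[abs_def] using h by auto
  have [measurable]: "P \<in> borel_measurable borel" "N \<in> borel_measurable borel"
    using P N by (auto dest: borel_measurable_integrable)
  have int: "integrable lborel (\<lambda>s. indicator {x<..} s * Q s)" if "integrable lborel Q" for x :: real and Q :: "real \<Rightarrow> real"
    using integrable_real_mult_indicator[OF _ that, of "{x<..}"] by (simp add: mult.commute)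
  have em: "emeasure (density lborel (\<lambda>s. ennreal (Q s))) {x<..} = ennreal (\<integral>s. indicator {x<..} s * Q s \<partial>lborel)"
    if Q: "integrable lborel Q" "\<And>s. 0 \<le> Q s" for x :: real and Q
  proof -
    have [measurable]: "Q \<in> borel_measurable borel" using Q by (auto dest: borel_measurable_integrable)
    have "emeasure (density lborel (\<lambda>s. ennreal (Q s))) {x<..} = (\<integral>\<^sup>+s. ennreal (Q s) * indicator {x<..} s \<partial>lborel)"
      by (rule emeasure_density) auto
    also have "\<dots> = (\<integral>\<^sup>+s. ennreal (indicator {x<..} s * Q s) \<partial>lborel)"
      by (intro nn_integral_cong) (auto simp: indicator_def)
    also have "\<dots> = ennreal (\<integral>s. indicator {x<..} s * Q s \<partial>lborel)"
      using Q by (intro nn_integral_eq_integral int) auto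
    finally show ?thesis .
  qed
  have eq: "(\<integral>s. indicator {x<..} s * P s \<partial>lborel) = (\<integral>s. indicator {x<..} s * N s \<partial>lborel)" for x
  proof -
    have "(\<integral>s. indicator {x<..} s * h s \<partial>lborel) = (\<integral>s. indicator {x<..} s * P s - indicator {x<..} s * N s \<partial>lborel)"
      by (intro Bochner_Integration.integral_cong refl) (simp only: PN(1) right_diff_distrib)
    also have "\<dots> = (\<integral>s. indicator {x<..} s * P s \<partial>lborel) - (\<integral>s. indicator {x<..} s * N s \<partial>lborel)"
      by (intro Bochner_Integration.integral_diff int P N)
    finally show ?thesis using tail[of x] by simp
  qed
  have "density lborel (\<lambda>s. ennreal (P s)) = density lborel (\<lambda>s. ennreal (N s))"
    by (rule measure_eqI_lessThan) (simp_all add: em[OF P PN(2)] em[OF N PN(3)] eq)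
  then have "AE s in lborel. ennreal (P s) = ennreal (N s)"
    by (intro sigma_finite_measure.density_unique[OF sigma_finite_lborel]) auto
  then show ?thesis
  proof eventually_elim
    case (elim s)
    then show ?case using PN[of s] by simp
  qed
qed

lemma AE_eq_if_integrals_eq:
  fixes f g :: "real \<Rightarrow> real"
  assumes f: "set_integrable lborel {0..T} f" and g: "set_integrable lborel {0..T} g"
    and eq: "\<And>t. t \<in> {0..T} \<Longrightarrow> (\<integral>s. indicator {0..t} s * f s \<partial>lborel) = (\<integral>s. indicator {0..t} s * g s \<partial>lborel)"
  shows "AE s in lborel. s \<in> {0..T} \<longrightarrow> f s = g s"
proof -
  have sub: "integrable lborel (\<lambda>s. indicator {0..t} s * q s)" if "t \<le> T" "set_integrable lborel {0..T} q" for t and q :: "real \<Rightarrow> real"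
    using set_integrable_subset[OF that(2), of "{0..t}"] that(1) by (simp add: set_integrable_def)
  define h where "h s = indicator {0..T} s * f s - indicator {0..T} s * g s" for s
  have h: "integrable lborel h" unfolding h_def[abs_def]
    using sub[OF order_refl f] sub[OF order_refl g] by (rule Bochner_Integration.integrable_diff)
  have init: "(\<integral>s. indicator {..x} s * h s \<partial>lborel) = 0" for x
  proof (cases "0 \<le> T")
    case False
    then show ?thesis by (simp add: h_def)
  next
    case T: True
    show ?thesis
    proof (cases "0 \<le> x")
      case True
      define t where "t = min x T"
      have t: "t \<in> {0..T}" "t \<le> T" using True T by (auto simp: t_def)
      have "(\<integral>s. indicator {..x} s * h s \<partial>lborel) = (\<integral>s. indicator {0..t} s * f s - indicator {0..t} s * g s \<partial>lborel)"
        by (intro Bochner_Integration.integral_cong refl) (auto simp: h_def t_def indicator_def)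
      also have "\<dots> = 0"
        using sub[OF t(2) f] sub[OF t(2) g] eq[OF t(1)] by simp
      finally show ?thesis .
    next
      case False
      then have "(\<lambda>s. indicator {..x} s * h s) = (\<lambda>s. 0)"
        by (auto simp: h_def indicator_def)
      then show ?thesis by (simp only: Bochner_Integration.integral_zero)
    qed
  qed
  have "AE s in lborel. h s = 0"
  proof (rule AE_zero_if_tail_integrals_zero[OF h])
    fix x
    have "(\<integral>s. h s \<partial>lborel) = (\<integral>s. indicator {..max x T} s * h s \<partial>lborel)"
      by (intro Bochner_Integration.integral_cong refl) (auto simp: h_def indicator_def)
    then have total: "(\<integral>s. h s \<partial>lborel) = 0" using init by simp
    have "(\<integral>s. indicator {x<..} s * h s \<partial>lborel) = (\<integral>s. h s - indicator {..x} s * h s \<partial>lborel)"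
      by (intro Bochner_Integration.integral_cong refl) (auto simp: indicator_def)
    also have "\<dots> = 0"
      using h integrable_real_mult_indicator[OF _ h, of "{..x}"] init[of x] total by (simp add: mult.commute)
    finally show "(\<integral>s. indicator {x<..} s * h s \<partial>lborel) = 0" .
  qed
  then show ?thesis
    by eventually_elim (auto simp: h_def indicator_def)
qed

text \<open>Applying the fractional integral of order \<open>1 - p\<close> gives the indefinite integrals of \<open>f\<close> and \<open>g\<close>, which
  determine \<open>f\<close> and \<open>g\<close> almost everywhere.\<close>

lemma frac_I_inject:
  assumes p: "0 < p" "p < 1"
    and f: "set_integrable lborel {0..T} f" and g: "set_integrable lborel {0..T} g"
    and eq: "\<And>t. t \<in> {0..T} \<Longrightarrow> frac_I p f t = frac_I p g t"
  shows "AE s in lborel. s \<in> {0..T} \<longrightarrow> f s = g s"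
proof (rule AE_eq_if_integrals_eq[OF f g])
  fix t assume t: "t \<in> {0..T}"
  have inv: "frac_I (1 - p) (frac_I p q) t = (\<integral>s. indicator {0..t} s * q s \<partial>lborel)"
    if q: "set_integrable lborel {0..T} q" for q
  proof -
    have qt: "set_integrable lborel {0..t} q"
      using set_integrable_subset[OF q, of "{0..t}"] t by simp
    have qi: "integrable lborel (\<lambda>s. indicator {0..t} s * q s)" using qt by (simp add: set_integrable_def)
    then have qm: "(\<lambda>s. indicator {0..t} s * q s) \<in> borel_measurable borel"
      by (auto dest: borel_measurable_integrable)
    have "frac_I (1 - p) (frac_I p q) t = frac_I (1 - p + p) q t"
    proof (rule frac_I_frac_I)
      show "set_borel_measurable lborel {0..t} q" using qm by (simp add: set_borel_measurable_def)
      have "(\<lambda>s. (t - s) powr 0 * (indicator {0..t} s * q s)) \<in> borel_measurable borel"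
        by (intro borel_measurable_times qm) measurable
      then have m: "(\<lambda>s. indicator {0..t} s * ((t - s) powr (1 - p + p - 1) * q s)) \<in> borel_measurable lborel"
        by (simp add: mult_ac)
      show "integrable lborel (\<lambda>s. indicator {0..t} s * ((t - s) powr (1 - p + p - 1) * q s))"
        by (rule Bochner_Integration.integrable_bound[OF qi m]) (auto simp: indicator_def)
    qed (use p t in auto)
    then show ?thesis by (simp add: frac_I_1)
  qed
  have "frac_I (1 - p) (frac_I p f) t = frac_I (1 - p) (frac_I p g) t"
    using t by (intro frac_I_cong eq) auto
  then show "(\<integral>s. indicator {0..t} s * f s \<partial>lborel) = (\<integral>s. indicator {0..t} s * g s \<partial>lborel)"
    by (simp only: inv[OF f] inv[OF g])
qed

section \<open>Decay of the fractional integrals of cosines\<close>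

text \<open>Integration by parts away from the singularity, carried out as a comparison of derivatives: with
  \<open>V s = (t - s)\<^bsup>p-1\<^esup> / c\<close>, an increasing function, the integrand differs from the derivative of
  \<open>V s * sin (c s)\<close> by at most \<open>V' s\<close>.\<close>

lemma cos_kernel_head_bound:
  fixes a c t p :: real
  assumes c: "c > 0" and p: "p < 1" and a: "0 \<le> a" "a < t"
    and int: "(\<lambda>s. (t - s) powr (p - 1) * cos (c * s)) integrable_on {0..a}"
  shows "\<bar>integral {0..a} (\<lambda>s. (t - s) powr (p - 1) * cos (c * s))\<bar> \<le> 2 * ((t - a) powr (p - 1) / c)"
proof -
  let ?f = "\<lambda>s. (t - s) powr (p - 1) * cos (c * s)"
  define V where "V s = (t - s) powr (p - 1) / c" for s
  define W where "W s = (1 - p) * (t - s) powr (p - 2) / c" for s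
  have W: "W s \<ge> 0" for s using p c by (simp add: W_def)
  have V: "V s \<ge> 0" for s using c by (simp add: V_def)
  have dV: "(V has_real_derivative W s) (at s)" if "s \<in> {0..a}" for s
    unfolding V_def[abs_def] W_def using that a c by (auto intro!: derivative_eq_intros simp: field_simps)
  have dG: "((\<lambda>s. V s * sin (c * s)) has_real_derivative (?f s + W s * sin (c * s))) (at s)" if "s \<in> {0..a}" for s
  proof (rule DERIV_cong[OF DERIV_mult[OF dV[OF that]]])
    show "((\<lambda>s. sin (c * s)) has_real_derivative cos (c * s) * c) (at s)"
      by (auto intro!: derivative_eq_intros)
    show "W s * sin (c * s) + cos (c * s) * c * V s = ?f s + W s * sin (c * s)"
      using c by (simp add: V_def)
  qed
  have up: "((\<lambda>s. ?f s + W s * sin (c * s) + W s) has_integral (V a * sin (c * a) + V a - (V 0 * sin (c * 0) + V 0))) {0..a}"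
    by (rule fundamental_theorem_of_calculus[OF a(1)])
       (auto simp: has_real_derivative_iff_has_vector_derivative[symmetric] intro!: DERIV_subset[OF DERIV_add[OF dG dV]])
  have low: "((\<lambda>s. ?f s + W s * sin (c * s) - W s) has_integral (V a * sin (c * a) - V a - (V 0 * sin (c * 0) - V 0))) {0..a}"
    by (rule fundamental_theorem_of_calculus[OF a(1)])
       (auto simp: has_real_derivative_iff_has_vector_derivative[symmetric] intro!: DERIV_subset[OF DERIV_diff[OF dG dV]])
  have I: "(?f has_integral integral {0..a} ?f) {0..a}" using int by (rule integrable_integral)
  have s1: "W s * sin (c * s) + W s \<ge> 0" "W s * sin (c * s) - W s \<le> 0" for s
    using mult_nonneg_nonneg[OF W[of s], of "1 + sin (c * s)"] mult_nonneg_nonneg[OF W[of s], of "1 - sin (c * s)"]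
    by (simp_all add: algebra_simps sin_ge_minus_one[of "c * s", THEN add_left_mono[of _ _ 1], simplified])
  have "integral {0..a} ?f \<le> V a * sin (c * a) + V a - (V 0 * sin (c * 0) + V 0)"
    by (rule has_integral_le[OF I up]) (use s1 in \<open>simp add: add.assoc\<close>)
  moreover have "V a * sin (c * a) - V a - (V 0 * sin (c * 0) - V 0) \<le> integral {0..a} ?f"
    by (rule has_integral_le[OF low I]) (use s1(2) in \<open>simp add: add_diff_eq[symmetric]\<close>)
  moreover have "\<bar>V a * sin (c * a)\<bar> \<le> V a"
    using mult_left_mono[OF abs_sin_le_one[of "c * a"] V[of a]] V[of a] by (simp add: abs_mult)
  ultimately have "\<bar>integral {0..a} ?f\<bar> \<le> 2 * V a" using V[of 0] by (simp add: abs_le_iff)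
  then show ?thesis by (simp add: V_def)
qed

text \<open>Near the singularity the cosine is bounded by one and the kernel is integrated over a length of at most
  \<open>1 / c\<close>; elsewhere the oscillation gains a factor \<open>1 / c\<close>. Both parts are of order \<open>c\<^bsup>-p\<^esup>\<close>.\<close>

lemma cos_kernel_bound:
  fixes c t p :: real
  assumes c: "c > 0" and p: "0 < p" "p < 1" and t: "0 \<le> t"
  shows "\<bar>\<integral>s. indicator {0..t} s * ((t - s) powr (p - 1) * cos (c * s)) \<partial>lborel\<bar> \<le> (1 / p + 2) * c powr (- p)"
proof -
  let ?f = "\<lambda>s. (t - s) powr (p - 1) * cos (c * s)"
  have "set_integrable lborel {0..t} ?f"
    unfolding set_integrable_def using power_kernel_mult_integrable[OF t p(1), of "\<lambda>s. cos (c * s)" 1] by simp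
  from set_borel_integral_eq_integral[OF this]
  have int: "?f integrable_on {0..t}" and eq: "(\<integral>s. indicator {0..t} s * ?f s \<partial>lborel) = integral {0..t} ?f"
    by (simp_all add: set_lebesgue_integral_def)
  \<comment> \<open>If \<open>t \<le> 1 / c\<close>, the whole interval is close to the singularity and the head is empty.\<close>
  define a where "a = max 0 (t - 1 / c)"
  have a: "0 \<le> a" "a \<le> t" "t - a \<le> 1 / c" using t c by (auto simp: a_def)
  have int1: "?f integrable_on {0..a}" and int2: "?f integrable_on {a..t}"
    using integrable_on_subinterval[OF int] a by auto
  have split: "integral {0..a} ?f + integral {a..t} ?f = integral {0..t} ?f"
    by (rule Henstock_Kurzweil_Integration.integral_combine[OF a(1,2) int])
  have pow: "(1 / c) powr q = c powr (- q)" for q using c by (simp add: powr_minus_divide powr_divide)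
  have "\<bar>integral {a..t} ?f\<bar> \<le> integral {a..t} (\<lambda>s. (t - s) powr (p - 1))"
  proof -
    have k: "(\<lambda>s. (t - s) powr (p - 1)) integrable_on {a..t}"
      using power_kernel_has_integral[OF a(2) p(1)] by blast
    have "norm (?f s) \<le> (t - s) powr (p - 1)" for s
      using mult_left_mono[OF abs_cos_le_one[of "c * s"], of "(t - s) powr (p - 1)"] by (simp add: abs_mult)
    then show ?thesis using integral_norm_bound_integral[OF int2 k] by simp
  qed
  also have "\<dots> = (t - a) powr p / p"
    using power_kernel_has_integral[OF a(2) p(1)] by (rule integral_unique)
  also have "\<dots> \<le> (1 / c) powr p / p"
    using a p by (intro divide_right_mono powr_mono2) auto
  finally have tail: "\<bar>integral {a..t} ?f\<bar> \<le> c powr (- p) / p" by (simp only: pow)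
  have head: "\<bar>integral {0..a} ?f\<bar> \<le> 2 * c powr (- p)"
  proof (cases "a = 0")
    case True
    then show ?thesis using c by simp
  next
    case False
    then have ta: "t - a = 1 / c" by (auto simp: a_def max_def split: if_splits)
    have "\<bar>integral {0..a} ?f\<bar> \<le> 2 * ((t - a) powr (p - 1) / c)"
      by (rule cos_kernel_head_bound[OF c p(2) a(1) _ int1]) (use ta divide_pos_pos[OF zero_less_one c] in linarith)
    also have "(t - a) powr (p - 1) / c = c powr (- p)"
      unfolding ta pow using c powr_add[of c "- p" 1] by simp
    finally show ?thesis .
  qed
  have "\<bar>integral {0..t} ?f\<bar> \<le> 2 * c powr (- p) + c powr (- p) / p"
    using head tail split by linarith
  then show ?thesis unfolding eq by (simp add: field_simps)
qed

lemma frac_I_cos_bound: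
  assumes "c > 0" "0 < p" "p < 1" "0 \<le> t"
  shows "\<bar>frac_I p (\<lambda>s. A * cos (c * s)) t\<bar> \<le> \<bar>A\<bar> * ((1 / p + 2) / Gamma p) * c powr (- p)"
proof -
  have "frac_I p (\<lambda>s. A * cos (c * s)) t = A / Gamma p * (\<integral>s. indicator {0..t} s * ((t - s) powr (p - 1) * cos (c * s)) \<partial>lborel)"
  proof -
    have "(\<integral>s. indicator {0..t} s * ((t - s) powr (p - 1) * (A * cos (c * s))) \<partial>lborel)
        = (\<integral>s. A * (indicator {0..t} s * ((t - s) powr (p - 1) * cos (c * s))) \<partial>lborel)"
      by (simp only: mult_ac)
    then show ?thesis unfolding frac_I_eq by simp
  qed
  then have "\<bar>frac_I p (\<lambda>s. A * cos (c * s)) t\<bar>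
      = \<bar>A\<bar> / Gamma p * \<bar>\<integral>s. indicator {0..t} s * ((t - s) powr (p - 1) * cos (c * s)) \<partial>lborel\<bar>"
    using Gamma_real_pos[OF assms(2)] by (simp add: abs_mult)
  also have "\<dots> \<le> \<bar>A\<bar> / Gamma p * ((1 / p + 2) * c powr (- p))"
    using Gamma_real_pos[OF assms(2)] by (intro mult_left_mono cos_kernel_bound assms) auto
  finally show ?thesis by simp
qed

section \<open>Chaos coefficients of the fractionally integrated Brownian motion\<close>

context brownian_motion
begin

lemma increment_second_moment:
  assumes "0 \<le> a" "a \<le> b" "b \<le> T"
  shows "(\<integral>\<omega>. (w b \<omega> - w a \<omega>)\<^sup>2 \<partial>M) = b - a"
proof (cases "a = b")
  case False
  then have ab: "0 < sqrt (b - a)" "a < b" using assms by auto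
  have "(\<integral>\<omega>. (w b \<omega> - w a \<omega>)\<^sup>2 \<partial>M) = (\<integral>x. normal_density 0 (sqrt (b - a)) x * x\<^sup>2 \<partial>lborel)"
    using distributed_integral[OF normal_increments[OF assms(1) ab(2) assms(3)], of "\<lambda>x. x\<^sup>2"] by simp
  also have "\<dots> = b - a"
    using integral_normal_moment_even[OF ab(1), of 0 1] ab by (simp add: less_imp_le)
  finally show ?thesis .
qed simp

text \<open>A continuous path is the limit of its values at the grid points \<open>\<lfloor>n s\<rfloor> / n\<close>, and for fixed \<open>n\<close> only
  countably many times occur. Clamping \<open>s\<close> to \<open>[0, T]\<close> keeps every time in the range where \<open>w\<close> is a
  continuous process.\<close>

lemma paths_jointly_measurable:
  assumes T: "T \<ge> 0"
  shows "(\<lambda>(s, \<omega>). w (max 0 (min T s)) \<omega>) \<in> borel_measurable (borel \<Otimes>\<^sub>M M)"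
proof (rule borel_measurable_LIMSEQ_real)
  let ?pr = "\<lambda>s. max 0 (min T s)"
  have pr: "?pr s \<in> {0..T}" for s using T by auto
  define U where "U n = (\<lambda>(s, \<omega>). w (?pr (of_int \<lfloor>real (Suc n) * s\<rfloor> / real (Suc n))) \<omega>)" for n
  show "U n \<in> borel_measurable (borel \<Otimes>\<^sub>M M)" for n
  proof -
    define V where "V i x = w (?pr (of_int i / real (Suc n))) (snd x)" for i :: int and x :: "real \<times> 'a"
    have V: "V i \<in> borel_measurable (borel \<Otimes>\<^sub>M M)" for i
      unfolding V_def[abs_def] by (rule measurable_compose[OF measurable_snd random_variable[OF pr]])
    have "(\<lambda>x. V \<lfloor>real (Suc n) * fst x\<rfloor> x) \<in> borel_measurable (borel \<Otimes>\<^sub>M M)"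
      by (rule measurable_compose_countable[OF V]) measurable
    then show ?thesis by (simp add: U_def V_def case_prod_unfold)
  qed
  fix x :: "real \<times> 'a" assume "x \<in> space (borel \<Otimes>\<^sub>M M)"
  then obtain s \<omega> where x: "x = (s, \<omega>)" "\<omega> \<in> space M" by (auto simp: space_pair_measure)
  have "(\<lambda>n. of_int \<lfloor>real (Suc n) * s\<rfloor> / real (Suc n)) \<longlonglongrightarrow> s"
  proof (subst LIM_zero_iff[symmetric], rule Lim_null_comparison[OF _ LIMSEQ_inverse_real_of_nat])
    show "\<forall>\<^sub>F n in sequentially. norm (of_int \<lfloor>real (Suc n) * s\<rfloor> / real (Suc n) - s) \<le> inverse (real (Suc n))"
    proof (intro always_eventually allI)
      fix n
      let ?m = "real (Suc n)"
      have "\<bar>of_int \<lfloor>?m * s\<rfloor> - ?m * s\<bar> \<le> 1" by linarith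
      then have "\<bar>of_int \<lfloor>?m * s\<rfloor> - ?m * s\<bar> / ?m \<le> 1 / ?m" by (intro divide_right_mono) auto
      moreover have "\<bar>of_int \<lfloor>?m * s\<rfloor> - ?m * s\<bar> / ?m = \<bar>of_int \<lfloor>?m * s\<rfloor> / ?m - s\<bar>"
      proof -
        have "of_int \<lfloor>?m * s\<rfloor> / ?m - s = (of_int \<lfloor>?m * s\<rfloor> - ?m * s) / ?m"
          by (simp add: diff_divide_distrib)
        then show ?thesis by (simp add: abs_divide)
      qed
      ultimately show "norm (of_int \<lfloor>?m * s\<rfloor> / ?m - s) \<le> inverse ?m"
        by (simp only: real_norm_def inverse_eq_divide)
    qed
  qed
  then have "(\<lambda>n. ?pr (of_int \<lfloor>real (Suc n) * s\<rfloor> / real (Suc n))) \<longlonglongrightarrow> ?pr s"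
    by (intro tendsto_intros)
  then have "(\<lambda>n. w (?pr (of_int \<lfloor>real (Suc n) * s\<rfloor> / real (Suc n))) \<omega>) \<longlonglongrightarrow> w (?pr s) \<omega>"
    by (rule continuous_on_tendsto_compose[OF continuous_paths[OF x(2)]]) (use pr in auto)
  then show "(\<lambda>n. U n x) \<longlonglongrightarrow> (case x of (s, \<omega>) \<Rightarrow> w (?pr s) \<omega>)"
    by (simp add: U_def x)
qed

text \<open>Fubini's theorem. The integrand is dominated because \<open>E \<bar>(w s - w 0) X\<bar>\<close> is at most \<open>T + E X\<^sup>2\<close>, uniformly in \<open>s\<close>,
  and the kernel is integrable.\<close>

lemma frac_I_paths_expectation:
  assumes t: "0 \<le> t" "t \<le> T" and p: "p > 0"
    and X [measurable]: "X \<in> borel_measurable M" and X2: "integrable M (\<lambda>\<omega>. (X \<omega>)\<^sup>2)"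
  shows "(\<integral>\<omega>. frac_I p (\<lambda>s. w s \<omega> - w 0 \<omega>) t * X \<omega> \<partial>M)
    = frac_I p (\<lambda>s. \<integral>\<omega>. (w s \<omega> - w 0 \<omega>) * X \<omega> \<partial>M) t"
proof -
  have T: "T \<ge> 0" using t by simp
  interpret P: pair_sigma_finite lborel M ..
  let ?pr = "\<lambda>s. max 0 (min T s)"
  have [measurable]: "(\<lambda>(s, \<omega>). w (max 0 (min T s)) \<omega>) \<in> borel_measurable (lborel \<Otimes>\<^sub>M M)"
    using paths_jointly_measurable[OF T] by (simp cong: measurable_cong_sets)
  have [measurable]: "w 0 \<in> borel_measurable M" by (rule random_variable) (use T in auto)
  define H where "H s \<omega> = indicator {0..t} s * (t - s) powr (p - 1) * ((w (?pr s) \<omega> - w 0 \<omega>) * X \<omega>)" for s \<omega>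
  have Hm [measurable]: "(\<lambda>(s, \<omega>). H s \<omega>) \<in> borel_measurable (lborel \<Otimes>\<^sub>M M)"
    unfolding H_def by measurable
  have Heq: "H s \<omega> = indicator {0..t} s * ((t - s) powr (p - 1) * ((w s \<omega> - w 0 \<omega>) * X \<omega>))" for s \<omega>
    using t by (auto simp: H_def indicator_def max_def min_def)
  define C where "C = T + (\<integral>\<omega>. (X \<omega>)\<^sup>2 \<partial>M)"
  have int: "integrable M (\<lambda>\<omega>. (w s \<omega> - w 0 \<omega>) * X \<omega>)" if s: "s \<in> {0..t}" for s
  proof (rule integrable_mult_if_square_integrable[OF _ X])
    have "w s \<in> borel_measurable M" by (rule random_variable) (use s t in auto)
    then show "(\<lambda>\<omega>. w s \<omega> - w 0 \<omega>) \<in> borel_measurable M" by simp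
    show "integrable M (\<lambda>\<omega>. (w s \<omega> - w 0 \<omega>)\<^sup>2)"
      by (rule increment_square_integrable) (use s t in auto)
  qed (rule X2)
  have bound: "(\<integral>\<omega>. \<bar>(w s \<omega> - w 0 \<omega>) * X \<omega>\<bar> \<partial>M) \<le> C" if s: "s \<in> {0..t}" for s
  proof -
    have w2: "integrable M (\<lambda>\<omega>. (w s \<omega> - w 0 \<omega>)\<^sup>2)"
      by (rule increment_square_integrable) (use s t in auto)
    have "(\<integral>\<omega>. \<bar>(w s \<omega> - w 0 \<omega>) * X \<omega>\<bar> \<partial>M) \<le> (\<integral>\<omega>. (w s \<omega> - w 0 \<omega>)\<^sup>2 + (X \<omega>)\<^sup>2 \<partial>M)"
    proof (rule integral_mono)
      show "\<bar>(w s \<omega> - w 0 \<omega>) * X \<omega>\<bar> \<le> (w s \<omega> - w 0 \<omega>)\<^sup>2 + (X \<omega>)\<^sup>2" for \<omega>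
        using sum_squares_bound[of "\<bar>w s \<omega> - w 0 \<omega>\<bar>" "\<bar>X \<omega>\<bar>"] mult_nonneg_nonneg[of "\<bar>w s \<omega> - w 0 \<omega>\<bar>" "\<bar>X \<omega>\<bar>"]
        unfolding abs_mult power2_abs by linarith
    qed (use int[OF s] w2 X2 in auto)
    also have "\<dots> = s + (\<integral>\<omega>. (X \<omega>)\<^sup>2 \<partial>M)"
      using w2 X2 increment_second_moment[of 0 s] s t by simp
    finally show ?thesis using s t by (simp add: C_def)
  qed
  have norm: "(\<integral>\<omega>. norm (H s \<omega>) \<partial>M) = indicator {0..t} s * (t - s) powr (p - 1) * (\<integral>\<omega>. \<bar>(w s \<omega> - w 0 \<omega>) * X \<omega>\<bar> \<partial>M)" for s
    unfolding Heq by (simp add: abs_mult mult.assoc)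
  have pair: "integrable (lborel \<Otimes>\<^sub>M M) (\<lambda>(s, \<omega>). H s \<omega>)"
  proof (rule P.Fubini_integrable)
    show "integrable lborel (\<lambda>s. \<integral>\<omega>. norm (case (s, \<omega>) of (s, \<omega>) \<Rightarrow> H s \<omega>) \<partial>M)"
    proof (rule Bochner_Integration.integrable_bound)
      show "integrable lborel (\<lambda>s. C * (indicator {0..t} s * (t - s) powr (p - 1)))"
        using power_kernel_integrable[OF t(1) p] by simp
      show "(\<lambda>s. \<integral>\<omega>. norm (case (s, \<omega>) of (s, \<omega>) \<Rightarrow> H s \<omega>) \<partial>M) \<in> borel_measurable lborel" by measurable
      have le: "indicator {0..t} s * (t - s) powr (p - 1) * (\<integral>\<omega>. \<bar>(w s \<omega> - w 0 \<omega>) * X \<omega>\<bar> \<partial>M)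
          \<le> C * (indicator {0..t} s * (t - s) powr (p - 1))" for s
        using mult_right_mono[OF bound, of s "(t - s) powr (p - 1)"] by (auto simp: indicator_def mult.commute)
      have nonneg: "0 \<le> indicator {0..t} s * (t - s) powr (p - 1) * (\<integral>\<omega>. \<bar>(w s \<omega> - w 0 \<omega>) * X \<omega>\<bar> \<partial>M)" for s
        by (intro mult_nonneg_nonneg integral_nonneg_AE) auto
      show "AE s in lborel. norm (\<integral>\<omega>. norm (case (s, \<omega>) of (s, \<omega>) \<Rightarrow> H s \<omega>) \<partial>M)
          \<le> norm (C * (indicator {0..t} s * (t - s) powr (p - 1)))"
        unfolding prod.case norm unfolding real_norm_def abs_of_nonneg[OF nonneg]
        by (intro AE_I2 order_trans[OF le abs_ge_self])
    qed
    show "AE s in lborel. integrable M (\<lambda>\<omega>. case (s, \<omega>) of (s, \<omega>) \<Rightarrow> H s \<omega>)"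
    proof (intro AE_I2)
      fix s show "integrable M (\<lambda>\<omega>. case (s, \<omega>) of (s, \<omega>) \<Rightarrow> H s \<omega>)"
        unfolding prod.case Heq using int[of s] by (cases "s \<in> {0..t}") auto
    qed
  qed (rule Hm)
  have "(\<integral>\<omega>. frac_I p (\<lambda>s. w s \<omega> - w 0 \<omega>) t * X \<omega> \<partial>M) = (\<integral>\<omega>. (\<integral>s. H s \<omega> \<partial>lborel) / Gamma p \<partial>M)"
  proof (intro Bochner_Integration.integral_cong refl)
    fix \<omega>
    have "(\<integral>s. H s \<omega> \<partial>lborel) = (\<integral>s. indicator {0..t} s * ((t - s) powr (p - 1) * (w s \<omega> - w 0 \<omega>)) * X \<omega> \<partial>lborel)"
      unfolding Heq by (simp only: mult.assoc)
    then show "frac_I p (\<lambda>s. w s \<omega> - w 0 \<omega>) t * X \<omega> = (\<integral>s. H s \<omega> \<partial>lborel) / Gamma p"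
      unfolding frac_I_eq by (simp only: integral_mult_left_zero times_divide_eq_left)
  qed
  also have "\<dots> = (\<integral>\<omega>. (\<integral>s. H s \<omega> \<partial>lborel) \<partial>M) / Gamma p" by simp
  also have "(\<integral>\<omega>. (\<integral>s. H s \<omega> \<partial>lborel) \<partial>M) = (\<integral>s. (\<integral>\<omega>. H s \<omega> \<partial>M) \<partial>lborel)"
    by (rule P.Fubini_integral[OF pair])
  also have "(\<integral>s. (\<integral>\<omega>. H s \<omega> \<partial>M) \<partial>lborel)
      = (\<integral>s. indicator {0..t} s * ((t - s) powr (p - 1) * (\<integral>\<omega>. (w s \<omega> - w 0 \<omega>) * X \<omega> \<partial>M)) \<partial>lborel)"
    unfolding Heq by simp
  finally show ?thesis unfolding frac_I_eq .
qed

end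

text \<open>The coefficient of \<open>w s - w 0\<close> at \<open>\<xi>\<^sub>k\<close>, which is an inner product, is the indefinite integral of
  \<open>m\<^sub>k\<close>.\<close>

lemma L2_inner_indicator:
  assumes "0 \<le> s" "s \<le> T"
  shows "L2_inner {0<..<T} (indicator {0<..s}) f = frac_I 1 f s"
  unfolding L2_inner_eq frac_I_1
  by (rule integral_discrete_difference[of "{0, T}"]) (use assms in \<open>auto simp: indicator_def\<close>)

context wiener_chaos
begin

lemma frac_J_chaos_coeff:
  assumes \<alpha>: "\<alpha> \<in> multi_indices" and t: "0 \<le> t" "t \<le> T" and p: "p > 0"
  shows "chaos_coeff M \<xi> (\<lambda>\<omega>. frac_J p (\<lambda>s. w s \<omega>) t) \<alpha> =
    (\<Sum>k\<in>Poly_Mapping.keys \<alpha>. if \<alpha> = Poly_Mapping.single k 1 then frac_I p (frac_I 1 (f k)) t else 0)"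
proof -
  let ?c = "\<lambda>s. \<Sum>k\<in>Poly_Mapping.keys \<alpha>. if \<alpha> = Poly_Mapping.single k 1 then frac_I 1 (f k) s else 0"
  have "chaos_coeff M \<xi> (\<lambda>\<omega>. frac_J p (\<lambda>s. w s \<omega>) t) \<alpha>
      = frac_I p (\<lambda>s. \<integral>\<omega>. (w s \<omega> - w 0 \<omega>) * chaos_basis \<xi> \<alpha> \<omega> \<partial>M) t"
    unfolding chaos_coeff_def frac_J_def
    by (rule frac_I_paths_expectation[OF t p chaos_basis_measurable[OF \<alpha>] chaos_basis_square_integrable[OF \<alpha>]])
  also have "\<dots> = frac_I p ?c t"
  proof (rule frac_I_cong)
    fix s assume "s \<in> {0..t}"
    then have s: "0 \<le> s" "s \<le> T" using t by auto
    show "(\<integral>\<omega>. (w s \<omega> - w 0 \<omega>) * chaos_basis \<xi> \<alpha> \<omega> \<partial>M) = ?c s"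
      using wiener_integral_chaos_coeff[OF \<alpha> increment_wiener_integral[OF s]]
      unfolding chaos_coeff_def L2_inner_indicator[OF s] .
  qed
  also have "\<dots> = (\<Sum>k\<in>Poly_Mapping.keys \<alpha>. if \<alpha> = Poly_Mapping.single k 1 then frac_I p (frac_I 1 (f k)) t else 0)"
  proof (cases "\<exists>j. \<alpha> = Poly_Mapping.single j 1")
    case True
    then obtain j where j: "\<alpha> = Poly_Mapping.single j 1" by blast
    then have K: "Poly_Mapping.keys \<alpha> = {j}" by simp
    show ?thesis unfolding K using j by simp
  next
    case False
    then have F: "(\<alpha> = Poly_Mapping.single k 1) = False" for k by simp
    show ?thesis unfolding F by simp
  qed
  finally show ?thesis .
qed

end

section \<open>The cosine basis\<close>

lemma cos_basis_eq:
  "cos_basis T k = (\<lambda>s. (if k = 1 then 1 / sqrt T else sqrt (2 / T)) * cos (pi * (real k - 1) / T * s))"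
  by (auto simp: cos_basis_def fun_eq_iff mult_ac)

lemma cos_basis_measurable [measurable]: "cos_basis T k \<in> borel_measurable borel"
  unfolding cos_basis_eq by measurable

text \<open>For \<open>n \<noteq> 0\<close> the interval consists of \<open>\<bar>n\<bar>\<close> half-periods, and an antiderivative, a multiple of the sine,
  vanishes at both ends.\<close>

lemma set_integral_cos_half_periods:
  assumes T: "T > 0"
  shows "(LBINT s:{0<..<T}. cos (pi * real_of_int n / T * s)) = (if n = 0 then T else 0)"
proof -
  have "(LBINT s:{0<..<T}. cos (pi * real_of_int n / T * s)) = (LBINT s=ereal 0..ereal T. cos (pi * real_of_int n / T * s))"
    using T by (subst interval_integral_Ioo) auto
  also have "\<dots> = (if n = 0 then T else 0)"
  proof (cases "n = 0")
    case True
    have "(LBINT s=ereal 0..ereal T. cos (pi * real_of_int n / T * s)) = T - 0"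
      by (rule interval_integral_FTC_finite)
         (auto simp: True has_real_derivative_iff_has_vector_derivative[symmetric])
    then show ?thesis using True by simp
  next
    case False
    define c where "c = pi * real_of_int n / T"
    have c: "c \<noteq> 0" using False T by (simp add: c_def)
    have "(LBINT s=ereal 0..ereal T. cos (c * s)) = sin (c * T) / c - sin (c * 0) / c"
      by (rule interval_integral_FTC_finite)
         (use c in \<open>auto simp: has_real_derivative_iff_has_vector_derivative[symmetric]
            intro!: continuous_intros derivative_eq_intros\<close>)
    moreover have "sin (c * T) = 0" using T by (simp add: c_def sin_zero_iff_int2)
    ultimately show ?thesis using False by (simp add: c_def)
  qed
  finally show ?thesis .
qed

lemma cos_basis_orthonormal:
  assumes T: "T > 0" and jk: "j \<ge> 1" "k \<ge> 1"
  shows "L2_inner {0<..<T} (cos_basis T j) (cos_basis T k) = (if j = k then 1 else 0)"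
proof -
  let ?A = "\<lambda>k::nat. if k = 1 then 1 / sqrt T else sqrt (2 / T)"
  let ?m = "int j - int k" and ?n = "int j + int k - 2"
  let ?C = "\<lambda>n s. cos (pi * real_of_int n / T * s)"
  have int: "set_integrable lborel {0<..<T} (?C n)" for n
  proof (rule set_integrable_subset)
    show "set_integrable lborel {0..T} (?C n)"
      by (rule borel_integrable_atLeastAtMost') (intro continuous_intros)
  qed auto
  have "cos_basis T j s * cos_basis T k s = ?A j * ?A k / 2 * (?C ?m s + ?C ?n s)" for s
  proof -
    have "cos (pi * (real j - 1) / T * s) * cos (pi * (real k - 1) / T * s)
        = (cos (pi * (real j - 1) / T * s - pi * (real k - 1) / T * s) + cos (pi * (real j - 1) / T * s + pi * (real k - 1) / T * s)) / 2"
      by (rule cos_times_cos)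
    also have "pi * (real j - 1) / T * s - pi * (real k - 1) / T * s = pi * real_of_int ?m / T * s"
      by (simp add: algebra_simps diff_divide_distrib)
    also have "pi * (real j - 1) / T * s + pi * (real k - 1) / T * s = pi * real_of_int ?n / T * s"
      by (simp add: algebra_simps diff_divide_distrib add_divide_distrib)
    finally show ?thesis unfolding cos_basis_eq by simp
  qed
  then have "L2_inner {0<..<T} (cos_basis T j) (cos_basis T k) = (LBINT s:{0<..<T}. ?A j * ?A k / 2 * (?C ?m s + ?C ?n s))"
    unfolding L2_inner_def by (simp only:)
  also have "\<dots> = ?A j * ?A k / 2 * ((LBINT s:{0<..<T}. ?C ?m s) + (LBINT s:{0<..<T}. ?C ?n s))"
    using int by (simp only: set_integral_mult_right set_integral_add(2))
  also have "\<dots> = ?A j * ?A k / 2 * ((if ?m = 0 then T else 0) + (if ?n = 0 then T else 0))"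
    unfolding set_integral_cos_half_periods[OF T] ..
  also have "\<dots> = (if j = k then 1 else 0)"
  proof (cases "j = k")
    case True
    then show ?thesis using T jk by (cases "k = 1") (auto simp: field_simps real_sqrt_divide)
  next
    case False
    then have "?m \<noteq> 0" "?n \<noteq> 0" using jk by linarith+
    then show ?thesis using False by simp
  qed
  finally show ?thesis .
qed

lemma cos_basis_abs_le: 
  assumes "T > 0"
  shows "\<bar>cos_basis T k s\<bar> \<le> sqrt (2 / T)"
proof -
  have "1 / sqrt T \<le> sqrt (2 / T)" using assms by (simp add: real_sqrt_divide divide_right_mono)
  then have A: "\<bar>if k = 1 then 1 / sqrt T else sqrt (2 / T)\<bar> \<le> sqrt (2 / T)" using assms by auto
  show ?thesis unfolding cos_basis_eq abs_mult
    using mult_mono[OF A abs_cos_le_one[of "pi * (real k - 1) / T * s"]] assms by simp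
qed

lemma L2_bounded:
  assumes T: "T > 0" and [measurable]: "h \<in> borel_measurable borel" and bnd: "\<And>t. t \<in> {0<..<T} \<Longrightarrow> \<bar>h t\<bar> \<le> B"
  shows "L2_on {0<..<T} h" and "L2_norm_sq {0<..<T} h \<le> T * B\<^sup>2"
proof -
  have le: "(indicator {0<..<T} t * h t)\<^sup>2 \<le> indicator {0<..<T} t * B\<^sup>2" for t
  proof (cases "t \<in> {0<..<T}")
    case True
    then show ?thesis using power_mono[OF bnd[OF True] abs_ge_zero, of 2] by simp
  qed simp
  have B: "integrable lborel (\<lambda>t. indicator {0<..<T} t * B\<^sup>2)"
    using T by (intro integrable_mult_left integrable_real_indicator) auto
  have int: "integrable lborel (\<lambda>t. (indicator {0<..<T} t * h t)\<^sup>2)"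
    by (rule Bochner_Integration.integrable_bound[OF B]) (use le in auto)
  show "L2_on {0<..<T} h" unfolding L2_on_iff using int by simp
  have "L2_norm_sq {0<..<T} h \<le> (\<integral>t. indicator {0<..<T} t * B\<^sup>2 \<partial>lborel)"
    unfolding L2_norm_sq_eq by (rule integral_mono[OF int B le])
  also have "\<dots> = T * B\<^sup>2" using T by simp
  finally show "L2_norm_sq {0<..<T} h \<le> T * B\<^sup>2" .
qed

lemma frac_I_abs_le:
  assumes p: "p > 0" and t: "0 \<le> t" "t \<le> T"
    and [measurable]: "f \<in> borel_measurable borel" and bnd: "\<And>s. \<bar>f s\<bar> \<le> B"
  shows "\<bar>frac_I p f t\<bar> \<le> B * T powr p / (p * Gamma p)"
proof -
  have "B \<ge> 0" using bnd[of 0] by linarith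
  have "\<bar>\<integral>s. indicator {0..t} s * ((t - s) powr (p - 1) * f s) \<partial>lborel\<bar>
      \<le> (\<integral>s. B * (indicator {0..t} s * (t - s) powr (p - 1)) \<partial>lborel)"
  proof (rule order_trans[OF integral_abs_bound integral_mono])
    show "integrable lborel (\<lambda>s. \<bar>indicator {0..t} s * ((t - s) powr (p - 1) * f s)\<bar>)"
      by (intro integrable_abs power_kernel_mult_integrable[OF t(1) p _ bnd]) measurable
    show "integrable lborel (\<lambda>s. B * (indicator {0..t} s * (t - s) powr (p - 1)))"
      using power_kernel_integrable[OF t(1) p] by simp
    show "\<bar>indicator {0..t} s * ((t - s) powr (p - 1) * f s)\<bar> \<le> B * (indicator {0..t} s * (t - s) powr (p - 1))" for s
      using mult_right_mono[OF bnd[of s], of "(t - s) powr (p - 1)"] by (auto simp: indicator_def abs_mult mult.commute)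
  qed
  also have "\<dots> = B * (t powr p / p)"
    using has_bochner_integral_integral_eq[OF power_kernel_has_bochner_integral[OF t(1) p]] by simp
  also have "\<dots> \<le> B * (T powr p / p)"
    using t p \<open>B \<ge> 0\<close> by (intro mult_left_mono divide_right_mono powr_mono2) auto
  finally show ?thesis
    using Gamma_real_pos[OF p] unfolding frac_I_eq by (simp add: abs_mult field_simps)
qed

section \<open>The solution of the equation\<close>

text \<open>The coefficients of \<open>x\<^sub>0 + \<Sum>\<^sub>k \<xi>\<^sub>k I\<^sup>p f\<^sub>k(t)\<close>. The sum over the support singles out the index \<open>k\<close> for
  which \<open>\<alpha>\<close> is the \<open>k\<close>-th unit multi-index and is zero if there is none.\<close>

definition chaos_solution :: "real \<Rightarrow> real \<Rightarrow> (nat \<Rightarrow> real \<Rightarrow> real) \<Rightarrow> (nat \<Rightarrow>\<^sub>0 nat) \<Rightarrow> real \<Rightarrow> real" where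
  "chaos_solution p x\<^sub>0 f \<alpha> t = (if \<alpha> = 0 then x\<^sub>0 else 0) +
     (\<Sum>k\<in>Poly_Mapping.keys \<alpha>. if \<alpha> = Poly_Mapping.single k 1 then frac_I p (f k) t else 0)"

lemma single_neq_0: "Poly_Mapping.single k (Suc 0) \<noteq> 0"
  by (metis lookup_single_eq lookup_zero nat.simps(3))

lemma chaos_solution_single: "chaos_solution p x\<^sub>0 f (Poly_Mapping.single k 1) = frac_I p (f k)"
  by (simp add: fun_eq_iff chaos_solution_def single_neq_0)

lemma chaos_solution_0: "chaos_solution p x\<^sub>0 f 0 = (\<lambda>t. x\<^sub>0)"
  by (simp add: fun_eq_iff chaos_solution_def)

lemma chaos_solution_other:
  assumes "\<alpha> \<noteq> 0" "\<And>k. \<alpha> \<noteq> Poly_Mapping.single k 1"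
  shows "chaos_solution p x\<^sub>0 f \<alpha> = (\<lambda>t. 0)"
proof -
  have F: "(\<alpha> = Poly_Mapping.single k 1) = False" for k using assms(2) by simp
  show ?thesis unfolding chaos_solution_def[abs_def] F using assms(1) by simp
qed

lemma multi_index_cases:
  assumes "\<alpha> \<in> multi_indices"
  obtains (zero) "\<alpha> = 0" | (unit) k where "k \<ge> 1" "\<alpha> = Poly_Mapping.single k 1"
    | (other) "\<alpha> \<noteq> 0" "\<And>k. \<alpha> \<noteq> Poly_Mapping.single k 1"
proof (cases "\<exists>k. \<alpha> = Poly_Mapping.single k 1")
  case True
  then obtain k where k: "\<alpha> = Poly_Mapping.single k 1" by blast
  then have "k \<ge> 1" using assms by (auto simp: multi_indices_def)
  then show thesis using unit k by blast
next
  case False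
  then show thesis using zero other by blast
qed

text \<open>For \<open>k \<ge> 2\<close> the frequency \<open>\<pi> (k - 1) / T\<close> is at least \<open>k / T\<close>, so the oscillatory bound applies. The
  constant function \<open>m\<^sub>1\<close> does not oscillate; its contribution is absorbed into the constant.\<close>

lemma frac_I_cos_basis_decay:
  assumes T: "T > 0" and p: "0 < p" "p < 1"
  obtains C where "\<And>k. k \<ge> 1 \<Longrightarrow> L2_norm_sq {0<..<T} (frac_I p (cos_basis T k)) \<le> C * real k powr (- (2 * p))"
proof -
  define D where "D = sqrt (2 / T) * ((1 / p + 2) / Gamma p)"
  define C1 where "C1 = T * (sqrt (2 / T) * T powr p / (p * Gamma p))\<^sup>2"
  define C2 where "C2 = T * (D * T powr p)\<^sup>2"
  have Gp: "Gamma p > 0" using p by (intro Gamma_real_pos)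
  have D: "D \<ge> 0" using T p Gp by (simp add: D_def)
  show thesis
  proof (rule that[of "max C1 C2"])
    fix k :: nat assume k: "k \<ge> 1"
    show "L2_norm_sq {0<..<T} (frac_I p (cos_basis T k)) \<le> max C1 C2 * real k powr (- (2 * p))"
    proof (cases "k = 1")
      case True
      have "L2_norm_sq {0<..<T} (frac_I p (cos_basis T k)) \<le> C1"
        unfolding C1_def
      proof (rule L2_bounded(2)[OF T])
        fix t assume t: "t \<in> {0<..<T}"
        show "\<bar>frac_I p (cos_basis T k) t\<bar> \<le> sqrt (2 / T) * T powr p / (p * Gamma p)"
          by (rule frac_I_abs_le[OF p(1) _ _ _ cos_basis_abs_le[OF T]]) (use t in auto)
      qed measurable
      then show ?thesis using True by simp
    next
      case False
      then have k2: "k \<ge> 2" using k by simp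
      define c where "c = pi * (real k - 1) / T"
      have "real k \<le> 2 * (real k - 1)" using k2 by simp
      also have "\<dots> \<le> pi * (real k - 1)" using k2 pi_ge_two by (intro mult_right_mono) auto
      finally have ck: "real k / T \<le> c" using T by (simp add: c_def divide_right_mono)
      have kT: "0 < real k / T" using k2 T by simp
      then have c: "c > 0" using ck by linarith
      have "c powr (- p) \<le> (real k / T) powr (- p)"
        using ck kT p by (intro powr_mono2') auto
      also have "\<dots> = real k powr (- p) * T powr p"
        using T k2 by (simp add: powr_divide powr_minus field_simps)
      finally have cp: "c powr (- p) \<le> real k powr (- p) * T powr p" .
      have "L2_norm_sq {0<..<T} (frac_I p (cos_basis T k)) \<le> T * (D * (real k powr (- p) * T powr p))\<^sup>2"
      proof (rule L2_bounded(2)[OF T])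
        fix t assume t: "t \<in> {0<..<T}"
        have "cos_basis T k = (\<lambda>s. sqrt (2 / T) * cos (c * s))"
          using False by (simp add: cos_basis_eq c_def)
        then have "\<bar>frac_I p (cos_basis T k) t\<bar> \<le> D * c powr (- p)"
          using frac_I_cos_bound[OF c p, of t "sqrt (2 / T)"] t T by (simp add: D_def)
        also have "\<dots> \<le> D * (real k powr (- p) * T powr p)" by (rule mult_left_mono[OF cp D])
        finally show "\<bar>frac_I p (cos_basis T k) t\<bar> \<le> D * (real k powr (- p) * T powr p)" .
      qed measurable
      also have "\<dots> = C2 * real k powr (- (2 * p))"
      proof -
        have "(real k powr (- p))\<^sup>2 = real k powr (- (2 * p))"
          by (simp add: power2_eq_square powr_add[symmetric])
        then show ?thesis by (simp add: C2_def power_mult_distrib mult_ac)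
      qed
      also have "\<dots> \<le> max C1 C2 * real k powr (- (2 * p))" by (intro mult_right_mono) auto
      finally show ?thesis .
    qed
  qed
qed

lemma set_integrable_const_Icc: "set_integrable lborel {a..b::real} (\<lambda>_. c :: real)"
  by (rule borel_integrable_atLeastAtMost') (rule continuous_on_const)

text \<open>A fractional integral vanishes at \<open>0\<close>, so the value subtracted in \<open>frac_J\<close> is zero.\<close>

lemma frac_J_frac_I:
  assumes ab: "a > 0" "b > 0" "a + b > 0" and t: "0 \<le> t"
    and f [measurable]: "f \<in> borel_measurable borel" and bnd: "\<And>s. \<bar>f s\<bar> \<le> B"
  shows "frac_J a (frac_I b f) t = frac_I (a + b) f t"
proof -
  have "frac_I a (frac_I b f) t = frac_I (a + b) f t"
  proof (rule frac_I_frac_I[OF ab(1,2) t])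
    show "set_borel_measurable lborel {0..t} f" unfolding set_borel_measurable_def by measurable
    show "integrable lborel (\<lambda>s. indicator {0..t} s * ((t - s) powr (a + b - 1) * f s))"
      by (rule power_kernel_mult_integrable[OF t ab(3) f bnd])
  qed
  then show ?thesis by (simp add: frac_J_def)
qed

context wiener_chaos
begin

text \<open>At the unit multi-indices both sides are equal to the fractional integral of order
  \<open>(1 - \<beta>) + (1 - (\<gamma> - \<beta>)) = (1 - \<gamma>) + 1\<close> of \<open>f k\<close>; at the others both sides vanish, as \<open>frac_J\<close>
  annihilates constants.\<close>

lemma chaos_solution_solves:
  assumes T: "T > 0" and bg: "0 < \<beta>" "\<beta> < 1" "0 < \<gamma>" "\<gamma> < 1" "0 < 1 - (\<gamma> - \<beta>)"
    and f [measurable]: "\<And>k. f k \<in> borel_measurable borel" and bnd: "\<And>k s. \<bar>f k s\<bar> \<le> B"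
  shows "solves_coeffwise M T w \<xi> \<beta> \<gamma> x\<^sub>0 (chaos_solution (1 - (\<gamma> - \<beta>)) x\<^sub>0 f)"
  unfolding solves_coeffwise_def
proof (intro ballI conjI)
  let ?p = "1 - (\<gamma> - \<beta>)"
  fix \<alpha> assume \<alpha>: "\<alpha> \<in> multi_indices"
  show "set_integrable lborel {0..T} (chaos_solution ?p x\<^sub>0 f \<alpha>)"
    using \<alpha>
  proof (cases rule: multi_index_cases)
    case zero
    show ?thesis unfolding zero chaos_solution_0 by (rule set_integrable_const_Icc)
  next
    case (unit k)
    define K where "K = B * T powr ?p / (?p * Gamma ?p)"
    have K: "\<bar>frac_I ?p (f k) t\<bar> \<le> K" if t: "t \<in> {0..T}" for t
      unfolding K_def using t bg by (intro frac_I_abs_le bnd) auto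
    have "set_integrable lborel {0..T} (frac_I ?p (f k))"
      unfolding set_integrable_def
    proof (rule Bochner_Integration.integrable_bound)
      show "integrable lborel (\<lambda>t. indicator {0..T} t *\<^sub>R K)"
        using set_integrable_const_Icc[of 0 T K] by (simp add: set_integrable_def)
      have "norm (indicator {0..T} t *\<^sub>R frac_I ?p (f k) t) \<le> norm (indicator {0..T} t *\<^sub>R K)" for t
        using order_trans[OF K abs_ge_self, of t] by (cases "t \<in> {0..T}") simp_all
      then show "AE t in lborel. norm (indicator {0..T} t *\<^sub>R frac_I ?p (f k) t) \<le> norm (indicator {0..T} t *\<^sub>R K)"
        by (intro AE_I2)
    qed measurable
    then show ?thesis unfolding unit(2) chaos_solution_single .
  next
    case other
    show ?thesis unfolding chaos_solution_other[OF other] set_integrable_def by simp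
  qed
  show "chaos_solution ?p x\<^sub>0 f \<alpha> 0 = chaos_coeff M \<xi> (\<lambda>_. x\<^sub>0) \<alpha>"
  proof -
    have "chaos_coeff M \<xi> (\<lambda>_. x\<^sub>0) \<alpha> = (if \<alpha> = 0 then x\<^sub>0 else 0)"
      unfolding chaos_coeff_def using chaos_basis_expectation[OF \<alpha>] by simp
    moreover have "(\<Sum>k\<in>Poly_Mapping.keys \<alpha>. if \<alpha> = Poly_Mapping.single k 1 then frac_I ?p (f k) 0 else 0) = 0"
      by (intro sum.neutral ballI) simp
    ultimately show ?thesis by (simp add: chaos_solution_def)
  qed
  fix t assume t: "t \<in> {0..T}"
  have coeff: "chaos_coeff M \<xi> (\<lambda>\<omega>. frac_J (1 - \<gamma>) (\<lambda>s. w s \<omega>) t) \<alpha> =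
      (\<Sum>k\<in>Poly_Mapping.keys \<alpha>. if \<alpha> = Poly_Mapping.single k 1 then frac_I (1 - \<gamma>) (frac_I 1 (f k)) t else 0)"
    using t bg by (intro frac_J_chaos_coeff[OF \<alpha>]) auto
  show "frac_J (1 - \<beta>) (chaos_solution ?p x\<^sub>0 f \<alpha>) t = chaos_coeff M \<xi> (\<lambda>\<omega>. frac_J (1 - \<gamma>) (\<lambda>s. w s \<omega>) t) \<alpha>"
    using \<alpha>
  proof (cases rule: multi_index_cases)
    case zero
    show ?thesis unfolding coeff unfolding zero chaos_solution_0 by (simp add: frac_J_def)
  next
    case (unit k)
    have "frac_J (1 - \<beta>) (frac_I ?p (f k)) t = frac_I (1 - \<beta> + ?p) (f k) t"
      using bg t by (intro frac_J_frac_I[OF _ _ _ _ f bnd]) auto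
    also have "1 - \<beta> + ?p = 1 - \<gamma> + 1" by simp
    also have "frac_I (1 - \<gamma> + 1) (f k) t = frac_J (1 - \<gamma>) (frac_I 1 (f k)) t"
      using bg t by (intro frac_J_frac_I[symmetric, OF _ _ _ _ f bnd]) auto
    also have "\<dots> = frac_I (1 - \<gamma>) (frac_I 1 (f k)) t" by (simp add: frac_J_def)
    finally show ?thesis unfolding coeff unfolding unit(2) chaos_solution_single by simp
  next
    case other
    then have F: "(\<alpha> = Poly_Mapping.single k 1) = False" for k by simp
    show ?thesis unfolding coeff F chaos_solution_other[OF other] by (simp add: frac_J_def)
  qed
qed

end

text \<open>The values at \<open>0\<close> agree because both are prescribed, so the coefficients differ from functions with
  equal fractional integrals by the same constant.\<close>

lemma solves_coeffwise_unique:
  assumes \<beta>: "0 < \<beta>" "\<beta> < 1"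
    and X: "solves_coeffwise M T w \<xi> \<beta> \<gamma> x\<^sub>0 X" and Y: "solves_coeffwise M T w \<xi> \<beta> \<gamma> x\<^sub>0 Y"
    and \<alpha>: "\<alpha> \<in> multi_indices"
  shows "AE t in lborel. t \<in> {0..T} \<longrightarrow> Y \<alpha> t = X \<alpha> t"
proof -
  have int: "set_integrable lborel {0..T} (\<lambda>s. Z \<alpha> s - Z \<alpha> 0)" if "solves_coeffwise M T w \<xi> \<beta> \<gamma> x\<^sub>0 Z" for Z
  proof (rule set_integral_diff(1))
    show "set_integrable lborel {0..T} (Z \<alpha>)" using that \<alpha> by (simp add: solves_coeffwise_def)
    show "set_integrable lborel {0..T} (\<lambda>s. Z \<alpha> 0)" by (rule set_integrable_const_Icc)
  qed
  have "AE t in lborel. t \<in> {0..T} \<longrightarrow> Y \<alpha> t - Y \<alpha> 0 = X \<alpha> t - X \<alpha> 0"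
  proof (rule frac_I_inject[of "1 - \<beta>", OF _ _ int[OF Y] int[OF X]])
    fix t assume t: "t \<in> {0..T}"
    have "frac_J (1 - \<beta>) (Z \<alpha>) t = chaos_coeff M \<xi> (\<lambda>\<omega>. frac_J (1 - \<gamma>) (\<lambda>s. w s \<omega>) t) \<alpha>"
      if "solves_coeffwise M T w \<xi> \<beta> \<gamma> x\<^sub>0 Z" for Z
      using that \<alpha> t unfolding solves_coeffwise_def by blast
    from this[OF Y] this[OF X] have "frac_J (1 - \<beta>) (Y \<alpha>) t = frac_J (1 - \<beta>) (X \<alpha>) t" by simp
    then show "frac_I (1 - \<beta>) (\<lambda>s. Y \<alpha> s - Y \<alpha> 0) t = frac_I (1 - \<beta>) (\<lambda>s. X \<alpha> s - X \<alpha> 0) t"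
      unfolding frac_J_def .
  qed (use \<beta> in auto)
  moreover have "Y \<alpha> 0 = X \<alpha> 0" using X Y \<alpha> unfolding solves_coeffwise_def by simp
  ultimately show ?thesis by simp
qed

text \<open>Only the multi-index \<open>0\<close> and the unit multi-indices contribute, so the sum over all multi-indices is a
  series over \<open>k\<close>, dominated by the assumed one.\<close>

lemma chaos_solution_q_generalized:
  assumes T: "T > 0" and p: "0 < p" "p < 1"
    and q: "\<And>k. k \<ge> 1 \<Longrightarrow> 0 < q k" and sum: "(\<lambda>k. real k powr (- (2 * p)) * q k) summable_on {1..}"
  shows "q_generalized_process q T (chaos_solution p x\<^sub>0 (cos_basis T))"
  unfolding q_generalized_process_def
proof (intro conjI ballI)
  let ?X = "chaos_solution p x\<^sub>0 (cos_basis T)"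
  fix \<alpha> :: "nat \<Rightarrow>\<^sub>0 nat" assume "\<alpha> \<in> multi_indices"
  then show "L2_on {0<..<T} (?X \<alpha>)"
  proof (cases rule: multi_index_cases)
    case zero
    show ?thesis unfolding zero chaos_solution_0 by (rule L2_bounded(1)[OF T, of _ "\<bar>x\<^sub>0\<bar>"]) auto
  next
    case (unit k)
    have "\<bar>frac_I p (cos_basis T k) t\<bar> \<le> sqrt (2 / T) * T powr p / (p * Gamma p)" if t: "t \<in> {0<..<T}" for t
      using t p T by (intro frac_I_abs_le cos_basis_abs_le) auto
    then show ?thesis unfolding unit(2) chaos_solution_single
      by (intro L2_bounded(1)[OF T]) auto
  next
    case other
    show ?thesis unfolding chaos_solution_other[OF other] by (simp add: L2_on_iff)
  qed
next
  let ?X = "chaos_solution p x\<^sub>0 (cos_basis T)" and ?e = "\<lambda>k. Poly_Mapping.single k (1::nat)"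
  let ?g = "\<lambda>\<alpha>. weight_pow q \<alpha> * L2_norm_sq {0<..<T} (?X \<alpha>)"
  obtain C where C: "\<And>k. k \<ge> 1 \<Longrightarrow> L2_norm_sq {0<..<T} (frac_I p (cos_basis T k)) \<le> C * real k powr (- (2 * p))"
    using frac_I_cos_basis_decay[OF T p] by blast
  have inj: "inj_on ?e {1..}"
    by (rule inj_onI) (metis keys_single singleton_inject zero_neq_one)
  have ge: "?g (?e k) = q k * L2_norm_sq {0<..<T} (frac_I p (cos_basis T k))" for k
    unfolding chaos_solution_single by (simp add: weight_pow_def)
  have "(\<lambda>k. C * (real k powr (- (2 * p)) * q k)) summable_on {1..}"
    by (rule summable_on_cmult_right[OF sum])
  then have "(\<lambda>k. q k * L2_norm_sq {0<..<T} (frac_I p (cos_basis T k))) summable_on {1..}"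
  proof (rule summable_on_comparison_test)
    fix k :: nat assume "k \<in> {1..}"
    then have k: "k \<ge> 1" by simp
    show "q k * L2_norm_sq {0<..<T} (frac_I p (cos_basis T k)) \<le> C * (real k powr (- (2 * p)) * q k)"
      using mult_left_mono[OF C[OF k], of "q k"] q[OF k] by (simp add: mult_ac)
    show "0 \<le> q k * L2_norm_sq {0<..<T} (frac_I p (cos_basis T k))"
      using q[OF k] L2_norm_sq_nonneg by simp
  qed
  then have "(?g \<circ> ?e) summable_on {1..}" by (simp only: o_def ge)
  then have "?g summable_on ?e ` {1..}" by (simp only: summable_on_reindex[OF inj])
  then have "?g summable_on insert 0 (?e ` {1..})" by (simp add: summable_on_insert_iff)
  moreover have "(?g summable_on multi_indices) = (?g summable_on insert 0 (?e ` {1..}))"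
  proof (rule summable_on_cong_neutral)
    fix \<alpha> :: "nat \<Rightarrow>\<^sub>0 nat"
    assume \<alpha>: "\<alpha> \<in> multi_indices - insert 0 (?e ` {1..})"
    then have "\<alpha> \<in> multi_indices" by simp
    then show "?g \<alpha> = 0"
    proof (cases rule: multi_index_cases)
      case other
      show ?thesis unfolding chaos_solution_other[OF other] by (simp add: L2_norm_sq_def set_lebesgue_integral_def)
    qed (use \<alpha> in auto)
  next
    fix \<alpha> :: "nat \<Rightarrow>\<^sub>0 nat"
    assume \<alpha>: "\<alpha> \<in> insert 0 (?e ` {1..}) - multi_indices"
    have "\<alpha> \<in> multi_indices" using \<alpha> by (auto simp: multi_indices_def)
    then show "?g \<alpha> = 0" using \<alpha> by simp
  qed simp
  ultimately show "?g summable_on multi_indices" by simp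
qed

theorem theorem3p7:
  fixes M :: "'a measure" and w :: "real \<Rightarrow> 'a \<Rightarrow> real" and \<xi> :: "nat \<Rightarrow> 'a \<Rightarrow> real"
    and T \<beta> \<gamma> X\<^sub>0 :: real
  assumes "T > 0"
    and "brownian_motion M T w"
    and "\<And>k. k \<ge> 1 \<Longrightarrow> has_wiener_integral M T w (cos_basis T k) (\<xi> k)"
    and "0 < \<beta>" "\<beta> < 1" "0 < \<gamma>" "\<gamma> < 1"
    and "\<gamma> - \<beta> \<ge> 1 / 2"
  shows "\<exists>X. solves_coeffwise M T w \<xi> \<beta> \<gamma> X\<^sub>0 X \<and>
    (\<forall>Y. solves_coeffwise M T w \<xi> \<beta> \<gamma> X\<^sub>0 Y \<longrightarrow>
       (\<forall>\<alpha>\<in>multi_indices. AE t in lborel. t \<in> {0<..<T} \<longrightarrow> Y \<alpha> t = X \<alpha> t)) \<and>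
    (\<forall>q :: nat \<Rightarrow> real. (\<forall>k\<ge>1. 0 < q k \<and> q k < 1) \<longrightarrow>
       (\<lambda>k. real k powr (2 * (\<gamma> - \<beta> - 1)) * q k) summable_on {1..} \<longrightarrow>
       q_generalized_process q T X)"
proof -
  interpret brownian_motion M T w by fact
  interpret wiener_chaos M T w "cos_basis T" \<xi>
    using assms cos_basis_orthonormal[OF assms(1)] by unfold_locales auto
  define p where "p = 1 - (\<gamma> - \<beta>)"
  define X where "X = chaos_solution p X\<^sub>0 (cos_basis T)"
  have p: "0 < p" "p < 1" "2 * (\<gamma> - \<beta> - 1) = - (2 * p)" using assms by (auto simp: p_def)
  have X: "solves_coeffwise M T w \<xi> \<beta> \<gamma> X\<^sub>0 X"
    unfolding X_def p_def
    by (rule chaos_solution_solves[where B = "sqrt (2 / T)"])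
       (use assms p cos_basis_abs_le[OF assms(1)] in \<open>auto simp: p_def\<close>)
  moreover have "AE t in lborel. t \<in> {0<..<T} \<longrightarrow> Y \<alpha> t = X \<alpha> t"
    if "solves_coeffwise M T w \<xi> \<beta> \<gamma> X\<^sub>0 Y" "\<alpha> \<in> multi_indices" for Y \<alpha>
    using solves_coeffwise_unique[OF assms(4,5) X that] by eventually_elim auto
  moreover have "q_generalized_process q T X"
    if "\<forall>k\<ge>1. 0 < q k \<and> q k < 1" "(\<lambda>k. real k powr (2 * (\<gamma> - \<beta> - 1)) * q k) summable_on {1..}" for q
    unfolding X_def using that p by (intro chaos_solution_q_generalized assms) auto
  ultimately show ?thesis by blast
qed

end
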